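(* Let $t_0\in\mathbb{R}$, $a>0$, $J=[t_0,t_0+a]$, let $g:J\to\mathbb{R}$ be nondecreasing and left-continuous, let $x_0\in\mathbb{R}^n$, and let $f,h:J\times\mathbb{R}^n\to\mathbb{R}^n$ be functions satisfying: (A0) For every $t\in J$, the function $f(t,\cdot)$ is continuous. (A1) For every $u\in\mathbb{R}^n$, the function $f(\cdot,u)$ is Kurzweil--Stieltjes integrable with respect to $g$ on $J$. (A2) There exists a function $M:J\to[0,\infty)$, Kurzweil--Stieltjes integrable with respect to $g$ on $J$, such that $\left\|\int_c^d f(s,u)\,\mathrm{d}g(s)\right\|\le\int_c^d M(s)\,\mathrm{d}g(s)$ for all $u\in\mathbb{R}^n$ and all $[c,d]\subseteq J$. (A3) For every $v\in\mathbb{R}^n$, the function $h(\cdot,v)$ is regulated on $J$, and there exists a $\mathfrak{D}$-function $\varphi:[0,\infty)\to[0,\infty)$ with $\varphi(t)<t$ for all $t>0$ such that $\|h(t,u)-h(t,v)\|\le\varphi(\|u-v\|)$ for all $u,v\in\mathbb{R}^n$ and $t\in J$. Assume further that $$\liminf_{r\to\infty}\frac{\varphi(r)}{r}<1 .$$ Then there exists a solution $x:J\to\mathbb{R}^n$ of the problem $$x(t)=x_0-h(t_0,x(t_0))+h(t,x(t))+\int_{t_0}^t f(s,x(s))\,\mathrm{d}g(s),\quad t\in J,\qquad x(t_0)=x_0 .$$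
   Context: $\mathbb{R}^n$ carries a norm $\|\cdot\|$. A function $x:[a,b]\to X$ ($X$ a Banach space) is regulated if the one-sided limit $x(t^-)$ exists for every $t\in(a,b]$ and $x(t^+)$ exists for every $t\in[a,b)$. Kurzweil--Stieltjes integral: a gauge on $[a,b]$ is a function $\delta:[a,b]\to(0,\infty)$. A tagged partition $a=s_0\le s_1\le\dots\le s_k=b$ with tags $\tau_i\in[s_{i-1},s_i]$ is $\delta$-fine if $[s_{i-1},s_i]\subset(\tau_i-\delta(\tau_i),\tau_i+\delta(\tau_i))$ for all $i$. A function $f:[a,b]\to\mathbb{R}^n$ is Kurzweil--Stieltjes integrable with respect to $g:[a,b]\to\mathbb{R}$ if there is $\mathcal{I}\in\mathbb{R}^n$ such that for every $\varepsilon>0$ there is a gauge $\delta$ on $[a,b]$ with $\left\|\sum_{i=1}^k f(\tau_i)(g(s_i)-g(s_{i-1}))-\mathcal{I}\right\|<\varepsilon$ for all $\delta$-fine tagged partitions of $[a,b]$; then $\int_a^b f\,\mathrm{d}g:=\mathcal{I}$. All integrals are in this sense. A $\mathfrak{D}$-function is a continuous nondecreasing function $\varphi:[0,\infty)\to[0,\infty)$ with $\varphi(0)=0$ and $\varphi(s)>0$ for $s>0$. A solution of the problem is a regulated function $x:J\to\mathbb{R}^n$ such that $t\mapsto h(t,x(t))$ is regulated on $J$, the integral equation holds for all $t\in J$ (with the integral existing in the Kurzweil--Stieltjes sense), and $x(t_0)=x_0$. *)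

theory Defs
  imports "HOL-Analysis.Analysis"
begin

text \<open>
  The space is \<^typ>\<open>real^'n\<close> with an arbitrary norm \<open>N\<close>, not necessarily the Euclidean
  \<^const>\<open>norm\<close>: contractivity conditions depend on the choice of \<open>N\<close>. Continuity and one-sided
  limits in \<^typ>\<open>real^'n\<close> use the library topology, which every such \<open>N\<close> induces.
\<close>

definition is_norm :: "('a::real_vector \<Rightarrow> real) \<Rightarrow> bool" where
  "is_norm N \<longleftrightarrow>
     (\<forall>x. 0 \<le> N x) \<and> (\<forall>x. N x = 0 \<longleftrightarrow> x = 0) \<and>
     (\<forall>c x. N (c *\<^sub>R x) = \<bar>c\<bar> * N x) \<and> (\<forall>x y. N (x + y) \<le> N x + N y)"

definition regulated_on :: "real \<Rightarrow> real \<Rightarrow> (real \<Rightarrow> 'a::banach) \<Rightarrow> bool" where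
  "regulated_on a b x \<longleftrightarrow>
     (\<forall>t\<in>{a<..b}. \<exists>l. (x \<longlongrightarrow> l) (at_left t)) \<and>
     (\<forall>t\<in>{a..<b}. \<exists>l. (x \<longlongrightarrow> l) (at_right t))"

definition gauge_on :: "real \<Rightarrow> real \<Rightarrow> (real \<Rightarrow> real) \<Rightarrow> bool" where
  "gauge_on a b \<delta> \<longleftrightarrow> (\<forall>t\<in>{a..b}. 0 < \<delta> t)"

text \<open>Division points \<open>s 0, \<dots>, s k\<close> and tags \<open>\<tau> 1, \<dots>, \<tau> k\<close>; other values are irrelevant.\<close>

definition tagged_partition ::
    "real \<Rightarrow> real \<Rightarrow> nat \<Rightarrow> (nat \<Rightarrow> real) \<Rightarrow> (nat \<Rightarrow> real) \<Rightarrow> bool" where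
  "tagged_partition a b k s \<tau> \<longleftrightarrow>
     s 0 = a \<and> s k = b \<and>
     (\<forall>i\<in>{1..k}. s (i - 1) \<le> s i \<and> \<tau> i \<in> {s (i - 1)..s i})"

definition delta_fine ::
    "(real \<Rightarrow> real) \<Rightarrow> nat \<Rightarrow> (nat \<Rightarrow> real) \<Rightarrow> (nat \<Rightarrow> real) \<Rightarrow> bool" where
  "delta_fine \<delta> k s \<tau> \<longleftrightarrow>
     (\<forall>i\<in>{1..k}. {s (i - 1)..s i} \<subseteq> {\<tau> i - \<delta> (\<tau> i)<..<\<tau> i + \<delta> (\<tau> i)})"

definition has_ks_integral ::
    "('a::real_vector \<Rightarrow> real) \<Rightarrow> (real \<Rightarrow> 'a) \<Rightarrow> (real \<Rightarrow> real) \<Rightarrow> real \<Rightarrow> real \<Rightarrow> 'a \<Rightarrow> bool" where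
  "has_ks_integral N f g a b I \<longleftrightarrow>
     (\<forall>\<epsilon>>0. \<exists>\<delta>. gauge_on a b \<delta> \<and>
        (\<forall>k s \<tau>. tagged_partition a b k s \<tau> \<and> delta_fine \<delta> k s \<tau> \<longrightarrow>
           N ((\<Sum>i=1..k. (g (s i) - g (s (i - 1))) *\<^sub>R f (\<tau> i)) - I) < \<epsilon>))"

definition ks_integrable ::
    "('a::real_vector \<Rightarrow> real) \<Rightarrow> (real \<Rightarrow> 'a) \<Rightarrow> (real \<Rightarrow> real) \<Rightarrow> real \<Rightarrow> real \<Rightarrow> bool" where
  "ks_integrable N f g a b \<longleftrightarrow> (\<exists>I. has_ks_integral N f g a b I)"

definition ks_integral ::
    "('a::real_vector \<Rightarrow> real) \<Rightarrow> (real \<Rightarrow> 'a) \<Rightarrow> (real \<Rightarrow> real) \<Rightarrow> real \<Rightarrow> real \<Rightarrow> 'a" where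
  "ks_integral N f g a b = (THE I. has_ks_integral N f g a b I)"

definition D_function :: "(real \<Rightarrow> real) \<Rightarrow> bool" where
  "D_function \<phi> \<longleftrightarrow>
     continuous_on {0..} \<phi> \<and> mono_on {0..} \<phi> \<and> \<phi> 0 = 0 \<and> (\<forall>s>0. 0 < \<phi> s)"

definition is_solution ::
    "(real^'n \<Rightarrow> real) \<Rightarrow> real \<Rightarrow> real \<Rightarrow> (real \<Rightarrow> real) \<Rightarrow>
     (real \<Rightarrow> real^'n \<Rightarrow> real^'n) \<Rightarrow> (real \<Rightarrow> real^'n \<Rightarrow> real^'n) \<Rightarrow> real^'n \<Rightarrow>
     (real \<Rightarrow> real^'n) \<Rightarrow> bool" where
  "is_solution N t\<^sub>0 a g f h x\<^sub>0 x \<longleftrightarrow>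
     regulated_on t\<^sub>0 (t\<^sub>0 + a) x \<and>
     regulated_on t\<^sub>0 (t\<^sub>0 + a) (\<lambda>t. h t (x t)) \<and>
     (\<forall>t\<in>{t\<^sub>0..t\<^sub>0 + a}.
        ks_integrable N (\<lambda>s. f s (x s)) g t\<^sub>0 t \<and>
        x t = x\<^sub>0 - h t\<^sub>0 (x t\<^sub>0) + h t (x t) + ks_integral N (\<lambda>s. f s (x s)) g t\<^sub>0 t) \<and>
     x t\<^sub>0 = x\<^sub>0"

end

theory Submission
  imports Defs "HOL-Complex_Analysis.Great_Picard" "HOL-Real_Asymp.Real_Asymp"
begin

text \<open>
  \<^bold>\<open>Removing the neutral term.\<close> By the contractivity of \<open>h t\<close> the equation \<open>u = w + h t u\<close> has exactly
  one solution \<open>resolvent (h t) w\<close>. So \<open>x\<close> solves the problem iff \<open>x t = resolvent (h t) (w\<^sub>0 + y t)\<close>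
  with \<open>w\<^sub>0 = x\<^sub>0 - h t\<^sub>0 x\<^sub>0\<close>, where \<open>y t\<close> is the integral of \<open>f s (x s)\<close> over \<open>[t\<^sub>0, t]\<close>. Only such
  a \<open>y\<close> has to be found. The condition on the lower limit of \<open>\<phi> r / r\<close> provides arbitrarily large
  balls that \<open>u \<mapsto> w + h t u\<close> maps into themselves; a fixed point in such a ball follows from
  compactness (\<open>fixed_point_in_ball\<close>), and the same argument on small balls makes the resolvent
  continuous in \<open>h t\<close> and \<open>w\<close> together (\<open>resolvent_tendsto\<close>).

  \<^bold>\<open>Approximation.\<close> If the value of \<open>s\<close> in \<open>resolvent (h s) (w\<^sub>0 + y s)\<close> is replaced by the last point
  of a finite grid before \<open>s\<close>, the integrand becomes \<open>f s u\<close> with \<open>u\<close> constant between grid points, and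
  \<open>y\<close> can be found step by step (\<open>euler_primitive\<close>); left continuity of \<open>g\<close> makes the jump at the end of
  a step harmless. All increments of these approximations \<open>z\<^sub>n\<close> are bounded by those of one
  monotone function \<open>m\<close>, a multiple of the integral of \<open>M\<close>, so a subsequence converges pointwise. If the grids
  exhaust a countable set that contains the discontinuities of \<open>m\<close> and of all \<open>h(\<cdot>, v)\<close>, then the arguments
  of \<open>f\<close> converge at every point, and so do the integrands, because \<open>f s\<close> is continuous.

  \<^bold>\<open>Passage to the limit.\<close> It remains to show that the limit of the integrals is the integral of the
  limit (\<open>ks_primitive_dominated_limit\<close>). The bound by \<open>M\<close> concerns integrals of \<open>f\<close>, not its
  values, so the proof works with primitives rather than with the integrands, in Henstock's strong sense: the errors on the single intervals of a fine division have a small sum of norms. If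
  primitives \<open>B\<^sub>n\<close> of functions converging pointwise to \<open>F\<close> converge in variation to \<open>P\<close>, then \<open>P\<close> is a
  primitive of \<open>F\<close>: choose at each tag an index at which the values have come close. Convergence in variation holds
  after passing to convex means of tails, by Mazur's argument in the Hilbert space
  of functions with finite energy \<open>\<integral> |dB|\<^sup>2 / dm\<close>: among the means of later and later tails choose nearly minimal ones; by
  the parallelogram law they form a Cauchy sequence in energy, and energy controls variation.
  The energy is a supremum of sums over divisions, so that only finite sums occur.
\<close>

section \<open>Tagged divisions as lists\<close>

text \<open>
  The integrals are studied with tagged divisions given as lists of triples (left end, tag, right
  end), since gluing and refining divisions then are concatenations of lists.
\<close>

fun tdiv :: "real \<Rightarrow> real \<Rightarrow> (real \<times> real \<times> real) list \<Rightarrow> bool" where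
  "tdiv a b [] \<longleftrightarrow> a = b"
| "tdiv a b ((u, \<tau>, v) # L) \<longleftrightarrow> u = a \<and> u \<le> \<tau> \<and> \<tau> \<le> v \<and> tdiv v b L"

definition fine_div :: "(real \<Rightarrow> real) \<Rightarrow> (real \<times> real \<times> real) list \<Rightarrow> bool" where
  "fine_div \<delta> L \<longleftrightarrow> (\<forall>(u, \<tau>, v)\<in>set L. \<tau> - \<delta> \<tau> < u \<and> v < \<tau> + \<delta> \<tau>)"

lemma tdiv_le: "tdiv a b L \<Longrightarrow> a \<le> b"
  by (induction L arbitrary: a) (auto, force)

lemma tdiv_mem:
  assumes "tdiv a b L" "(u, \<tau>, v) \<in> set L"
  shows "a \<le> u" "u \<le> \<tau>" "\<tau> \<le> v" "v \<le> b"
proof -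
  have "a \<le> u \<and> u \<le> \<tau> \<and> \<tau> \<le> v \<and> v \<le> b"
    using assms
  proof (induction L arbitrary: a)
    case (Cons e L)
    obtain u' \<tau>' v' where e: "e = (u', \<tau>', v')" by (cases e)
    have "tdiv v' b L" "u' = a" "u' \<le> \<tau>'" "\<tau>' \<le> v'" using Cons.prems e by auto
    then show ?case using Cons.IH[of v'] Cons.prems e tdiv_le[of v' b L] by auto
  qed simp
  then show "a \<le> u" "u \<le> \<tau>" "\<tau> \<le> v" "v \<le> b" by auto
qed

lemma tdiv_append: "tdiv a c L \<Longrightarrow> tdiv c b L' \<Longrightarrow> tdiv a b (L @ L')"
  by (induction L arbitrary: a) auto

lemma fine_append [simp]: "fine_div \<delta> (L @ L') \<longleftrightarrow> fine_div \<delta> L \<and> fine_div \<delta> L'"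
  by (simp add: fine_div_def ball_Un)

lemma fine_Nil [simp]: "fine_div \<delta> []"
  by (simp add: fine_div_def)

lemma fine_mono:
  assumes "fine_div \<delta> L" "\<And>t. \<delta> t \<le> \<delta>' t"
  shows "fine_div \<delta>' L"
  unfolding fine_div_def
proof (clarify)
  fix u \<tau> v assume "(u, \<tau>, v) \<in> set L"
  then have "\<tau> - \<delta> \<tau> < u \<and> v < \<tau> + \<delta> \<tau>" using assms(1) by (auto simp: fine_div_def)
  then show "\<tau> - \<delta>' \<tau> < u \<and> v < \<tau> + \<delta>' \<tau>" using assms(2)[of \<tau>] by linarith
qed

lemma dsum_telescope:
  fixes B :: "real \<Rightarrow> 'b::ab_group_add"
  shows "tdiv a b L \<Longrightarrow> (\<Sum>(u, \<tau>, v)\<leftarrow>L. B v - B u) = B b - B a"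
  by (induction L arbitrary: a) auto

text \<open>The way in which divisions are refined below: each interval is replaced by a division of it.\<close>

lemma tdiv_concat:
  "tdiv a b L \<Longrightarrow> (\<And>u \<tau> v. (u, \<tau>, v) \<in> set L \<Longrightarrow> tdiv u v (R (u, \<tau>, v))) \<Longrightarrow>
     tdiv a b (concat (map R L))"
proof (induction L arbitrary: a)
  case (Cons e L)
  obtain u' \<tau>' v' where e: "e = (u', \<tau>', v')" by (cases e)
  have "tdiv a v' (R e)" using Cons.prems e by auto
  moreover have "tdiv v' b (concat (map R L))"
    using Cons.IH[of v'] Cons.prems e by auto
  ultimately show ?case by (simp add: tdiv_append)
qed simp

lemma sum_list_concat_map:
  fixes \<Phi> :: "_ \<Rightarrow> 'b::monoid_add"
  shows "sum_list (map \<Phi> (concat (map R L))) = (\<Sum>e\<leftarrow>L. sum_list (map \<Phi> (R e)))"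
  by (induction L) auto

lemma sum_list_swap:
  fixes \<Phi> :: "_ \<Rightarrow> _ \<Rightarrow> 'b::comm_monoid_add"
  shows "(\<Sum>x\<leftarrow>xs. \<Sum>y\<leftarrow>ys. \<Phi> x y) = (\<Sum>y\<leftarrow>ys. \<Sum>x\<leftarrow>xs. \<Phi> x y)"
  by (induction xs) (auto simp: sum_list_addf)

lemma norm_sum_list_le:
  fixes \<Phi> :: "_ \<Rightarrow> 'b::real_normed_vector"
  shows "norm (\<Sum>x\<leftarrow>xs. \<Phi> x) \<le> (\<Sum>x\<leftarrow>xs. norm (\<Phi> x))"
  by (induction xs) (auto intro: norm_triangle_le)

text \<open>
  Truncating every point of a division to \<open>[c, d]\<close> restricts the division to \<open>[c, d]\<close>. Intervals outside
  \<open>[c, d]\<close> degenerate to points instead of disappearing, so sums over the restriction are sums over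
  the original list.
\<close>

definition clip :: "real \<Rightarrow> real \<Rightarrow> real \<Rightarrow> real" where
  "clip c d t = max c (min d t)"

definition clip_div :: "real \<Rightarrow> real \<Rightarrow> (real \<times> real \<times> real) list \<Rightarrow> (real \<times> real \<times> real) list" where
  "clip_div c d = map (\<lambda>(u, \<tau>, v). (clip c d u, clip c d \<tau>, clip c d v))"

lemma clip_mono: "s \<le> t \<Longrightarrow> clip c d s \<le> clip c d t"
  by (auto simp: clip_def)

lemma tdiv_clip: "tdiv a b L \<Longrightarrow> tdiv (clip c d a) (clip c d b) (clip_div c d L)"
  by (induction L arbitrary: a) (auto simp: clip_div_def intro: clip_mono)

lemma sum_clip_div:
  "sum_list (map (\<lambda>(u, \<tau>, v). \<Phi> u \<tau> v) (clip_div c d L)) =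
    (\<Sum>(u, \<tau>, v)\<leftarrow>L. \<Phi> (clip c d u) (clip c d \<tau>) (clip c d v))"
  by (induction L) (auto simp: clip_div_def)

section \<open>The integral in terms of lists\<close>

lemma tdiv_of_tagged_partition:
  "(\<forall>i\<in>{1..k}. s (i - 1) \<le> s i \<and> \<tau> i \<in> {s (i - 1)..s i}) \<Longrightarrow>
     tdiv (s 0) (s k) (map (\<lambda>i. (s (i - 1), \<tau> i, s i)) [1..<Suc k])"
proof (induction k)
  case (Suc k)
  have "tdiv (s 0) (s k) (map (\<lambda>i. (s (i - 1), \<tau> i, s i)) [1..<Suc k])"
    using Suc by auto
  moreover have "tdiv (s k) (s (Suc k)) [(s k, \<tau> (Suc k), s (Suc k))]"
    using Suc.prems by (auto dest: bspec[where x = "Suc k"])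
  ultimately have "tdiv (s 0) (s (Suc k)) (map (\<lambda>i. (s (i - 1), \<tau> i, s i)) [1..<Suc k] @ [(s k, \<tau> (Suc k), s (Suc k))])"
    by (rule tdiv_append)
  then show ?case by simp
qed simp

lemma tagged_partition_of_tdiv:
  "tdiv a b L \<Longrightarrow> \<exists>k s \<tau>. tagged_partition a b k s \<tau> \<and> L = map (\<lambda>i. (s (i - 1), \<tau> i, s i)) [1..<Suc k]"
proof (induction L arbitrary: a)
  case Nil
  then show ?case by (intro exI[of _ 0] exI[of _ "\<lambda>_. a"]) (auto simp: tagged_partition_def)
next
  case (Cons e L)
  obtain u \<sigma> v where e: "e = (u, \<sigma>, v)" by (cases e)
  obtain k s \<tau> where k: "tagged_partition v b k s \<tau>" "L = map (\<lambda>i. (s (i - 1), \<tau> i, s i)) [1..<Suc k]"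
    using Cons.IH[of v] Cons.prems e by auto
  define s' where "s' = (\<lambda>i. case i of 0 \<Rightarrow> a | Suc j \<Rightarrow> s j)"
  define \<tau>' where "\<tau>' = (\<lambda>i. case i of 0 \<Rightarrow> a | Suc 0 \<Rightarrow> \<sigma> | Suc (Suc j) \<Rightarrow> \<tau> (Suc j))"
  have "s' (i - 1) \<le> s' i \<and> \<tau>' i \<in> {s' (i - 1)..s' i}" if "i \<in> {1..Suc k}" for i
  proof (cases "i = 1")
    case True
    then show ?thesis using Cons.prems e k(1)
      by (auto simp: s'_def \<tau>'_def tagged_partition_def)
  next
    case False
    define j where "j = i - 2"
    have "i = Suc (Suc j)" "Suc j \<in> {1..k}"
      using that False unfolding j_def by auto
    then show ?thesis using k(1)
      by (auto simp: s'_def \<tau>'_def tagged_partition_def dest: bspec[where x = "Suc j"])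
  qed
  then have "tagged_partition a b (Suc k) s' \<tau>'"
    using k(1) by (auto simp: tagged_partition_def s'_def)
  moreover have "e # L = map (\<lambda>i. (s' (i - 1), \<tau>' i, s' i)) [1..<Suc (Suc k)]"
  proof -
    have "[1..<Suc (Suc k)] = 1 # map Suc [1..<Suc k]"
      by (subst map_Suc_upt, subst upt_conv_Cons) auto
    moreover have "map (\<lambda>i. (s' (i - 1), \<tau>' i, s' i)) (map Suc [1..<Suc k])
       = map (\<lambda>i. (s (i - 1), \<tau> i, s i)) [1..<Suc k]"
      unfolding map_map by (rule map_cong) (auto simp: s'_def \<tau>'_def split: nat.splits)
    ultimately show ?thesis using k Cons.prems e
      by (simp add: s'_def \<tau>'_def tagged_partition_def)
  qed
  ultimately show ?case
    by (intro exI[of _ "Suc k"] exI[of _ s'] exI[of _ \<tau>'] conjI)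
qed

lemma has_ks_integral_iff_tdiv:
  "has_ks_integral N F g a b I \<longleftrightarrow>
    (\<forall>\<epsilon>>0. \<exists>\<delta>. gauge_on a b \<delta> \<and>
      (\<forall>L. tdiv a b L \<and> fine_div \<delta> L \<longrightarrow> N ((\<Sum>(u, \<tau>, v)\<leftarrow>L. (g v - g u) *\<^sub>R F \<tau>) - I) < \<epsilon>))"
proof -
  have fine: "delta_fine \<delta> k s \<tau> \<longleftrightarrow> fine_div \<delta> (map (\<lambda>i. (s (i - 1), \<tau> i, s i)) [1..<Suc k])"
    if "tagged_partition a b k s \<tau>" for \<delta> k s \<tau>
  proof -
    have "{s (i - 1)..s i} \<subseteq> {\<tau> i - \<delta> (\<tau> i)<..<\<tau> i + \<delta> (\<tau> i)} \<longleftrightarrow>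
        \<tau> i - \<delta> (\<tau> i) < s (i - 1) \<and> s i < \<tau> i + \<delta> (\<tau> i)" if "i \<in> {1..k}" for i
    proof -
      have "s (i - 1) \<le> s i" using \<open>tagged_partition a b k s \<tau>\<close> that by (auto simp: tagged_partition_def)
      then show ?thesis by auto
    qed
    then show ?thesis by (auto simp: delta_fine_def fine_div_def less_Suc_eq_le)
  qed
  have sum: "(\<Sum>(u, \<tau>, v)\<leftarrow>map (\<lambda>i. (s (i - 1), \<tau> i, s i)) [1..<Suc k]. (g v - g u) *\<^sub>R F \<tau>)
     = (\<Sum>i=1..k. (g (s i) - g (s (i - 1))) *\<^sub>R F (\<tau> i))" for k s \<tau>
    by (simp add: interv_sum_list_conv_sum_set_nat atLeastLessThanSuc_atLeastAtMost comp_def del: upt_Suc)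
  have "(\<forall>k s \<tau>. tagged_partition a b k s \<tau> \<and> delta_fine \<delta> k s \<tau> \<longrightarrow>
           N ((\<Sum>i=1..k. (g (s i) - g (s (i - 1))) *\<^sub>R F (\<tau> i)) - I) < \<epsilon>) \<longleftrightarrow>
        (\<forall>L. tdiv a b L \<and> fine_div \<delta> L \<longrightarrow> N ((\<Sum>(u, \<tau>, v)\<leftarrow>L. (g v - g u) *\<^sub>R F \<tau>) - I) < \<epsilon>)" (is "?A = ?B")
    for \<delta> \<epsilon>
  proof
    assume A: ?A
    show ?B
    proof (intro allI impI, elim conjE)
      fix L assume "tdiv a b L" "fine_div \<delta> L"
      then obtain k s \<tau> where k: "tagged_partition a b k s \<tau>" "L = map (\<lambda>i. (s (i - 1), \<tau> i, s i)) [1..<Suc k]"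
        using tagged_partition_of_tdiv by blast
      then have "delta_fine \<delta> k s \<tau>" using fine \<open>fine_div \<delta> L\<close> by blast
      then show "N ((\<Sum>(u, \<tau>, v)\<leftarrow>L. (g v - g u) *\<^sub>R F \<tau>) - I) < \<epsilon>"
        using A k(1) unfolding k(2) sum by blast
    qed
  next
    assume B: ?B
    show ?A
    proof (intro allI impI, elim conjE)
      fix k s \<tau> assume k: "tagged_partition a b k s \<tau>" "delta_fine \<delta> k s \<tau>"
      let ?L = "map (\<lambda>i. (s (i - 1), \<tau> i, s i)) [1..<Suc k]"
      have "tdiv a b ?L" using k(1) tdiv_of_tagged_partition[of k s \<tau>] by (simp add: tagged_partition_def)
      moreover have "fine_div \<delta> ?L" using fine k by blast
      ultimately have "N ((\<Sum>(u, \<tau>, v)\<leftarrow>?L. (g v - g u) *\<^sub>R F \<tau>) - I) < \<epsilon>" using B by blast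
      then show "N ((\<Sum>i=1..k. (g (s i) - g (s (i - 1))) *\<^sub>R F (\<tau> i)) - I) < \<epsilon>" by (simp only: sum)
    qed
  qed
  then show ?thesis unfolding has_ks_integral_def by simp
qed

text \<open>Cousin's lemma, an instance of the bisection principle \<open>Bolzano\<close>.\<close>

lemma fine_division_exists:
  assumes "a \<le> b" "gauge_on a b \<delta>"
  shows "\<exists>L. tdiv a b L \<and> fine_div \<delta> L"
proof -
  have "a \<le> a' \<longrightarrow> b' \<le> b \<longrightarrow> a' \<le> b' \<longrightarrow> (\<exists>L. tdiv a' b' L \<and> fine_div \<delta> L)" if "a' = a" "b' = b" for a' b'
  proof -
    have "a' \<le> b'" using that assms by simp
    then have "a' \<le> b' \<longrightarrow> (\<exists>L. tdiv a' b' L \<and> fine_div \<delta> L)"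
    proof (induction rule: Bolzano)
      case (trans x y z)
      then show ?case using tdiv_append by (metis fine_append)
    next
      case (local x)
      then have "\<delta> x > 0" using assms that by (auto simp: gauge_on_def)
      moreover have "\<exists>L. tdiv c d L \<and> fine_div \<delta> L" if "c \<le> x" "x \<le> d" "d - c < \<delta> x" for c d
        using that by (intro exI[of _ "[(c, x, d)]"]) (auto simp: fine_div_def)
      ultimately show ?case by blast
    qed
    then show ?thesis by blast
  qed
  then show ?thesis using assms by auto
qed

lemma gauge_on_subset: "gauge_on a b \<delta> \<Longrightarrow> a \<le> c \<Longrightarrow> d \<le> b \<Longrightarrow> gauge_on c d \<delta>"
  by (auto simp: gauge_on_def)

lemma gauge_on_min: "gauge_on a b \<delta> \<Longrightarrow> gauge_on a b \<delta>' \<Longrightarrow> gauge_on a b (\<lambda>t. min (\<delta> t) (\<delta>' t))"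
  by (auto simp: gauge_on_def)

lemma fine_min: "fine_div (\<lambda>t. min (\<delta> t) (\<delta>' t)) L \<longleftrightarrow> fine_div \<delta> L \<and> fine_div \<delta>' L"
proof -
  have "\<tau> - min x y < u \<and> v < \<tau> + min x y \<longleftrightarrow> (\<tau> - x < u \<and> v < \<tau> + x) \<and> (\<tau> - y < u \<and> v < \<tau> + y)"
    for \<tau> u v x y :: real by linarith
  then show ?thesis unfolding fine_div_def case_prod_unfold by blast
qed

section \<open>Primitives\<close>

text \<open>
  The norms are taken inside the sum, so this is the conclusion of Henstock's lemma and not just
  the statement that the increments of \<open>P\<close> are integrals of \<open>F\<close>. In this form restriction to
  subintervals, gluing, and limits are direct estimates.
\<close>

definition ks_primitive ::
    "(real \<Rightarrow> real) \<Rightarrow> real \<Rightarrow> real \<Rightarrow> (real \<Rightarrow> 'a::real_normed_vector) \<Rightarrow> (real \<Rightarrow> 'a) \<Rightarrow> bool" where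
  "ks_primitive g a b F P \<longleftrightarrow>
    (\<forall>\<epsilon>>0. \<exists>\<delta>. gauge_on a b \<delta> \<and>
      (\<forall>L. tdiv a b L \<and> fine_div \<delta> L \<longrightarrow>
        (\<Sum>(u, \<tau>, v)\<leftarrow>L. norm ((g v - g u) *\<^sub>R F \<tau> - (P v - P u))) \<le> \<epsilon>))"

lemma ks_primitiveD:
  assumes "ks_primitive g a b F P" "\<epsilon> > 0"
  obtains \<delta> where "gauge_on a b \<delta>"
    "\<And>L. tdiv a b L \<Longrightarrow> fine_div \<delta> L \<Longrightarrow>
        (\<Sum>(u, \<tau>, v)\<leftarrow>L. norm ((g v - g u) *\<^sub>R F \<tau> - (P v - P u))) \<le> \<epsilon>"
  using assms unfolding ks_primitive_def by blast

text \<open>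
  A fine collection of some of the intervals of a division extends to a fine division,
  since the other intervals have fine divisions themselves. Hence the estimate that defines a
  primitive also holds for such partial divisions.
\<close>

lemma dsum_filter_le_fine:
  fixes \<Psi> :: "real \<Rightarrow> real \<Rightarrow> real \<Rightarrow> real"
  assumes \<delta>: "gauge_on a b \<delta>" and L: "tdiv a b L"
    and A: "\<And>u \<tau> v. (u, \<tau>, v) \<in> set L \<Longrightarrow> A (u, \<tau>, v) \<Longrightarrow> \<tau> - \<delta> \<tau> < u \<and> v < \<tau> + \<delta> \<tau>"
    and pos: "\<And>u \<tau> v. 0 \<le> \<Psi> u \<tau> v"
    and le: "\<And>L. tdiv a b L \<Longrightarrow> fine_div \<delta> L \<Longrightarrow> (\<Sum>(u, \<tau>, v)\<leftarrow>L. \<Psi> u \<tau> v) \<le> \<epsilon>"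
  shows "(\<Sum>(u, \<tau>, v)\<leftarrow>L. if A (u, \<tau>, v) then \<Psi> u \<tau> v else 0) \<le> \<epsilon>"
proof -
  have "\<exists>M. tdiv u v M \<and> fine_div \<delta> M \<and> (A (u, \<tau>, v) \<longrightarrow> M = [(u, \<tau>, v)])"
    if "(u, \<tau>, v) \<in> set L" for u \<tau> v
  proof (cases "A (u, \<tau>, v)")
    case True
    then show ?thesis using A[OF that] tdiv_mem[OF L that]
      by (intro exI[of _ "[(u, \<tau>, v)]"]) (auto simp: fine_div_def)
  next
    case False
    have "gauge_on u v \<delta>" using gauge_on_subset[OF \<delta>] tdiv_mem[OF L that] by blast
    moreover have "u \<le> v" using tdiv_mem[OF L that] by linarith
    ultimately show ?thesis using fine_division_exists[of u v \<delta>] False by auto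
  qed
  then have "\<forall>e\<in>set L. \<exists>M. tdiv (fst e) (snd (snd e)) M \<and> fine_div \<delta> M \<and> (A e \<longrightarrow> M = [e])"
    by auto
  then obtain R where R: "\<And>e. e \<in> set L \<Longrightarrow> tdiv (fst e) (snd (snd e)) (R e) \<and> fine_div \<delta> (R e) \<and> (A e \<longrightarrow> R e = [e])"
    by metis
  have "tdiv a b (concat (map R L))"
    by (rule tdiv_concat[OF L]) (use R in fastforce)
  moreover have "fine_div \<delta> (concat (map R L))"
    unfolding fine_div_def set_concat using R by (force simp: fine_div_def)
  ultimately have "(\<Sum>(u, \<tau>, v)\<leftarrow>concat (map R L). \<Psi> u \<tau> v) \<le> \<epsilon>" by (rule le)
  moreover have "(\<Sum>(u, \<tau>, v)\<leftarrow>L. if A (u, \<tau>, v) then \<Psi> u \<tau> v else 0)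
      \<le> (\<Sum>(u, \<tau>, v)\<leftarrow>concat (map R L). \<Psi> u \<tau> v)"
    unfolding sum_list_concat_map
  proof (rule sum_list_mono, clarify)
    fix u \<tau> v assume e: "(u, \<tau>, v) \<in> set L"
    show "(if A (u, \<tau>, v) then \<Psi> u \<tau> v else 0) \<le> (\<Sum>(u, \<tau>, v)\<leftarrow>R (u, \<tau>, v). \<Psi> u \<tau> v)"
      using R[OF e] pos by (auto intro!: sum_list_nonneg)
  qed
  ultimately show ?thesis by linarith
qed

lemma ks_primitive_subinterval:
  assumes P: "ks_primitive g a b F P" and cd: "a \<le> c" "c \<le> d" "d \<le> b"
  shows "ks_primitive g c d F P"
  unfolding ks_primitive_def
proof (intro allI impI)
  fix \<epsilon> :: real assume "\<epsilon> > 0"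
  then obtain \<delta> where \<delta>: "gauge_on a b \<delta>"
    "\<And>L. tdiv a b L \<Longrightarrow> fine_div \<delta> L \<Longrightarrow>
        (\<Sum>(u, \<tau>, v)\<leftarrow>L. norm ((g v - g u) *\<^sub>R F \<tau> - (P v - P u))) \<le> \<epsilon>"
    using ks_primitiveD[OF P] by blast
  obtain L1 L2 where L12: "tdiv a c L1" "fine_div \<delta> L1" "tdiv d b L2" "fine_div \<delta> L2"
    using fine_division_exists[of a c \<delta>] fine_division_exists[of d b \<delta>] \<delta>(1) cd
      gauge_on_subset[OF \<delta>(1)] by (metis order.refl order.trans)
  have "(\<Sum>(u, \<tau>, v)\<leftarrow>L. norm ((g v - g u) *\<^sub>R F \<tau> - (P v - P u))) \<le> \<epsilon>"
    if "tdiv c d L" "fine_div \<delta> L" for L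
  proof -
    have nn: "0 \<le> (\<Sum>(u, \<tau>, v)\<leftarrow>M. norm ((g v - g u) *\<^sub>R F \<tau> - (P v - P u)))" for M
      by (rule sum_list_nonneg) auto
    have "tdiv a b (L1 @ L @ L2)" "fine_div \<delta> (L1 @ L @ L2)"
      using that L12 by (auto intro!: tdiv_append)
    then show ?thesis using \<delta>(2)[of "L1 @ L @ L2"] nn[of L1] nn[of L2] by simp
  qed
  then show "\<exists>\<delta>. gauge_on c d \<delta> \<and> (\<forall>L. tdiv c d L \<and> fine_div \<delta> L \<longrightarrow>
      (\<Sum>(u, \<tau>, v)\<leftarrow>L. norm ((g v - g u) *\<^sub>R F \<tau> - (P v - P u))) \<le> \<epsilon>)"
    using gauge_on_subset[OF \<delta>(1)] cd by blast
qed

lemma ks_primitive_cong: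
  assumes "ks_primitive g a b F P" "\<And>t. t \<in> {a..b} \<Longrightarrow> F t = F' t"
    "\<And>s t. a \<le> s \<Longrightarrow> s \<le> t \<Longrightarrow> t \<le> b \<Longrightarrow> P t - P s = P' t - P' s"
  shows "ks_primitive g a b F' P'"
proof -
  have "(\<Sum>(u, \<tau>, v)\<leftarrow>L. norm ((g v - g u) *\<^sub>R F \<tau> - (P v - P u))) =
     (\<Sum>(u, \<tau>, v)\<leftarrow>L. norm ((g v - g u) *\<^sub>R F' \<tau> - (P' v - P' u)))" if L: "tdiv a b L" for L
  proof (rule arg_cong[of _ _ sum_list], rule map_cong[OF refl], clarify)
    fix u \<tau> v assume "(u, \<tau>, v) \<in> set L"
    from tdiv_mem[OF L this] show "norm ((g v - g u) *\<^sub>R F \<tau> - (P v - P u)) =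
      norm ((g v - g u) *\<^sub>R F' \<tau> - (P' v - P' u))"
      using assms(2)[of \<tau>] assms(3)[of u v] by simp
  qed
  then show ?thesis using assms(1) unfolding ks_primitive_def by (simp cong: conj_cong imp_cong)
qed

lemma ks_primitive_imp_approx:
  assumes P: "ks_primitive g a b F P" and "\<epsilon> > 0"
  shows "\<exists>\<delta>. gauge_on a b \<delta> \<and> (\<forall>L. tdiv a b L \<and> fine_div \<delta> L \<longrightarrow>
      norm ((\<Sum>(u, \<tau>, v)\<leftarrow>L. (g v - g u) *\<^sub>R F \<tau>) - (P b - P a)) \<le> \<epsilon>)"
proof -
  obtain \<delta> where \<delta>: "gauge_on a b \<delta>"
    "\<And>L. tdiv a b L \<Longrightarrow> fine_div \<delta> L \<Longrightarrow>
        (\<Sum>(u, \<tau>, v)\<leftarrow>L. norm ((g v - g u) *\<^sub>R F \<tau> - (P v - P u))) \<le> \<epsilon>"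
    using ks_primitiveD[OF assms] by blast
  have "norm ((\<Sum>(u, \<tau>, v)\<leftarrow>L. (g v - g u) *\<^sub>R F \<tau>) - (P b - P a)) \<le> \<epsilon>"
    if L: "tdiv a b L" "fine_div \<delta> L" for L
  proof -
    have "(\<Sum>(u, \<tau>, v)\<leftarrow>L. (g v - g u) *\<^sub>R F \<tau>) - (P b - P a) =
        (\<Sum>(u, \<tau>, v)\<leftarrow>L. (g v - g u) *\<^sub>R F \<tau>) - (\<Sum>(u, \<tau>, v)\<leftarrow>L. P v - P u)"
      using dsum_telescope[OF L(1)] by metis
    also have "\<dots> = (\<Sum>(u, \<tau>, v)\<leftarrow>L. (g v - g u) *\<^sub>R F \<tau> - (P v - P u))"
      by (simp add: sum_list_subtractf[symmetric] case_prod_unfold)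
    finally have "norm ((\<Sum>(u, \<tau>, v)\<leftarrow>L. (g v - g u) *\<^sub>R F \<tau>) - (P b - P a))
       \<le> (\<Sum>(u, \<tau>, v)\<leftarrow>L. norm ((g v - g u) *\<^sub>R F \<tau> - (P v - P u)))"
      using norm_sum_list_le[of "\<lambda>(u, \<tau>, v). (g v - g u) *\<^sub>R F \<tau> - (P v - P u)" L]
      by (simp add: case_prod_unfold)
    with \<delta>(2)[OF L] show ?thesis by linarith
  qed
  with \<delta>(1) show ?thesis by blast
qed

lemma ks_primitive_imp_integral:
  assumes P: "ks_primitive g a b F P" and cd: "a \<le> c" "c \<le> d" "d \<le> b"
  shows "has_ks_integral norm F g c d (P d - P c)"
  unfolding has_ks_integral_iff_tdiv
proof (intro allI impI)
  fix \<epsilon> :: real assume "\<epsilon> > 0"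
  then have "\<epsilon> / 2 > 0" "\<epsilon> / 2 < \<epsilon>" by auto
  with ks_primitive_imp_approx[OF ks_primitive_subinterval[OF P cd], of "\<epsilon> / 2"]
  show "\<exists>\<delta>. gauge_on c d \<delta> \<and> (\<forall>L. tdiv c d L \<and> fine_div \<delta> L \<longrightarrow>
      norm ((\<Sum>(u, \<tau>, v)\<leftarrow>L. (g v - g u) *\<^sub>R F \<tau>) - (P d - P c)) < \<epsilon>)"
    by (meson order.strict_trans1)
qed

text \<open>
  Uniqueness depends on the existence of a division that is fine for two gauges at the same time.
\<close>

lemma has_ks_integral_unique:
  fixes F :: "real \<Rightarrow> 'a::real_normed_vector"
  assumes "a \<le> b" "has_ks_integral norm F g a b I" "has_ks_integral norm F g a b I'"
  shows "I = I'"
proof (rule ccontr)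
  assume "I \<noteq> I'"
  define \<epsilon> where "\<epsilon> = norm (I - I') / 2"
  have "\<epsilon> > 0" using \<open>I \<noteq> I'\<close> by (simp add: \<epsilon>_def)
  let ?S = "\<lambda>L. \<Sum>(u, \<tau>, v)\<leftarrow>L. (g v - g u) *\<^sub>R F \<tau>"
  obtain \<delta> \<delta>' where "gauge_on a b \<delta>" "gauge_on a b \<delta>'"
    and \<delta>: "\<And>L. tdiv a b L \<Longrightarrow> fine_div \<delta> L \<Longrightarrow> norm (?S L - I) < \<epsilon>"
    and \<delta>': "\<And>L. tdiv a b L \<Longrightarrow> fine_div \<delta>' L \<Longrightarrow> norm (?S L - I') < \<epsilon>"
    using assms(2,3) \<open>\<epsilon> > 0\<close> unfolding has_ks_integral_iff_tdiv by metis
  then obtain L where L: "tdiv a b L" "fine_div \<delta> L" "fine_div \<delta>' L"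
    using fine_division_exists[OF assms(1) gauge_on_min] by (metis fine_min)
  have "norm (I - I') \<le> norm (?S L - I) + norm (?S L - I')"
    using norm_triangle_ineq4[of "?S L - I'" "?S L - I"] by (simp add: algebra_simps)
  also have "\<dots> < \<epsilon> + \<epsilon>" using \<delta>[OF L(1,2)] \<delta>'[OF L(1,3)] by linarith
  finally show False by (simp add: \<epsilon>_def)
qed

section \<open>Henstock's lemma\<close>

text \<open>
  The Cauchy criterion: two fine divisions of \<open>[c, d]\<close> extend by the same divisions of \<open>[a, c]\<close>
  and \<open>[d, b]\<close>, so their Riemann sums are as close as those over \<open>[a, b]\<close>. One sequence of gauges serves all
  subintervals.
\<close>

lemma integrable_on_subinterval_limit:
  fixes F :: "real \<Rightarrow> 'a::banach"
  assumes I: "has_ks_integral norm F g a b I"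
  shows "\<exists>\<Delta>. (\<forall>n::nat. gauge_on a b (\<Delta> n)) \<and>
    (\<forall>c d. a \<le> c \<and> c \<le> d \<and> d \<le> b \<longrightarrow> (\<exists>J. \<forall>n L. tdiv c d L \<and> fine_div (\<Delta> n) L \<longrightarrow>
       norm ((\<Sum>(u, \<tau>, v)\<leftarrow>L. (g v - g u) *\<^sub>R F \<tau>) - J) \<le> 2 / Suc n))"
proof -
  let ?S = "\<lambda>L. \<Sum>(u, \<tau>, v)\<leftarrow>L. (g v - g u) *\<^sub>R F \<tau>"
  have "\<forall>n. \<exists>\<delta>. gauge_on a b \<delta> \<and> (\<forall>L. tdiv a b L \<and> fine_div \<delta> L \<longrightarrow> norm (?S L - I) < 1 / Suc n)"
    using I unfolding has_ks_integral_iff_tdiv by simp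
  then obtain \<Delta>0 where \<Delta>0: "\<And>n. gauge_on a b (\<Delta>0 n)"
    "\<And>n L. tdiv a b L \<Longrightarrow> fine_div (\<Delta>0 n) L \<Longrightarrow> norm (?S L - I) < 1 / Suc n" by metis
  \<comment> \<open>minima of the first gauges, so that fineness for a larger index is the stronger property\<close>
  define \<Delta> where "\<Delta> n t = Min ((\<lambda>i. \<Delta>0 i t) ` {..n})" for n t
  have \<Delta>_le: "\<Delta> n t \<le> \<Delta> m t" if "m \<le> n" for m n t
    unfolding \<Delta>_def using that by (intro Min_antimono) auto
  have \<Delta>_le0: "\<Delta> n t \<le> \<Delta>0 n t" for n t
    unfolding \<Delta>_def by (rule Min_le) auto
  have g\<Delta>: "gauge_on a b (\<Delta> n)" for n
    using \<Delta>0(1) by (auto simp: gauge_on_def \<Delta>_def)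
  have fine_le: "fine_div (\<Delta> m) L" if "m \<le> n" "fine_div (\<Delta> n) L" for m n L
    using that \<Delta>_le[OF that(1)] by (blast intro: fine_mono)
  have fine0: "fine_div (\<Delta>0 n) L" if "fine_div (\<Delta> n) L" for n L
    using that \<Delta>_le0[of n] by (blast intro: fine_mono)
  have "\<exists>J. \<forall>n L. tdiv c d L \<and> fine_div (\<Delta> n) L \<longrightarrow> norm (?S L - J) \<le> 2 / Suc n"
    if cd: "a \<le> c" "c \<le> d" "d \<le> b" for c d
  proof -
    have close: "norm (?S L - ?S L') < 2 / Suc n"
      if L: "tdiv c d L" "fine_div (\<Delta> n) L" "tdiv c d L'" "fine_div (\<Delta> n) L'" for L L' n
    proof -
      obtain L1 L2 where L12: "tdiv a c L1" "fine_div (\<Delta> n) L1" "tdiv d b L2" "fine_div (\<Delta> n) L2"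
        using fine_division_exists[of a c "\<Delta> n"] fine_division_exists[of d b "\<Delta> n"] cd
          gauge_on_subset[OF g\<Delta>] by (metis order.refl order.trans)
      have "norm (?S (L1 @ L @ L2) - I) < 1 / Suc n" "norm (?S (L1 @ L' @ L2) - I) < 1 / Suc n"
        using tdiv_append[OF L12(1) tdiv_append[OF L(1) L12(3)]] tdiv_append[OF L12(1) tdiv_append[OF L(3) L12(3)]] L L12
        by - ((intro \<Delta>0(2) fine0; simp)+)
      then have "norm ((?S (L1 @ L @ L2) - I) - (?S (L1 @ L' @ L2) - I)) < 1 / Suc n + 1 / Suc n"
        using norm_triangle_ineq4[of "?S (L1 @ L @ L2) - I" "?S (L1 @ L' @ L2) - I"] by linarith
      then show ?thesis by (simp add: algebra_simps)
    qed
    have "\<forall>n. \<exists>L. tdiv c d L \<and> fine_div (\<Delta> n) L"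
      using fine_division_exists[OF cd(2)] gauge_on_subset[OF g\<Delta> cd(1,3)] by blast
    then obtain X where X: "\<And>n. tdiv c d (X n)" "\<And>n. fine_div (\<Delta> n) (X n)" by metis
    have tend: "(\<lambda>n. 2 / real (Suc n)) \<longlonglongrightarrow> 0" by real_asymp
    have "Cauchy (\<lambda>n. ?S (X n))"
    proof (rule CauchyI)
      fix e :: real assume "e > 0"
      then obtain M where M: "2 / Suc M < e"
        using LIMSEQ_D[OF tend, of e] by auto
      have "norm (?S (X m) - ?S (X n)) < e" if "m \<ge> M" "n \<ge> M" for m n
        using close[OF X(1) fine_le[OF that(1) X(2)] X(1) fine_le[OF that(2) X(2)]] M by linarith
      then show "\<exists>M. \<forall>m\<ge>M. \<forall>n\<ge>M. norm (?S (X m) - ?S (X n)) < e" by blast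
    qed
    then obtain J where J: "(\<lambda>n. ?S (X n)) \<longlonglongrightarrow> J" using Cauchy_convergent convergent_def by blast
    have "norm (?S L - J) \<le> 2 / Suc n" if L: "tdiv c d L" "fine_div (\<Delta> n) L" for n L
    proof (rule LIMSEQ_le_const2[of "\<lambda>k. norm (?S L - ?S (X k))"])
      show "(\<lambda>k. norm (?S L - ?S (X k))) \<longlonglongrightarrow> norm (?S L - J)" by (intro tendsto_intros J)
      show "\<exists>N. \<forall>k\<ge>N. norm (?S L - ?S (X k)) \<le> 2 / Suc n"
        using close[OF L X(1) fine_le[OF _ X(2)]] by (meson less_imp_le)
    qed
    then show ?thesis by blast
  qed
  then show ?thesis using g\<Delta> by blast
qed

lemma ks_integral_additive_primitive:
  fixes F :: "real \<Rightarrow> 'a::banach"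
  assumes "a \<le> b" and I: "has_ks_integral norm F g a b I"
  shows "\<exists>P. \<forall>c d. a \<le> c \<and> c \<le> d \<and> d \<le> b \<longrightarrow> has_ks_integral norm F g c d (P d - P c)"
proof -
  let ?S = "\<lambda>L. \<Sum>(u, \<tau>, v)\<leftarrow>L. (g v - g u) *\<^sub>R F \<tau>"
  obtain \<Delta> J where g\<Delta>: "\<And>n. gauge_on a b (\<Delta> n)"
    and J: "\<And>c d n L. a \<le> c \<Longrightarrow> c \<le> d \<Longrightarrow> d \<le> b \<Longrightarrow> tdiv c d L \<Longrightarrow> fine_div (\<Delta> n) L \<Longrightarrow>
      norm (?S L - J c d) \<le> 2 / Suc n"
    using integrable_on_subinterval_limit[OF I] by metis
  have tend: "(\<lambda>n. 6 / real (Suc n)) \<longlonglongrightarrow> 0" "(\<lambda>n. 2 / real (Suc n)) \<longlonglongrightarrow> 0" by real_asymp+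
  have add: "J a d = J a c + J c d" if cd: "a \<le> c" "c \<le> d" "d \<le> b" for c d
  proof -
    have "norm (J a c + J c d - J a d) \<le> 6 / Suc n" for n
    proof -
      obtain L1 L2 where L12: "tdiv a c L1" "fine_div (\<Delta> n) L1" "tdiv c d L2" "fine_div (\<Delta> n) L2"
        using fine_division_exists[of a c "\<Delta> n"] fine_division_exists[of c d "\<Delta> n"] cd
          gauge_on_subset[OF g\<Delta>] by (metis order.refl order.trans)
      have "norm (?S L1 - J a c) \<le> 2 / Suc n" "norm (?S L2 - J c d) \<le> 2 / Suc n"
        "norm (?S (L1 @ L2) - J a d) \<le> 2 / Suc n"
        using L12 cd by (intro J tdiv_append[of a c L1 d L2]; simp)+
      moreover have "norm (J a c + J c d - J a d) = norm ((?S (L1 @ L2) - J a d) - (?S L1 - J a c) - (?S L2 - J c d))"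
        by (rule arg_cong[of _ _ norm]) (simp add: algebra_simps)
      moreover have "6 / real (Suc n) = 2 / Suc n + 2 / Suc n + 2 / Suc n" by simp
      ultimately show ?thesis
        using norm_triangle_ineq4[of "?S (L1 @ L2) - J a d - (?S L1 - J a c)" "?S L2 - J c d"]
          norm_triangle_ineq4[of "?S (L1 @ L2) - J a d" "?S L1 - J a c"] by linarith
    qed
    then have "norm (J a c + J c d - J a d) \<le> 0"
      using LIMSEQ_le_const[OF tend(1)] by blast
    then show ?thesis by simp
  qed
  have "has_ks_integral norm F g c d (J a d - J a c)" if cd: "a \<le> c" "c \<le> d" "d \<le> b" for c d
    unfolding has_ks_integral_iff_tdiv
  proof (intro allI impI)
    fix \<epsilon> :: real assume "\<epsilon> > 0"
    then obtain n where "2 / Suc n < \<epsilon>" using LIMSEQ_D[OF tend(2), of \<epsilon>] by auto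
    then have "norm (?S L - (J a d - J a c)) < \<epsilon>" if "tdiv c d L" "fine_div (\<Delta> n) L" for L
      using J[OF cd that] add[OF cd] by simp
    then show "\<exists>\<delta>. gauge_on c d \<delta> \<and> (\<forall>L. tdiv c d L \<and> fine_div \<delta> L \<longrightarrow> norm (?S L - (J a d - J a c)) < \<epsilon>)"
      using gauge_on_subset[OF g\<Delta> cd(1,3)] by blast
  qed
  then show ?thesis by blast
qed

text \<open>
  The Saks-Henstock argument: on the intervals outside \<open>A\<close> replace the given division by one whose
  Riemann sum is practically the increment of \<open>P\<close>. The result is still a fine division of \<open>[a, b]\<close>, and its
  total error is practically the error on the intervals in \<open>A\<close>.
\<close>

lemma henstock_filter:
  fixes F :: "real \<Rightarrow> 'a::banach"
  assumes P: "\<And>c d. a \<le> c \<Longrightarrow> c \<le> d \<Longrightarrow> d \<le> b \<Longrightarrow> has_ks_integral norm F g c d (P d - P c)"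
    and \<delta>: "gauge_on a b \<delta>"
    and le: "\<And>L. tdiv a b L \<Longrightarrow> fine_div \<delta> L \<Longrightarrow>
       norm ((\<Sum>(u, \<tau>, v)\<leftarrow>L. (g v - g u) *\<^sub>R F \<tau>) - (P b - P a)) \<le> \<epsilon>"
    and L: "tdiv a b L" "fine_div \<delta> L"
  shows "norm (\<Sum>(u, \<tau>, v)\<leftarrow>L. if A (u, \<tau>, v) then (g v - g u) *\<^sub>R F \<tau> - (P v - P u) else 0) \<le> \<epsilon>"
proof (rule field_le_epsilon)
  fix \<eta> :: real assume "\<eta> > 0"
  let ?S = "\<lambda>L. \<Sum>(u, \<tau>, v)\<leftarrow>L. (g v - g u) *\<^sub>R F \<tau>"
  let ?X = "\<Sum>(u, \<tau>, v)\<leftarrow>L. if A (u, \<tau>, v) then (g v - g u) *\<^sub>R F \<tau> - (P v - P u) else 0"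
  define \<kappa> where "\<kappa> = \<eta> / (length L + 1)"
  have "\<kappa> > 0" using \<open>\<eta> > 0\<close> by (simp add: \<kappa>_def)
  define T where "T = (\<lambda>(u, \<tau>, v). if A (u, \<tau>, v) then (g v - g u) *\<^sub>R F \<tau> else P v - P u)"
  have "\<exists>M. tdiv u v M \<and> fine_div \<delta> M \<and>
     norm (?S M - T (u, \<tau>, v)) \<le> \<kappa>"
    if "(u, \<tau>, v) \<in> set L" for u \<tau> v
  proof (cases "A (u, \<tau>, v)")
    case True
    then show ?thesis using L(2) that tdiv_mem[OF L(1) that] \<open>\<kappa> > 0\<close>
      by (intro exI[of _ "[(u, \<tau>, v)]"]) (auto simp: fine_div_def T_def)
  next
    case False
    have uv: "a \<le> u" "u \<le> v" "v \<le> b" using tdiv_mem[OF L(1) that] by auto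
    obtain \<delta>' where \<delta>': "gauge_on u v \<delta>'"
      "\<And>M. tdiv u v M \<Longrightarrow> fine_div \<delta>' M \<Longrightarrow> norm (?S M - (P v - P u)) < \<kappa>"
      using P[OF uv] \<open>\<kappa> > 0\<close> unfolding has_ks_integral_iff_tdiv by metis
    obtain M where "tdiv u v M" "fine_div \<delta> M" "fine_div \<delta>' M"
      using fine_division_exists[OF uv(2) gauge_on_min[OF gauge_on_subset[OF \<delta> uv(1,3)] \<delta>'(1)]]
      by (metis fine_min)
    then show ?thesis using \<delta>'(2)[of M] False by (auto intro: less_imp_le simp: T_def)
  qed
  then have "\<forall>e\<in>set L. \<exists>M. tdiv (fst e) (snd (snd e)) M \<and> fine_div \<delta> M \<and>
     norm (?S M - T e) \<le> \<kappa>"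
    by auto
  then obtain R where R: "\<And>e. e \<in> set L \<Longrightarrow> tdiv (fst e) (snd (snd e)) (R e) \<and> fine_div \<delta> (R e) \<and>
     norm (?S (R e) - T e) \<le> \<kappa>"
    by metis
  have "tdiv a b (concat (map R L))"
    by (rule tdiv_concat[OF L(1)]) (use R in fastforce)
  moreover have "fine_div \<delta> (concat (map R L))"
    unfolding fine_div_def set_concat using R by (force simp: fine_div_def)
  ultimately have 1: "norm (?S (concat (map R L)) - (P b - P a)) \<le> \<epsilon>" by (rule le)
  have "?S (concat (map R L)) - (P b - P a) - ?X =
    (\<Sum>e\<leftarrow>L. ?S (R e)) - (\<Sum>(u, \<tau>, v)\<leftarrow>L. P v - P u) - ?X"
    using dsum_telescope[OF L(1), of P] by (simp add: sum_list_concat_map)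
  also have "\<dots> = (\<Sum>e\<leftarrow>L. ?S (R e) - (case e of (u, \<tau>, v) \<Rightarrow> P v - P u) -
      (case e of (u, \<tau>, v) \<Rightarrow> if A (u, \<tau>, v) then (g v - g u) *\<^sub>R F \<tau> - (P v - P u) else 0))"
    by (simp add: sum_list_subtractf)
  also have "\<dots> = (\<Sum>e\<leftarrow>L. ?S (R e) -
      T e)"
    by (rule arg_cong[of _ _ sum_list], rule map_cong[OF refl]) (auto simp: T_def)
  also have "norm \<dots> \<le> (\<Sum>e\<leftarrow>L. norm (?S (R e) -
      T e))"
    by (rule norm_sum_list_le)
  also have "\<dots> \<le> (\<Sum>e\<leftarrow>L. \<kappa>)" by (rule sum_list_mono) (use R in blast)
  also have "\<dots> \<le> \<eta>" using \<open>\<eta> > 0\<close> by (simp add: sum_list_triv \<kappa>_def field_simps)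
  finally have 2: "norm (?S (concat (map R L)) - (P b - P a) - ?X) \<le> \<eta>" .
  have "norm ?X \<le> norm (?S (concat (map R L)) - (P b - P a)) + norm (?S (concat (map R L)) - (P b - P a) - ?X)"
    using norm_triangle_sub[of ?X "?S (concat (map R L)) - (P b - P a)"]
      norm_minus_commute[of ?X "?S (concat (map R L)) - (P b - P a)"] by linarith
  then show "norm ?X \<le> \<epsilon> + \<eta>" using 1 2 by linarith
qed

text \<open>
  Small errors on every part of a division give a small sum of norms: take, for each coordinate, the
  parts where the error is positive and where it is not.
\<close>

lemma henstock:
  fixes F :: "real \<Rightarrow> 'a::euclidean_space"
  assumes "a \<le> b" and I: "has_ks_integral norm F g a b I"
  shows "\<exists>P. ks_primitive g a b F P"
proof -
  let ?S = "\<lambda>L. \<Sum>(u, \<tau>, v)\<leftarrow>L. (g v - g u) *\<^sub>R F \<tau>"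
  obtain P where P: "\<And>c d. a \<le> c \<Longrightarrow> c \<le> d \<Longrightarrow> d \<le> b \<Longrightarrow> has_ks_integral norm F g c d (P d - P c)"
    using ks_integral_additive_primitive[OF assms] by blast
  define D where "D = real DIM('a)"
  have "D > 0" by (simp add: D_def)
  have "ks_primitive g a b F P"
    unfolding ks_primitive_def
  proof (intro allI impI)
    fix \<epsilon> :: real assume "\<epsilon> > 0"
    define \<kappa> where "\<kappa> = \<epsilon> / (2 * D)"
    have "\<kappa> > 0" using \<open>\<epsilon> > 0\<close> \<open>D > 0\<close> by (simp add: \<kappa>_def)
    then obtain \<delta> where \<delta>: "gauge_on a b \<delta>"
      "\<And>L. tdiv a b L \<Longrightarrow> fine_div \<delta> L \<Longrightarrow> norm (?S L - (P b - P a)) < \<kappa>"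
      using P[OF order.refl assms(1) order.refl] unfolding has_ks_integral_iff_tdiv by metis
    have "(\<Sum>(u, \<tau>, v)\<leftarrow>L. norm ((g v - g u) *\<^sub>R F \<tau> - (P v - P u))) \<le> \<epsilon>"
      if L: "tdiv a b L" "fine_div \<delta> L" for L
    proof -
      define x where "x = (\<lambda>(u, \<tau>, v). (g v - g u) *\<^sub>R F \<tau> - (P v - P u))"
      have part: "norm (\<Sum>e\<leftarrow>L. if A e then x e else 0) \<le> \<kappa>" for A
        using henstock_filter[OF P \<delta>(1) less_imp_le[OF \<delta>(2)] L, where A = A]
        by (simp add: x_def case_prod_unfold cong: if_cong)
      have comp: "(\<Sum>e\<leftarrow>L. \<bar>x e \<bullet> i\<bar>) \<le> 2 * \<kappa>" if "i \<in> Basis" for i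
      proof -
        have inner: "(\<Sum>e\<leftarrow>M. y e) \<bullet> i = (\<Sum>e\<leftarrow>M. y e \<bullet> i)" for y :: "(real \<times> real \<times> real) \<Rightarrow> 'a" and M
          by (induction M) (auto simp: inner_add_left)
        have half: "\<bar>\<Sum>e\<leftarrow>L. if A e then x e \<bullet> i else 0\<bar> \<le> \<kappa>" for A
        proof -
          have "(\<Sum>e\<leftarrow>L. if A e then x e \<bullet> i else 0) = (\<Sum>e\<leftarrow>L. if A e then x e else 0) \<bullet> i"
            unfolding inner by (rule arg_cong[of _ _ sum_list], rule map_cong[OF refl]) auto
          then show ?thesis using Basis_le_norm[OF that] part[of A] by (metis order.trans)
        qed
        have "(\<Sum>e\<leftarrow>L. \<bar>x e \<bullet> i\<bar>) = (\<Sum>e\<leftarrow>L. (if x e \<bullet> i > 0 then x e \<bullet> i else 0)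
            - (if \<not> x e \<bullet> i > 0 then x e \<bullet> i else 0))"
          by (rule arg_cong[of _ _ sum_list], rule map_cong[OF refl]) auto
        also have "\<dots> = (\<Sum>e\<leftarrow>L. (if x e \<bullet> i > 0 then x e \<bullet> i else 0))
            - (\<Sum>e\<leftarrow>L. (if \<not> x e \<bullet> i > 0 then x e \<bullet> i else 0))"
          by (rule sum_list_subtractf)
        finally show ?thesis using half[of "\<lambda>e. x e \<bullet> i > 0"] half[of "\<lambda>e. \<not> x e \<bullet> i > 0"] by linarith
      qed
      have "(\<Sum>e\<leftarrow>L. norm (x e)) \<le> (\<Sum>e\<leftarrow>L. \<Sum>i\<in>Basis. \<bar>x e \<bullet> i\<bar>)"
        by (rule sum_list_mono) (rule norm_le_l1)
      also have "\<dots> = (\<Sum>i\<in>Basis. \<Sum>e\<leftarrow>L. \<bar>x e \<bullet> i\<bar>)"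
        by (induction L) (auto simp: sum.distrib)
      also have "\<dots> \<le> (\<Sum>i\<in>(Basis::'a set). 2 * \<kappa>)" by (rule sum_mono) (rule comp)
      also have "\<dots> = \<epsilon>" using \<open>D > 0\<close> by (simp add: \<kappa>_def D_def)
      finally show ?thesis by (simp add: x_def case_prod_unfold)
    qed
    then show "\<exists>\<delta>. gauge_on a b \<delta> \<and> (\<forall>L. tdiv a b L \<and> fine_div \<delta> L \<longrightarrow>
      (\<Sum>(u, \<tau>, v)\<leftarrow>L. norm ((g v - g u) *\<^sub>R F \<tau> - (P v - P u))) \<le> \<epsilon>)" using \<delta>(1) by blast
  qed
  then show ?thesis by blast
qed

section \<open>Gluing primitives\<close>

text \<open>
  The gauge shrinks towards \<open>c\<close>, so that an interval meeting \<open>c\<close> must have \<open>c\<close> as its tag; cutting such an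
  interval at \<open>c\<close> yields fine divisions of both halves.
\<close>

lemma ks_primitive_join:
  assumes P1: "ks_primitive g a c F P" and P2: "ks_primitive g c b F P" and c: "a \<le> c" "c \<le> b"
  shows "ks_primitive g a b F P"
  unfolding ks_primitive_def
proof (intro allI impI)
  fix \<epsilon> :: real assume "\<epsilon> > 0"
  then have "\<epsilon> / 2 > 0" by simp
  obtain \<delta>1 where \<delta>1: "gauge_on a c \<delta>1"
    "\<And>L. tdiv a c L \<Longrightarrow> fine_div \<delta>1 L \<Longrightarrow>
        (\<Sum>(u, \<tau>, v)\<leftarrow>L. norm ((g v - g u) *\<^sub>R F \<tau> - (P v - P u))) \<le> \<epsilon> / 2"
    using ks_primitiveD[OF P1 \<open>\<epsilon> / 2 > 0\<close>] by blast
  obtain \<delta>2 where \<delta>2: "gauge_on c b \<delta>2"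
    "\<And>L. tdiv c b L \<Longrightarrow> fine_div \<delta>2 L \<Longrightarrow>
        (\<Sum>(u, \<tau>, v)\<leftarrow>L. norm ((g v - g u) *\<^sub>R F \<tau> - (P v - P u))) \<le> \<epsilon> / 2"
    using ks_primitiveD[OF P2 \<open>\<epsilon> / 2 > 0\<close>] by blast
  define \<delta> where "\<delta> t = (if t < c then min (\<delta>1 t) (c - t)
      else if t > c then min (\<delta>2 t) (t - c) else min (\<delta>1 c) (\<delta>2 c))" for t
  have "\<delta>1 c > 0" "\<delta>2 c > 0" using \<delta>1(1) \<delta>2(1) c by (auto simp: gauge_on_def)
  have "gauge_on a b \<delta>" using \<delta>1(1) \<delta>2(1) c by (auto simp: gauge_on_def \<delta>_def)
  moreover have "(\<Sum>(u, \<tau>, v)\<leftarrow>L. norm ((g v - g u) *\<^sub>R F \<tau> - (P v - P u))) \<le> \<epsilon>"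
    if L: "tdiv a b L" "fine_div \<delta> L" for L
  proof -
    let ?T = "\<lambda>u \<tau> v. norm ((g v - g u) *\<^sub>R F \<tau> - (P v - P u))"
    have cases: "(v < c \<and> \<tau> - \<delta>1 \<tau> < u \<and> v < \<tau> + \<delta>1 \<tau>) \<or> (u > c \<and> \<tau> - \<delta>2 \<tau> < u \<and> v < \<tau> + \<delta>2 \<tau>) \<or>
       (\<tau> = c \<and> \<tau> - \<delta>1 \<tau> < u \<and> v < \<tau> + \<delta>1 \<tau> \<and> \<tau> - \<delta>2 \<tau> < u \<and> v < \<tau> + \<delta>2 \<tau>)"
      and uv: "a \<le> u" "u \<le> \<tau>" "\<tau> \<le> v" "v \<le> b"
      if "(u, \<tau>, v) \<in> set L" for u \<tau> v
    proof -
      show uv: "a \<le> u" "u \<le> \<tau>" "\<tau> \<le> v" "v \<le> b" using tdiv_mem[OF L(1) that] by auto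
      have "\<tau> - \<delta> \<tau> < u" "v < \<tau> + \<delta> \<tau>" using L(2) that by (auto simp: fine_div_def)
      then show "(v < c \<and> \<tau> - \<delta>1 \<tau> < u \<and> v < \<tau> + \<delta>1 \<tau>) \<or> (u > c \<and> \<tau> - \<delta>2 \<tau> < u \<and> v < \<tau> + \<delta>2 \<tau>) \<or>
       (\<tau> = c \<and> \<tau> - \<delta>1 \<tau> < u \<and> v < \<tau> + \<delta>1 \<tau> \<and> \<tau> - \<delta>2 \<tau> < u \<and> v < \<tau> + \<delta>2 \<tau>)"
        unfolding \<delta>_def by (auto split: if_splits)
    qed
    have "tdiv a c (clip_div a c L)" using tdiv_clip[OF L(1), of a c] c by (simp add: clip_def)
    moreover have "fine_div \<delta>1 (clip_div a c L)"
      unfolding fine_div_def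
    proof (clarify)
      fix u' \<tau>' v' assume "(u', \<tau>', v') \<in> set (clip_div a c L)"
      then obtain u \<tau> v where e: "(u, \<tau>, v) \<in> set L" "u' = clip a c u" "\<tau>' = clip a c \<tau>" "v' = clip a c v"
        by (auto simp: clip_div_def)
      show "\<tau>' - \<delta>1 \<tau>' < u' \<and> v' < \<tau>' + \<delta>1 \<tau>'"
        using cases[OF e(1)] uv[OF e(1)] \<open>\<delta>1 c > 0\<close> c unfolding e clip_def
        by (elim disjE) (auto simp: min_def max_def)
    qed
    ultimately have 1: "(\<Sum>(u, \<tau>, v)\<leftarrow>clip_div a c L. ?T u \<tau> v) \<le> \<epsilon> / 2" by (rule \<delta>1(2))
    have "tdiv c b (clip_div c b L)" using tdiv_clip[OF L(1), of c b] c by (simp add: clip_def)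
    moreover have "fine_div \<delta>2 (clip_div c b L)"
      unfolding fine_div_def
    proof (clarify)
      fix u' \<tau>' v' assume "(u', \<tau>', v') \<in> set (clip_div c b L)"
      then obtain u \<tau> v where e: "(u, \<tau>, v) \<in> set L" "u' = clip c b u" "\<tau>' = clip c b \<tau>" "v' = clip c b v"
        by (auto simp: clip_div_def)
      show "\<tau>' - \<delta>2 \<tau>' < u' \<and> v' < \<tau>' + \<delta>2 \<tau>'"
        using cases[OF e(1)] uv[OF e(1)] \<open>\<delta>2 c > 0\<close> c unfolding e clip_def
        by (elim disjE) (auto simp: min_def max_def)
    qed
    ultimately have 2: "(\<Sum>(u, \<tau>, v)\<leftarrow>clip_div c b L. ?T u \<tau> v) \<le> \<epsilon> / 2" by (rule \<delta>2(2))
    have "(\<Sum>(u, \<tau>, v)\<leftarrow>L. ?T u \<tau> v) \<le> (\<Sum>(u, \<tau>, v)\<leftarrow>L.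
        ?T (clip a c u) (clip a c \<tau>) (clip a c v) + ?T (clip c b u) (clip c b \<tau>) (clip c b v))"
    proof (rule sum_list_mono, clarify)
      fix u \<tau> v assume e: "(u, \<tau>, v) \<in> set L"
      consider "v < c" | "u > c" | "\<tau> = c" "u \<le> c" "c \<le> v"
        using cases[OF e] uv[OF e] by fastforce
      then show "?T u \<tau> v \<le> ?T (clip a c u) (clip a c \<tau>) (clip a c v) + ?T (clip c b u) (clip c b \<tau>) (clip c b v)"
      proof cases
        case 1
        then have "clip a c u = u" "clip a c \<tau> = \<tau>" "clip a c v = v" using uv[OF e] by (auto simp: clip_def)
        then show ?thesis by simp
      next
        case 2
        then have "clip c b u = u" "clip c b \<tau> = \<tau>" "clip c b v = v" using uv[OF e] by (auto simp: clip_def)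
        then show ?thesis by simp
      next
        case 3
        then have "clip a c u = u" "clip a c v = c" "clip c b u = c" "clip c b v = v" "clip a c \<tau> = c" "clip c b \<tau> = c"
          using uv[OF e] c by (auto simp: clip_def)
        moreover have "(g v - g u) *\<^sub>R F c - (P v - P u) =
           ((g c - g u) *\<^sub>R F c - (P c - P u)) + ((g v - g c) *\<^sub>R F c - (P v - P c))"
          by (simp add: algebra_simps)
        ultimately show ?thesis using 3 by (metis norm_triangle_ineq)
      qed
    qed
    also have "\<dots> = (\<Sum>(u, \<tau>, v)\<leftarrow>clip_div a c L. ?T u \<tau> v) + (\<Sum>(u, \<tau>, v)\<leftarrow>clip_div c b L. ?T u \<tau> v)"
      by (simp add: clip_div_def sum_list_addf comp_def case_prod_unfold)
    finally show ?thesis using 1 2 by linarith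
  qed
  ultimately show "\<exists>\<delta>. gauge_on a b \<delta> \<and> (\<forall>L. tdiv a b L \<and> fine_div \<delta> L \<longrightarrow>
      (\<Sum>(u, \<tau>, v)\<leftarrow>L. norm ((g v - g u) *\<^sub>R F \<tau> - (P v - P u))) \<le> \<epsilon>)" by blast
qed

text \<open>
  The intervals tagged with \<open>p\<close> lie in a short interval \<open>[q, p]\<close>, on which \<open>g\<close> hardly grows because it is left
  continuous at \<open>p\<close>.
\<close>

lemma ks_primitive_change_right_end:
  assumes P: "ks_primitive g a p F P" and "a < p" and mono: "mono_on {a..p} g"
    and left: "(g \<longlongrightarrow> g p) (at_left p)"
    and eq: "\<And>t. a \<le> t \<Longrightarrow> t < p \<Longrightarrow> F' t = F t"
  shows "ks_primitive g a p F' P"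
  unfolding ks_primitive_def
proof (intro allI impI)
  fix \<epsilon> :: real assume "\<epsilon> > 0"
  then have "\<epsilon> / 2 > 0" by simp
  obtain \<delta>1 where \<delta>1: "gauge_on a p \<delta>1"
    "\<And>L. tdiv a p L \<Longrightarrow> fine_div \<delta>1 L \<Longrightarrow>
        (\<Sum>(u, \<tau>, v)\<leftarrow>L. norm ((g v - g u) *\<^sub>R F \<tau> - (P v - P u))) \<le> \<epsilon> / 2"
    using ks_primitiveD[OF P \<open>\<epsilon> / 2 > 0\<close>] by blast
  define C where "C = norm (F' p - F p) + 1"
  have "C > 0" by (simp add: C_def add_nonneg_pos)
  have "\<forall>\<^sub>F t in at_left p. dist (g t) (g p) < \<epsilon> / 2 / C"
    using \<open>\<epsilon> > 0\<close> \<open>C > 0\<close> by (intro tendstoD[OF left]) auto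
  then have "\<forall>\<^sub>F t in at_left p. dist (g t) (g p) < \<epsilon> / 2 / C \<and> t \<in> {a<..<p}"
    using eventually_at_left_real[OF \<open>a < p\<close>] by eventually_elim simp
  then obtain q where q: "dist (g q) (g p) < \<epsilon> / 2 / C" "a < q" "q < p"
    using eventually_happens'[OF trivial_limit_at_left_real] by fastforce
  have gq: "g q \<le> g p" using q by (intro mono_onD[OF mono]) auto
  define \<delta> where "\<delta> t = (if t = p then min (\<delta>1 p) (p - q) else \<delta>1 t)" for t
  have "gauge_on a p \<delta>" using \<delta>1(1) q by (auto simp: gauge_on_def \<delta>_def)
  moreover have "(\<Sum>(u, \<tau>, v)\<leftarrow>L. norm ((g v - g u) *\<^sub>R F' \<tau> - (P v - P u))) \<le> \<epsilon>"
    if L: "tdiv a p L" "fine_div \<delta> L" for L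
  proof -
    have f1: "fine_div \<delta>1 L" by (rule fine_mono[OF L(2)]) (auto simp: \<delta>_def)
    have "(\<Sum>(u, \<tau>, v)\<leftarrow>L. norm ((g v - g u) *\<^sub>R F' \<tau> - (P v - P u))) \<le>
      (\<Sum>(u, \<tau>, v)\<leftarrow>L. norm ((g v - g u) *\<^sub>R F \<tau> - (P v - P u)) + C * (g (clip q p v) - g (clip q p u)))"
    proof (rule sum_list_mono, clarify)
      fix u \<tau> v assume e: "(u, \<tau>, v) \<in> set L"
      have uv: "a \<le> u" "u \<le> \<tau>" "\<tau> \<le> v" "v \<le> p" using tdiv_mem[OF L(1) e] by auto
      have mc: "g (clip q p u) \<le> g (clip q p v)"
        using uv q by (intro mono_onD[OF mono] clip_mono) (auto simp: clip_def)
      show "norm ((g v - g u) *\<^sub>R F' \<tau> - (P v - P u)) \<le>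
         norm ((g v - g u) *\<^sub>R F \<tau> - (P v - P u)) + C * (g (clip q p v) - g (clip q p u))"
      proof (cases "\<tau> = p")
        case False
        then have "F' \<tau> = F \<tau>" using uv by (intro eq) auto
        then show ?thesis using mc \<open>C > 0\<close> by simp
      next
        case True
        have "q < u" using L(2) e True by (auto simp: fine_div_def \<delta>_def)
        then have cl: "clip q p u = u" "clip q p v = v" using uv by (auto simp: clip_def)
        have "g u \<le> g v" using mc cl by simp
        have "(g v - g u) *\<^sub>R F' \<tau> - (P v - P u) =
          ((g v - g u) *\<^sub>R F \<tau> - (P v - P u)) + (g v - g u) *\<^sub>R (F' p - F p)"
          using True by (simp add: algebra_simps)
        then have "norm ((g v - g u) *\<^sub>R F' \<tau> - (P v - P u)) \<le>
          norm ((g v - g u) *\<^sub>R F \<tau> - (P v - P u)) + norm ((g v - g u) *\<^sub>R (F' p - F p))"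
          by (metis norm_triangle_ineq)
        also have "norm ((g v - g u) *\<^sub>R (F' p - F p)) \<le> C * (g v - g u)"
        proof -
          have "norm ((g v - g u) *\<^sub>R (F' p - F p)) = norm (F' p - F p) * (g v - g u)"
            using \<open>g u \<le> g v\<close> by simp
          also have "\<dots> \<le> C * (g v - g u)"
            using \<open>g u \<le> g v\<close> by (intro mult_right_mono) (auto simp: C_def)
          finally show ?thesis .
        qed
        finally show ?thesis using cl by simp
      qed
    qed
    also have "\<dots> = (\<Sum>(u, \<tau>, v)\<leftarrow>L. norm ((g v - g u) *\<^sub>R F \<tau> - (P v - P u))) +
       C * (\<Sum>(u, \<tau>, v)\<leftarrow>L. g (clip q p v) - g (clip q p u))"
      by (simp add: sum_list_addf sum_list_const_mult[symmetric] case_prod_unfold)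
    also have "(\<Sum>(u, \<tau>, v)\<leftarrow>L. g (clip q p v) - g (clip q p u)) = g p - g q"
      using dsum_telescope[OF L(1), of "\<lambda>t. g (clip q p t)"] q by (simp add: clip_def)
    also have "C * (g p - g q) \<le> C * (\<epsilon> / 2 / C)"
      using q gq \<open>C > 0\<close> by (intro mult_left_mono) (auto simp: dist_real_def)
    also have "\<dots> = \<epsilon> / 2" using \<open>C > 0\<close> by simp
    finally show ?thesis using \<delta>1(2)[OF L(1) f1] by linarith
  qed
  ultimately show "\<exists>\<delta>. gauge_on a p \<delta> \<and> (\<forall>L. tdiv a p L \<and> fine_div \<delta> L \<longrightarrow>
      (\<Sum>(u, \<tau>, v)\<leftarrow>L. norm ((g v - g u) *\<^sub>R F' \<tau> - (P v - P u))) \<le> \<epsilon>)" by blast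
qed

lemma ks_primitive_midpoint:
  assumes P: "ks_primitive g a b F P" and Q: "ks_primitive g a b G Q"
  shows "ks_primitive g a b (\<lambda>t. (1/2) *\<^sub>R (F t + G t)) (\<lambda>t. (1/2) *\<^sub>R (P t + Q t))"
  unfolding ks_primitive_def
proof (intro allI impI)
  fix \<epsilon> :: real assume "\<epsilon> > 0"
  obtain \<delta>1 where \<delta>1: "gauge_on a b \<delta>1"
    "\<And>L. tdiv a b L \<Longrightarrow> fine_div \<delta>1 L \<Longrightarrow>
        (\<Sum>(u, \<tau>, v)\<leftarrow>L. norm ((g v - g u) *\<^sub>R F \<tau> - (P v - P u))) \<le> \<epsilon>"
    using ks_primitiveD[OF P \<open>\<epsilon> > 0\<close>] by blast
  obtain \<delta>2 where \<delta>2: "gauge_on a b \<delta>2"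
    "\<And>L. tdiv a b L \<Longrightarrow> fine_div \<delta>2 L \<Longrightarrow>
        (\<Sum>(u, \<tau>, v)\<leftarrow>L. norm ((g v - g u) *\<^sub>R G \<tau> - (Q v - Q u))) \<le> \<epsilon>"
    using ks_primitiveD[OF Q \<open>\<epsilon> > 0\<close>] by blast
  let ?H = "\<lambda>u \<tau> v. (g v - g u) *\<^sub>R ((1/2) *\<^sub>R (F \<tau> + G \<tau>)) - ((1/2) *\<^sub>R (P v + Q v) - (1/2) *\<^sub>R (P u + Q u))"
  have "(\<Sum>(u, \<tau>, v)\<leftarrow>L. norm (?H u \<tau> v)) \<le> \<epsilon>"
    if L: "tdiv a b L" "fine_div (\<lambda>t. min (\<delta>1 t) (\<delta>2 t)) L" for L
  proof -
    have "(\<Sum>(u, \<tau>, v)\<leftarrow>L. norm (?H u \<tau> v)) \<le> (\<Sum>(u, \<tau>, v)\<leftarrow>L.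
      (1/2) * norm ((g v - g u) *\<^sub>R F \<tau> - (P v - P u)) + (1/2) * norm ((g v - g u) *\<^sub>R G \<tau> - (Q v - Q u)))"
    proof (rule sum_list_mono, clarify)
      fix u \<tau> v
      have "?H u \<tau> v = (1/2) *\<^sub>R ((g v - g u) *\<^sub>R F \<tau> - (P v - P u)) + (1/2) *\<^sub>R ((g v - g u) *\<^sub>R G \<tau> - (Q v - Q u))"
        by (simp add: algebra_simps diff_divide_distrib)
      then show "norm (?H u \<tau> v) \<le> (1/2) * norm ((g v - g u) *\<^sub>R F \<tau> - (P v - P u)) + (1/2) * norm ((g v - g u) *\<^sub>R G \<tau> - (Q v - Q u))"
        using norm_triangle_ineq[of "(1/2) *\<^sub>R ((g v - g u) *\<^sub>R F \<tau> - (P v - P u))" "(1/2) *\<^sub>R ((g v - g u) *\<^sub>R G \<tau> - (Q v - Q u))"]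
        unfolding norm_scaleR by simp
    qed
    also have "\<dots> = (1/2) * (\<Sum>(u, \<tau>, v)\<leftarrow>L. norm ((g v - g u) *\<^sub>R F \<tau> - (P v - P u)))
       + (1/2) * (\<Sum>(u, \<tau>, v)\<leftarrow>L. norm ((g v - g u) *\<^sub>R G \<tau> - (Q v - Q u)))"
      unfolding sum_list_const_mult[symmetric] by (simp add: sum_list_addf[symmetric] case_prod_unfold)
    finally show ?thesis using \<delta>1(2)[OF L(1)] \<delta>2(2)[OF L(1)] L(2) by (auto simp: fine_min)
  qed
  then show "\<exists>\<delta>. gauge_on a b \<delta> \<and> (\<forall>L. tdiv a b L \<and> fine_div \<delta> L \<longrightarrow> (\<Sum>(u, \<tau>, v)\<leftarrow>L. norm (?H u \<tau> v)) \<le> \<epsilon>)"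
    using gauge_on_min[OF \<delta>1(1) \<delta>2(1)] by blast
qed

section \<open>Energy and variation of dominated functions\<close>

text \<open>
  The Hilbert space part of Mazur's lemma. For decreasing sets \<open>H n\<close> the infima of \<open>E\<close> increase to a limit, and the
  parallelogram inequality \<open>mid\<close> turns near-minimality of two points and their midpoint into a bound for
  their distance \<open>D\<close>.
\<close>

lemma midpoint_minimizing_Cauchy:
  fixes H :: "nat \<Rightarrow> 'x set" and E :: "'x \<Rightarrow> real" and D :: "'x \<Rightarrow> 'x \<Rightarrow> real"
  assumes ne: "\<And>n. H n \<noteq> {}" and dec: "\<And>m n. m \<le> n \<Longrightarrow> H n \<subseteq> H m"
    and E: "\<And>x. x \<in> H 0 \<Longrightarrow> 0 \<le> E x" "\<And>x. x \<in> H 0 \<Longrightarrow> E x \<le> \<Lambda>"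
    and mid: "\<And>n x y. x \<in> H n \<Longrightarrow> y \<in> H n \<Longrightarrow> \<exists>z\<in>H n. D x y + 4 * E z \<le> 2 * E x + 2 * E y"
  shows "\<exists>x. (\<forall>n. x n \<in> H n) \<and> (\<forall>\<epsilon>>0. \<exists>N. \<forall>n\<ge>N. \<forall>j\<ge>n. D (x n) (x j) \<le> \<epsilon>)"
proof -
  define e where "e n = (INF x\<in>H n. E x)" for n
  have E': "0 \<le> E x" "E x \<le> \<Lambda>" if "x \<in> H n" for n x
    using subsetD[OF dec[of 0 n] that] E by auto
  have bdd: "bdd_below (E ` H n)" for n using E' by (intro bdd_belowI[of _ 0]) auto
  have e_le: "e n \<le> E x" if "x \<in> H n" for n x
    unfolding e_def by (rule cINF_lower[OF bdd that])
  have inc: "e m \<le> e n" if "m \<le> n" for m n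
    unfolding e_def using cINF_superset_mono[OF ne bdd dec[OF that]] by simp
  have "e n \<le> \<Lambda>" for n using e_le ne E'(2) by (metis all_not_in_conv order.trans)
  then obtain l where l: "e \<longlonglongrightarrow> l" "\<And>n. e n \<le> l"
    using incseq_convergent[of e \<Lambda>] inc by (auto simp: incseq_def)
  have "\<exists>x\<in>H n. E x < e n + 1 / Suc n" for n
    using cINF_less_iff[OF ne bdd, of n "e n + 1 / Suc n"] by (simp add: e_def)
  then obtain x where x: "\<And>n. x n \<in> H n" "\<And>n. E (x n) < e n + 1 / Suc n" by metis
  have "\<exists>N. \<forall>n\<ge>N. \<forall>j\<ge>n. D (x n) (x j) \<le> \<epsilon>" if "\<epsilon> > 0" for \<epsilon> :: real
  proof -
    have "(\<lambda>n. 2 * (l - e n) + 4 / Suc n) \<longlonglongrightarrow> 2 * (l - l) + 0"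
    proof (intro tendsto_intros l)
      show "(\<lambda>n. 4 / real (Suc n)) \<longlonglongrightarrow> 0" by real_asymp
    qed
    then have "\<forall>\<^sub>F n in sequentially. 2 * (l - e n) + 4 / Suc n < \<epsilon>"
      using that by (intro order_tendstoD) auto
    then obtain N where N: "\<And>n. n \<ge> N \<Longrightarrow> 2 * (l - e n) + 4 / Suc n < \<epsilon>"
      by (auto simp: eventually_sequentially)
    have "D (x n) (x j) \<le> \<epsilon>" if "n \<ge> N" "j \<ge> n" for n j
    proof -
      have "x j \<in> H n" using x(1) dec[OF that(2)] by auto
      then obtain z where z: "z \<in> H n" "D (x n) (x j) + 4 * E z \<le> 2 * E (x n) + 2 * E (x j)"
        using mid[OF x(1)] by blast
      have "1 / real (Suc j) \<le> 1 / Suc n" using that by (simp add: frac_le)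
      moreover have "4 / real (Suc n) = 4 * (1 / Suc n)" by simp
      ultimately show ?thesis
        using z(2) e_le[OF z(1)] x(2)[of n] x(2)[of j] l(2)[of j] N[OF that(1)] by argo
    qed
    then show ?thesis by blast
  qed
  then show ?thesis using x(1) by blast
qed

text \<open>
  A Riemann sum of the Hellinger integral \<open>\<integral> |dB|\<^sup>2 / dm\<close>. Where \<open>m\<close> does not grow, neither do the functions \<open>B\<close>
  considered here, and the quotient is \<open>0 / 0 = 0\<close>.
\<close>

definition quad :: "(real \<Rightarrow> real) \<Rightarrow> (real \<Rightarrow> 'a::real_inner) \<Rightarrow> (real \<times> real \<times> real) list \<Rightarrow> real" where
  "quad m B L = (\<Sum>(u, \<tau>, v)\<leftarrow>L. (norm (B v - B u))\<^sup>2 / (m v - m u))"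

definition dominated :: "(real \<Rightarrow> real) \<Rightarrow> real \<Rightarrow> real \<Rightarrow> real \<Rightarrow> (real \<Rightarrow> 'a::real_normed_vector) \<Rightarrow> bool" where
  "dominated m a b K B \<longleftrightarrow> (\<forall>s t. a \<le> s \<and> s \<le> t \<and> t \<le> b \<longrightarrow> norm (B t - B s) \<le> K * (m t - m s))"

lemma dominatedD: "dominated m a b K B \<Longrightarrow> a \<le> s \<Longrightarrow> s \<le> t \<Longrightarrow> t \<le> b \<Longrightarrow> norm (B t - B s) \<le> K * (m t - m s)"
  by (simp add: dominated_def)

lemma dominated_diff:
  assumes "dominated m a b K B" "dominated m a b K C"
  shows "dominated m a b (2 * K) (\<lambda>t. B t - C t)"
  unfolding dominated_def
proof (intro allI impI, elim conjE)
  fix s t assume st: "a \<le> s" "s \<le> t" "t \<le> b"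
  have "norm (B t - C t - (B s - C s)) = norm ((B t - B s) - (C t - C s))" by (simp add: algebra_simps)
  also have "\<dots> \<le> norm (B t - B s) + norm (C t - C s)" by (rule norm_triangle_ineq4)
  also have "\<dots> \<le> K * (m t - m s) + K * (m t - m s)"
    by (intro add_mono dominatedD[OF assms(1) st] dominatedD[OF assms(2) st])
  finally show "norm (B t - C t - (B s - C s)) \<le> 2 * K * (m t - m s)" by simp
qed

lemma midpoint_in_convex: "convex S \<Longrightarrow> x \<in> S \<Longrightarrow> y \<in> S \<Longrightarrow> (1/2) *\<^sub>R (x + y) \<in> S"
  using convexD[of S x y "1/2" "1/2"] by (simp add: scaleR_add_right)

lemma dominated_midpoint:
  assumes "dominated m a b K B" "dominated m a b K C"
  shows "dominated m a b K (\<lambda>t. (1/2) *\<^sub>R (B t + C t))"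
  unfolding dominated_def
proof (intro allI impI, elim conjE)
  fix s t assume "a \<le> s" "s \<le> t" "t \<le> b"
  then have "B t - B s \<in> cball 0 (K * (m t - m s))" "C t - C s \<in> cball 0 (K * (m t - m s))"
    using assms by (auto simp: dominated_def)
  then have "(1/2) *\<^sub>R ((B t - B s) + (C t - C s)) \<in> cball 0 (K * (m t - m s))"
    by (intro midpoint_in_convex convex_cball)
  moreover have "(1/2) *\<^sub>R ((B t - B s) + (C t - C s)) = (1/2) *\<^sub>R (B t + C t) - (1/2) *\<^sub>R (B s + C s)"
    by (simp add: algebra_simps)
  ultimately show "norm ((1/2) *\<^sub>R (B t + C t) - (1/2) *\<^sub>R (B s + C s)) \<le> K * (m t - m s)"
    by (simp only: mem_cball_0)
qed

text \<open>
  Convexity of \<open>|x|\<^sup>2 / p\<close> (the Cauchy-Schwarz inequality): the reason why \<open>quad\<close> grows under refinement. The bounds by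
  \<open>K\<close> exclude the case of a zero denominator with nonzero numerator.
\<close>

lemma weighted_square_add_le:
  fixes x y :: "'a::real_inner"
  assumes "0 \<le> p" "0 \<le> q" "norm x \<le> K * p" "norm y \<le> K * q"
  shows "(norm (x + y))\<^sup>2 / (p + q) \<le> (norm x)\<^sup>2 / p + (norm y)\<^sup>2 / q"
proof (cases "p = 0 \<or> q = 0")
  case True
  then show ?thesis using assms by auto
next
  case False
  then have pq: "p > 0" "q > 0" using assms by auto
  \<comment> \<open>the defect in the inequality is a multiple of this square\<close>
  have "0 \<le> (norm (q *\<^sub>R x - p *\<^sub>R y))\<^sup>2" by simp
  also have "\<dots> = q\<^sup>2 * (norm x)\<^sup>2 + p\<^sup>2 * (norm y)\<^sup>2 - 2 * p * q * (x \<bullet> y)"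
    unfolding power2_norm_eq_inner
    by (simp add: inner_diff inner_commute power2_eq_square algebra_simps)
  finally have "2 * p * q * (x \<bullet> y) \<le> q\<^sup>2 * (norm x)\<^sup>2 + p\<^sup>2 * (norm y)\<^sup>2" by simp
  moreover have "(norm (x + y))\<^sup>2 = (norm x)\<^sup>2 + (norm y)\<^sup>2 + 2 * (x \<bullet> y)"
    unfolding power2_norm_eq_inner by (simp add: inner_add inner_commute)
  ultimately have "p * q * (norm (x + y))\<^sup>2 \<le> (p + q) * (q * (norm x)\<^sup>2 + p * (norm y)\<^sup>2)"
    by (simp add: power2_eq_square algebra_simps)
  then show ?thesis using pq by (simp add: field_simps)
qed

lemma quad_refine_single:
  assumes B: "dominated m a b K B" and m: "mono_on {a..b} m"
  shows "tdiv c d L \<Longrightarrow> a \<le> c \<Longrightarrow> d \<le> b \<Longrightarrow> (norm (B d - B c))\<^sup>2 / (m d - m c) \<le> quad m B L"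
proof (induction L arbitrary: c)
  case Nil
  then show ?case by (simp add: quad_def)
next
  case (Cons e L)
  obtain u \<tau> v where e: "e = (u, \<tau>, v)" by (cases e)
  have *: "u = c" "c \<le> v" "tdiv v d L" using Cons.prems e by auto
  have vd: "v \<le> d" using tdiv_le[OF *(3)] .
  have "(norm (B d - B c))\<^sup>2 / (m d - m c) = (norm ((B v - B c) + (B d - B v)))\<^sup>2 / ((m v - m c) + (m d - m v))"
    by simp
  also have "\<dots> \<le> (norm (B v - B c))\<^sup>2 / (m v - m c) + (norm (B d - B v))\<^sup>2 / (m d - m v)"
    using * vd Cons.prems
    by (intro weighted_square_add_le[where K = K] dominatedD[OF B]) (auto intro!: mono_onD[OF m])
  also have "(norm (B d - B v))\<^sup>2 / (m d - m v) \<le> quad m B L"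
    using * Cons.prems by (intro Cons.IH) auto
  finally show ?case using * by (simp add: quad_def e)
qed

text \<open>
  The intersections of the intervals of \<open>L\<close> with those of \<open>M\<close> can be listed by restricting \<open>M\<close> to the intervals of \<open>L\<close>
  or the other way round. Disjoint intervals give different degenerate intervals in the two lists, which
  contribute \<open>0\<close>.
\<close>

lemma sum_clip_swap:
  fixes \<Psi> :: "real \<Rightarrow> real \<Rightarrow> real"
  assumes zero: "\<And>t. \<Psi> t t = 0"
    and L: "\<And>u \<tau> v. (u, \<tau>, v) \<in> set L \<Longrightarrow> u \<le> v" and M: "\<And>u \<tau> v. (u, \<tau>, v) \<in> set M \<Longrightarrow> u \<le> v"
  shows "(\<Sum>(u, \<tau>, v)\<leftarrow>L. \<Sum>(x, \<sigma>, y)\<leftarrow>M. \<Psi> (clip u v x) (clip u v y)) =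
         (\<Sum>(x, \<sigma>, y)\<leftarrow>M. \<Sum>(u, \<tau>, v)\<leftarrow>L. \<Psi> (clip x y u) (clip x y v))"
proof -
  have *: "\<Psi> (clip u v x) (clip u v y) = \<Psi> (clip x y u) (clip x y v)" if "u \<le> v" "x \<le> y" for u v x y
  proof (cases "max u x \<le> min v y")
    case True
    then have "clip u v x = max u x" "clip x y u = max u x" "clip u v y = min v y" "clip x y v = min v y"
      using that unfolding clip_def by linarith+
    then show ?thesis by simp
  next
    case False
    then have "clip u v x = clip u v y" "clip x y u = clip x y v"
      using that unfolding clip_def by linarith+
    then show ?thesis using zero by simp
  qed
  have "(\<Sum>(u, \<tau>, v)\<leftarrow>L. \<Sum>(x, \<sigma>, y)\<leftarrow>M. \<Psi> (clip u v x) (clip u v y)) =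
     (\<Sum>(u, \<tau>, v)\<leftarrow>L. \<Sum>(x, \<sigma>, y)\<leftarrow>M. \<Psi> (clip x y u) (clip x y v))"
    by (intro arg_cong[of _ _ sum_list] map_cong refl) (auto intro!: arg_cong[of _ _ sum_list] map_cong * dest: L M)
  also have "\<dots> = (\<Sum>(x, \<sigma>, y)\<leftarrow>M. \<Sum>(u, \<tau>, v)\<leftarrow>L. \<Psi> (clip x y u) (clip x y v))"
    using sum_list_swap[of "\<lambda>e e'. \<Psi> (clip (fst e') (snd (snd e')) (fst e)) (clip (fst e') (snd (snd e')) (snd (snd e)))" M L]
    by (simp add: case_prod_unfold)
  finally show ?thesis .
qed

text \<open>
  The refinement is obtained from \<open>M\<close> restricted to each interval of \<open>L\<close>, which refines \<open>L\<close> by construction and \<open>M\<close> by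
  the symmetry \<open>sum_clip_swap\<close>. It serves all \<open>B\<close> at once, as the parallelogram law compares sums
  for different functions over one division.
\<close>

lemma quad_common_refinement:
  fixes a b :: real
  assumes L: "tdiv a b L" and M: "tdiv a b M"
  shows "\<exists>R. tdiv a b R \<and> (\<forall>m K (B :: real \<Rightarrow> 'a::real_inner). mono_on {a..b} m \<longrightarrow> dominated m a b K B \<longrightarrow>
     quad m B L \<le> quad m B R \<and> quad m B M \<le> quad m B R)"
proof (intro exI conjI allI impI)
  define R where "R = concat (map (\<lambda>(u, \<tau>, v). clip_div u v M) L)"
  have clip_id: "tdiv u v (clip_div u v M')"
    if "tdiv a b M'" "(u, \<tau>, v) \<in> set L'" "tdiv a b L'" for u \<tau> v L' M'
    using tdiv_clip[OF that(1), of u v] tdiv_mem[OF that(3,2)] by (simp add: clip_def)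
  show R: "tdiv a b R" unfolding R_def
    by (rule tdiv_concat[OF L]) (use clip_id[OF M _ L] in auto)
  fix m K and B :: "real \<Rightarrow> 'a"
  assume m: "mono_on {a..b} m" and B: "dominated m a b K B"
  define \<Psi> where "\<Psi> = (\<lambda>u v. (norm (B v - B u))\<^sup>2 / (m v - m u))"
  have quadR: "quad m B R = (\<Sum>(u, \<tau>, v)\<leftarrow>L. \<Sum>(x, \<sigma>, y)\<leftarrow>M. \<Psi> (clip u v x) (clip u v y))"
    unfolding quad_def R_def sum_list_concat_map
    by (intro arg_cong[of _ _ sum_list] map_cong refl) (auto simp: \<Psi>_def sum_clip_div)
  have le: "quad m B L' \<le> (\<Sum>(u, \<tau>, v)\<leftarrow>L'. \<Sum>(x, \<sigma>, y)\<leftarrow>M'. \<Psi> (clip u v x) (clip u v y))"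
    if "tdiv a b L'" "tdiv a b M'" for L' M'
    unfolding quad_def
  proof (rule sum_list_mono, clarify)
    fix u \<tau> v assume e: "(u, \<tau>, v) \<in> set L'"
    show "(norm (B v - B u))\<^sup>2 / (m v - m u) \<le> (\<Sum>(x, \<sigma>, y)\<leftarrow>M'. \<Psi> (clip u v x) (clip u v y))"
      using quad_refine_single[OF B m clip_id[OF that(2) e that(1)]] tdiv_mem[OF that(1) e]
      by (simp add: quad_def sum_clip_div \<Psi>_def)
  qed
  show "quad m B L \<le> quad m B R" using le[OF L M] quadR by simp
  have "quad m B M \<le> (\<Sum>(u, \<tau>, v)\<leftarrow>L. \<Sum>(x, \<sigma>, y)\<leftarrow>M. \<Psi> (clip u v x) (clip u v y))"
  proof (subst sum_clip_swap)
    show "\<Psi> t t = 0" for t by (simp add: \<Psi>_def)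
    show "u \<le> v" if "(u, \<tau>, v) \<in> set L" for u \<tau> v using tdiv_mem(2,3)[OF L that] by simp
    show "u \<le> v" if "(u, \<tau>, v) \<in> set M" for u \<tau> v using tdiv_mem(2,3)[OF M that] by simp
    show "quad m B M \<le> (\<Sum>(x, \<sigma>, y)\<leftarrow>M. \<Sum>(u, \<tau>, v)\<leftarrow>L. \<Psi> (clip x y u) (clip x y v))"
      using le[OF M L] .
  qed
  then show "quad m B M \<le> quad m B R" using quadR by simp
qed

definition energy :: "(real \<Rightarrow> real) \<Rightarrow> real \<Rightarrow> real \<Rightarrow> (real \<Rightarrow> 'a::real_inner) \<Rightarrow> real" where
  "energy m a b B = (SUP L\<in>{L. tdiv a b L}. quad m B L)"

context
  fixes m :: "real \<Rightarrow> real" and a b :: real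
  assumes ab: "a \<le> b" and m: "mono_on {a..b} m"
begin

lemma quad_nonneg:
  assumes "tdiv a b L"
  shows "0 \<le> quad m B L"
  unfolding quad_def
proof (rule sum_list_nonneg, clarsimp)
  fix u \<tau> v assume e: "(u, \<tau>, v) \<in> set L"
  have "m u \<le> m v" using tdiv_mem[OF assms e] by (intro mono_onD[OF m]) auto
  then show "0 \<le> (norm (B v - B u))\<^sup>2 / (m v - m u)" by simp
qed

lemma quad_le:
  assumes B: "dominated m a b K B" and L: "tdiv a b L"
  shows "quad m B L \<le> K\<^sup>2 * (m b - m a)"
proof -
  have "quad m B L \<le> (\<Sum>(u, \<tau>, v)\<leftarrow>L. K\<^sup>2 * (m v - m u))"
    unfolding quad_def
  proof (rule sum_list_mono, clarify)
    fix u \<tau> v assume e: "(u, \<tau>, v) \<in> set L"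
    note uv = tdiv_mem[OF L e]
    have "m u \<le> m v" using uv by (intro mono_onD[OF m]) auto
    have "norm (B v - B u) \<le> K * (m v - m u)" using uv by (intro dominatedD[OF B]) auto
    then have "(norm (B v - B u))\<^sup>2 \<le> (K * (m v - m u))\<^sup>2" by (intro power_mono) auto
    then show "(norm (B v - B u))\<^sup>2 / (m v - m u) \<le> K\<^sup>2 * (m v - m u)"
      using \<open>m u \<le> m v\<close>
      by (cases "m u = m v") (simp_all add: pos_divide_le_eq power_mult_distrib power2_eq_square ac_simps)
  qed
  also have "\<dots> = K\<^sup>2 * (\<Sum>(u, \<tau>, v)\<leftarrow>L. m v - m u)"
    by (simp add: sum_list_const_mult[symmetric] case_prod_unfold)
  finally show ?thesis using dsum_telescope[OF L, of m] by simp
qed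

lemma quad_le_energy:
  assumes "dominated m a b K B" "tdiv a b L"
  shows "quad m B L \<le> energy m a b B"
  unfolding energy_def
  by (rule cSUP_upper) (use assms quad_le[OF assms(1)] in \<open>auto intro!: bdd_aboveI2\<close>)

lemma tdiv_exists: "\<exists>L. tdiv a b L"
  using ab by (intro exI[of _ "[(a, a, b)]"]) simp

lemma energy_least: "(\<And>L. tdiv a b L \<Longrightarrow> quad m B L \<le> c) \<Longrightarrow> energy m a b B \<le> c"
  unfolding energy_def using tdiv_exists by (intro cSUP_least) auto

text \<open>
  The parallelogram law holds for the sums over each division; common refinements
  transfer it to the suprema as an inequality.
\<close>

lemma energy_parallelogram:
  assumes B: "dominated m a b K B" and C: "dominated m a b K C"
  shows "energy m a b (\<lambda>t. B t - C t) + 4 * energy m a b (\<lambda>t. (1/2) *\<^sub>R (B t + C t))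
     \<le> 2 * energy m a b B + 2 * energy m a b C"
proof -
  let ?D = "\<lambda>t. B t - C t" and ?M = "\<lambda>t. (1/2) *\<^sub>R (B t + C t)"
  have D: "dominated m a b (2 * K) ?D" and M: "dominated m a b K ?M"
    by (rule dominated_diff[OF B C], rule dominated_midpoint[OF B C])
  have key: "quad m ?D L1 + 4 * quad m ?M L2 \<le> 2 * energy m a b B + 2 * energy m a b C"
    if L: "tdiv a b L1" "tdiv a b L2" for L1 L2
  proof -
    obtain R where R: "tdiv a b R" "quad m ?D L1 \<le> quad m ?D R" "quad m ?M L2 \<le> quad m ?M R"
      using quad_common_refinement[OF L, where 'a = 'a] m D M by blast
    have "quad m ?D R + 4 * quad m ?M R = 2 * quad m B R + 2 * quad m C R"
      unfolding quad_def sum_list_const_mult[symmetric] sum_list_addf[symmetric]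
    proof (rule arg_cong[of _ _ sum_list], rule map_cong[OF refl], clarify)
      fix u \<tau> v
      have "(norm (?D v - ?D u))\<^sup>2 + 4 * (norm (?M v - ?M u))\<^sup>2
          = 2 * (norm (B v - B u))\<^sup>2 + 2 * (norm (C v - C u))\<^sup>2"
      proof -
        have 1: "?D v - ?D u = (B v - B u) - (C v - C u)" by simp
        have 2: "?M v - ?M u = (1/2) *\<^sub>R ((B v - B u) + (C v - C u))" by (simp add: algebra_simps)
        have 3: "4 * (norm ((1/2) *\<^sub>R ((B v - B u) + (C v - C u))))\<^sup>2 = (norm ((B v - B u) + (C v - C u)))\<^sup>2"
          by (simp add: power_mult_distrib power2_eq_square)
        have "(norm (x - y))\<^sup>2 + (norm (x + y))\<^sup>2 = 2 * (norm x)\<^sup>2 + 2 * (norm y)\<^sup>2" for x y :: 'a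
          unfolding power2_norm_eq_inner by (simp add: inner_add inner_diff inner_commute)
        then show ?thesis unfolding 1 2 3 .
      qed
      then show "(norm (?D v - ?D u))\<^sup>2 / (m v - m u) + 4 * ((norm (?M v - ?M u))\<^sup>2 / (m v - m u))
          = 2 * ((norm (B v - B u))\<^sup>2 / (m v - m u)) + 2 * ((norm (C v - C u))\<^sup>2 / (m v - m u))"
        by (simp add: add_divide_distrib[symmetric])
    qed
    moreover have "quad m B R \<le> energy m a b B" "quad m C R \<le> energy m a b C"
      using quad_le_energy B C R by blast+
    ultimately show ?thesis using R by linarith
  qed
  have "quad m ?D L1 \<le> 2 * energy m a b B + 2 * energy m a b C - 4 * energy m a b ?M"
    if L1: "tdiv a b L1" for L1
  proof -
    have "energy m a b ?M \<le> (2 * energy m a b B + 2 * energy m a b C - quad m ?D L1) / 4"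
      by (rule energy_least) (use key[OF L1] in force)
    then show ?thesis by simp
  qed
  then have "energy m a b ?D \<le> 2 * energy m a b B + 2 * energy m a b C - 4 * energy m a b ?M"
    by (rule energy_least)
  then show ?thesis by simp
qed

text \<open>By \<open>x \<le> \<alpha> p + x\<^sup>2 / (\<alpha> p)\<close> on each interval, in place of the Cauchy-Schwarz inequality.\<close>

lemma variation_le_of_quad:
  assumes B: "dominated m a b K B" and L: "tdiv a b L" and "\<alpha> > 0" and q: "quad m B L \<le> \<alpha>\<^sup>2"
  shows "(\<Sum>(u, \<tau>, v)\<leftarrow>L. norm (B v - B u)) \<le> \<alpha> * (m b - m a + 1)"
proof -
  have "(\<Sum>(u, \<tau>, v)\<leftarrow>L. norm (B v - B u)) \<le>
    (\<Sum>(u, \<tau>, v)\<leftarrow>L. \<alpha> * (m v - m u) + (1 / \<alpha>) * ((norm (B v - B u))\<^sup>2 / (m v - m u)))"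
  proof (rule sum_list_mono, clarify)
    fix u \<tau> v assume e: "(u, \<tau>, v) \<in> set L"
    note uv = tdiv_mem[OF L e]
    define p x where "p = m v - m u" and "x = norm (B v - B u)"
    have "0 \<le> p" using uv by (auto simp: p_def intro!: mono_onD[OF m])
    have "0 \<le> x" by (simp add: x_def)
    have "x \<le> K * p" unfolding x_def p_def using uv by (intro dominatedD[OF B]) auto
    have "x \<le> \<alpha> * p + (1 / \<alpha>) * (x\<^sup>2 / p)"
    proof (cases "p = 0")
      case True
      then show ?thesis using \<open>x \<le> K * p\<close> by simp
    next
      case False
      then have "p > 0" using \<open>0 \<le> p\<close> by simp
      have "0 \<le> (\<alpha> * p - x)\<^sup>2 + \<alpha> * p * x" using \<open>\<alpha> > 0\<close> \<open>p > 0\<close> \<open>0 \<le> x\<close> by simp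
      then have "\<alpha> * p * x \<le> (\<alpha> * p)\<^sup>2 + x\<^sup>2" by (simp add: power2_eq_square algebra_simps)
      then show ?thesis using \<open>\<alpha> > 0\<close> \<open>p > 0\<close> by (simp add: field_simps power2_eq_square)
    qed
    then show "norm (B v - B u) \<le> \<alpha> * (m v - m u) + (1 / \<alpha>) * ((norm (B v - B u))\<^sup>2 / (m v - m u))"
      by (simp add: p_def x_def)
  qed
  also have "\<dots> = \<alpha> * (\<Sum>(u, \<tau>, v)\<leftarrow>L. m v - m u) + (1 / \<alpha>) * quad m B L"
    unfolding quad_def sum_list_const_mult[symmetric] sum_list_addf[symmetric]
    by (simp add: case_prod_unfold)
  also have "(1 / \<alpha>) * quad m B L \<le> \<alpha>"
    using q \<open>\<alpha> > 0\<close> by (simp add: divide_le_eq power2_eq_square)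
  finally show ?thesis using dsum_telescope[OF L, of m] by (simp add: algebra_simps)
qed

end

section \<open>Limits of dominated sequences of primitives\<close>

text \<open>
  Iterated midpoints of the pairs \<open>(F k, P k)\<close> with \<open>n \<le> k\<close>. These dyadic means replace the convex hull of the
  tail: closure under midpoints is all that the parallelogram law asks for, and every property of primitives needs
  to be checked for midpoints only.
\<close>

inductive tail_mean ::
    "(nat \<Rightarrow> real \<Rightarrow> 'a::real_vector) \<Rightarrow> (nat \<Rightarrow> real \<Rightarrow> 'a) \<Rightarrow> nat \<Rightarrow> (real \<Rightarrow> 'a) \<Rightarrow> (real \<Rightarrow> 'a) \<Rightarrow> bool"
  for F P n where
  base: "n \<le> k \<Longrightarrow> tail_mean F P n (F k) (P k)"
| midpoint: "tail_mean F P n A B \<Longrightarrow> tail_mean F P n A' B' \<Longrightarrow>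
    tail_mean F P n (\<lambda>t. (1/2) *\<^sub>R (A t + A' t)) (\<lambda>t. (1/2) *\<^sub>R (B t + B' t))"

lemma tail_mean_mono: "tail_mean F P n A B \<Longrightarrow> k \<le> n \<Longrightarrow> tail_mean F P k A B"
  by (induction rule: tail_mean.induct) (auto intro: tail_mean.intros)

lemma tail_mean_in_convex:
  assumes "tail_mean F P n A B" "convex S"
  shows "(\<And>k. n \<le> k \<Longrightarrow> F k t \<in> S) \<Longrightarrow> A t \<in> S" "(\<And>k. n \<le> k \<Longrightarrow> P k t \<in> S) \<Longrightarrow> B t \<in> S"
  using assms by (induction rule: tail_mean.induct) (auto intro: midpoint_in_convex)

lemma LIMSEQ_of_tail_convex:
  fixes X Y :: "nat \<Rightarrow> 'a::real_normed_vector"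
  assumes "X \<longlonglongrightarrow> x" "\<And>n S. convex S \<Longrightarrow> (\<And>k. n \<le> k \<Longrightarrow> X k \<in> S) \<Longrightarrow> Y n \<in> S"
  shows "Y \<longlonglongrightarrow> x"
proof (rule tendstoI)
  fix e :: real assume "e > 0"
  then obtain M where M: "\<And>n. n \<ge> M \<Longrightarrow> X n \<in> ball x e"
    using metric_LIMSEQ_D[OF assms(1)] by (metis dist_commute mem_ball)
  have "Y n \<in> ball x e" if "n \<ge> M" for n
    by (rule assms(2)[OF convex_ball M]) (use that in simp)
  then show "\<forall>\<^sub>F n in sequentially. dist (Y n) x < e"
    unfolding eventually_sequentially by (auto simp: dist_commute)
qed

lemma tail_mean_LIMSEQ:
  fixes F P :: "nat \<Rightarrow> real \<Rightarrow> 'a::real_normed_vector"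
  assumes "\<And>n. tail_mean F P n (A n) (B n)"
  shows "(\<lambda>n. F n t) \<longlonglongrightarrow> x \<Longrightarrow> (\<lambda>n. A n t) \<longlonglongrightarrow> x" "(\<lambda>n. P n t) \<longlonglongrightarrow> x \<Longrightarrow> (\<lambda>n. B n t) \<longlonglongrightarrow> x"
  by (erule LIMSEQ_of_tail_convex, rule tail_mean_in_convex[OF assms]; assumption)+

lemma tail_mean_dominated:
  assumes "tail_mean F P n A B" "\<And>k. dominated m a b K (P k)"
  shows "dominated m a b K B"
  using assms by (induction rule: tail_mean.induct) (auto intro: dominated_midpoint)

lemma tail_mean_primitive:
  assumes "tail_mean F P n A B" "\<And>k. ks_primitive g a b (F k) (P k)"
  shows "ks_primitive g a b A B"
  using assms by (induction rule: tail_mean.induct) (auto intro: ks_primitive_midpoint)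

text \<open>
  Means of later and later tails with nearly minimal energy form a Cauchy sequence in energy, hence in variation.
  Their limit is that of the \<open>P n\<close>, as the means of tails of a convergent sequence have the same limit.
\<close>

lemma tail_mean_close_in_variation:
  fixes F P :: "nat \<Rightarrow> real \<Rightarrow> 'a::real_inner"
  assumes ab: "a \<le> b" and m: "mono_on {a..b} m" and dom: "\<And>n. dominated m a b 1 (P n)"
    and lim: "\<And>t. t \<in> {a..b} \<Longrightarrow> (\<lambda>n. P n t) \<longlonglongrightarrow> P\<^sub>0 t" and "\<epsilon> > 0"
  shows "\<exists>A B. tail_mean F P n A B \<and>
    (\<forall>L. tdiv a b L \<longrightarrow> (\<Sum>(u, \<tau>, v)\<leftarrow>L. norm ((B v - P\<^sub>0 v) - (B u - P\<^sub>0 u))) \<le> \<epsilon>)"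
proof -
  define H where "H n = {(A, B). tail_mean F P n A B}" for n
  have mab: "m a \<le> m b" using ab by (intro mono_onD[OF m]) auto
  have H_dom: "dominated m a b 1 B" if "(A, B) \<in> H n" for n A B
    using that tail_mean_dominated[OF _ dom] by (auto simp: H_def)
  have energy_bound: "0 \<le> energy m a b B" "energy m a b B \<le> m b - m a" if "dominated m a b 1 B" for B :: "real \<Rightarrow> 'a"
  proof -
    obtain L where L: "tdiv a b L" using tdiv_exists[OF ab m] by blast
    show "0 \<le> energy m a b B"
      using quad_nonneg[OF ab m L] quad_le_energy[OF ab m that L] by (rule order.trans)
    show "energy m a b B \<le> m b - m a"
      using energy_least[OF ab m, where c = "m b - m a" and B = B] quad_le[OF ab m that] by simp
  qed
  have "\<exists>x. (\<forall>n. x n \<in> H n) \<and>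
    (\<forall>\<epsilon>>0. \<exists>N. \<forall>n\<ge>N. \<forall>j\<ge>n. energy m a b (\<lambda>t. snd (x n) t - snd (x j) t) \<le> \<epsilon>)"
  proof (rule midpoint_minimizing_Cauchy[where E = "\<lambda>x. energy m a b (snd x)" and \<Lambda> = "m b - m a"])
    show "H n \<noteq> {}" for n by (auto simp: H_def intro: tail_mean.base)
    show "H n \<subseteq> H k" if "k \<le> n" for k n using tail_mean_mono[OF _ that] by (auto simp: H_def)
    show "0 \<le> energy m a b (snd x)" "energy m a b (snd x) \<le> m b - m a" if "x \<in> H 0" for x
      using energy_bound H_dom[of "fst x" "snd x" 0] that by auto
    show "\<exists>z\<in>H n. energy m a b (\<lambda>t. snd x t - snd y t) + 4 * energy m a b (snd z)
       \<le> 2 * energy m a b (snd x) + 2 * energy m a b (snd y)" if "x \<in> H n" "y \<in> H n" for n x y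
    proof (rule bexI[of _ "(\<lambda>t. (1/2) *\<^sub>R (fst x t + fst y t), \<lambda>t. (1/2) *\<^sub>R (snd x t + snd y t))"])
      show "energy m a b (\<lambda>t. snd x t - snd y t) +
          4 * energy m a b (snd (\<lambda>t. (1/2) *\<^sub>R (fst x t + fst y t), \<lambda>t. (1/2) *\<^sub>R (snd x t + snd y t)))
        \<le> 2 * energy m a b (snd x) + 2 * energy m a b (snd y)"
        using energy_parallelogram[OF ab m H_dom[of "fst x" "snd x" n] H_dom[of "fst y" "snd y" n]] that
        by simp
      show "(\<lambda>t. (1/2) *\<^sub>R (fst x t + fst y t), \<lambda>t. (1/2) *\<^sub>R (snd x t + snd y t)) \<in> H n"
        using that by (auto simp: H_def intro: tail_mean.midpoint)
    qed
  qed
  then obtain x where x: "\<And>n. x n \<in> H n" and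
    Cauchy: "\<And>\<epsilon>. \<epsilon> > 0 \<Longrightarrow> \<exists>N. \<forall>n\<ge>N. \<forall>j\<ge>n. energy m a b (\<lambda>t. snd (x n) t - snd (x j) t) \<le> \<epsilon>" by blast
  define A B where "A n = fst (x n)" and "B n = snd (x n)" for n
  have AB: "tail_mean F P n (A n) (B n)" for n using x[of n] by (auto simp: H_def A_def B_def)
  have B_dom: "dominated m a b 1 (B n)" for n using tail_mean_dominated[OF AB dom] .
  \<comment> \<open>the choice that turns the energy bound \<open>\<alpha>\<^sup>2\<close> into the variation bound \<open>\<epsilon>\<close>\<close>
  define \<alpha> where "\<alpha> = \<epsilon> / (m b - m a + 1)"
  have "\<alpha> > 0" using mab \<open>\<epsilon> > 0\<close> by (auto simp: \<alpha>_def)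
  then obtain N where N: "\<And>n j. n \<ge> N \<Longrightarrow> j \<ge> n \<Longrightarrow> energy m a b (\<lambda>t. B n t - B j t) \<le> \<alpha>\<^sup>2"
    using Cauchy[of "\<alpha>\<^sup>2"] unfolding B_def by auto
  define k where "k = max n N"
  have "(\<Sum>(u, \<tau>, v)\<leftarrow>L. norm ((B k v - P\<^sub>0 v) - (B k u - P\<^sub>0 u))) \<le> \<epsilon>" if L: "tdiv a b L" for L
  proof (rule LIMSEQ_le_const2)
    have "(\<lambda>j. \<Sum>(u, \<tau>, v)\<leftarrow>M. norm ((B k v - B j v) - (B k u - B j u))) \<longlonglongrightarrow>
       (\<Sum>(u, \<tau>, v)\<leftarrow>M. norm ((B k v - P\<^sub>0 v) - (B k u - P\<^sub>0 u)))" if "set M \<subseteq> set L" for M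
      using that
    proof (induction M)
      case (Cons e M)
      obtain u \<tau> v where e: "e = (u, \<tau>, v)" by (cases e)
      have "u \<in> {a..b}" "v \<in> {a..b}" using tdiv_mem[OF L, of u \<tau> v] Cons.prems e by auto
      then have "(\<lambda>j. B j u) \<longlonglongrightarrow> P\<^sub>0 u" "(\<lambda>j. B j v) \<longlonglongrightarrow> P\<^sub>0 v"
        using tail_mean_LIMSEQ(2)[OF AB lim] by auto
      then show ?case using Cons e by (auto intro!: tendsto_intros)
    qed simp
    then show "(\<lambda>j. \<Sum>(u, \<tau>, v)\<leftarrow>L. norm ((B k v - B j v) - (B k u - B j u))) \<longlonglongrightarrow>
       (\<Sum>(u, \<tau>, v)\<leftarrow>L. norm ((B k v - P\<^sub>0 v) - (B k u - P\<^sub>0 u)))" by simp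
    have "(\<Sum>(u, \<tau>, v)\<leftarrow>L. norm ((B k v - B j v) - (B k u - B j u))) \<le> \<epsilon>" if "j \<ge> k" for j
    proof -
      have d: "dominated m a b (2 * 1) (\<lambda>t. B k t - B j t)" using B_dom by (intro dominated_diff)
      have "quad m (\<lambda>t. B k t - B j t) L \<le> \<alpha>\<^sup>2"
        using quad_le_energy[OF ab m d L] N[of k j] that by (auto simp: k_def)
      from variation_le_of_quad[OF ab m d L \<open>\<alpha> > 0\<close> this]
      show ?thesis using mab by (simp add: \<alpha>_def)
    qed
    then show "\<exists>k'. \<forall>j\<ge>k'. (\<Sum>(u, \<tau>, v)\<leftarrow>L. norm ((B k v - B j v) - (B k u - B j u))) \<le> \<epsilon>" by blast
  qed
  moreover have "tail_mean F P n (A k) (B k)" using tail_mean_mono[OF AB] by (simp add: k_def)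
  ultimately show ?thesis by blast
qed

lemma sum_list_group_le:
  fixes \<Phi> :: "nat \<Rightarrow> 'e \<Rightarrow> real"
  assumes "\<And>i. (\<Sum>e\<leftarrow>L. if k e = i then \<Phi> i e else 0) \<le> \<epsilon> / 2 ^ i" "\<epsilon> \<ge> 0"
  shows "(\<Sum>e\<leftarrow>L. \<Phi> (k e) e) \<le> 2 * \<epsilon>"
proof -
  define n where "n = Suc (Max (insert 0 (k ` set L)))"
  have n: "k e < n" if "e \<in> set L" for e
    unfolding n_def using that by (auto simp: less_Suc_eq_le intro!: Max_ge)
  have "(\<Sum>e\<leftarrow>L. \<Phi> (k e) e) = (\<Sum>e\<leftarrow>L. \<Sum>i<n. if k e = i then \<Phi> i e else 0)"
    by (intro arg_cong[of _ _ sum_list] map_cong refl) (auto dest: n)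
  also have "\<dots> = (\<Sum>i<n. \<Sum>e\<leftarrow>L. if k e = i then \<Phi> i e else 0)"
    by (induction L) (auto simp: sum.distrib)
  also have "\<dots> \<le> (\<Sum>i<n. \<epsilon> / 2 ^ i)" by (intro sum_mono assms)
  also have "\<dots> = \<epsilon> * (\<Sum>i<n. (1/2) ^ i)" by (simp add: sum_distrib_left power_divide)
  also have "\<dots> \<le> \<epsilon> * 2"
  proof (intro mult_left_mono assms)
    have "(\<Sum>i<n. (1/2::real) ^ i) = 2 * (1 - (1/2) ^ n)" by (simp add: sum_gp_strict)
    then show "(\<Sum>i<n. (1/2::real) ^ i) \<le> 2" by simp
  qed
  finally show ?thesis by simp
qed

text \<open>
  Let \<open>A i\<close>, \<open>B i\<close> be tail means with \<open>B i\<close> close to \<open>P\<^sub>0\<close> in variation, up to \<open>\<kappa> / 2\<^sup>i\<close>. At each tag \<open>\<tau>\<close> fix an index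
  \<open>k \<tau>\<close> with \<open>A (k \<tau>) \<tau>\<close> close to \<open>F\<^sub>0 \<tau>\<close> and use the gauge of that index. On an interval the error for \<open>F\<^sub>0\<close> and
  \<open>P\<^sub>0\<close> splits into three parts: the difference of the values; the error of the primitive \<open>B i\<close> of \<open>A i\<close>; the increment of
  \<open>B i - P\<^sub>0\<close>. For the last two, the intervals with the same index \<open>i\<close> contribute at most
  \<open>\<kappa> / 2\<^sup>i\<close>, and these bounds are summable.
\<close>

theorem ks_primitive_dominated_limit:
  fixes F :: "nat \<Rightarrow> real \<Rightarrow> 'a::euclidean_space"
  assumes ab: "a \<le> b" and g: "mono_on {a..b} g" and m: "mono_on {a..b} m"
    and prim: "\<And>n. ks_primitive g a b (F n) (P n)" and dom: "\<And>n. dominated m a b 1 (P n)"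
    and limF: "\<And>t. t \<in> {a..b} \<Longrightarrow> (\<lambda>n. F n t) \<longlonglongrightarrow> F\<^sub>0 t"
    and limP: "\<And>t. t \<in> {a..b} \<Longrightarrow> (\<lambda>n. P n t) \<longlonglongrightarrow> P\<^sub>0 t"
  shows "ks_primitive g a b F\<^sub>0 P\<^sub>0"
  unfolding ks_primitive_def
proof (intro allI impI)
  fix \<epsilon> :: real assume "\<epsilon> > 0"
  define \<kappa> where "\<kappa> = \<epsilon> / (g b - g a + 4)"
  have gab: "g a \<le> g b" using ab by (intro mono_onD[OF g]) auto
  have "\<kappa> > 0" using \<open>\<epsilon> > 0\<close> gab by (auto simp: \<kappa>_def)
  have "\<forall>i. \<exists>A B. tail_mean F P i A B \<and>
    (\<forall>L. tdiv a b L \<longrightarrow> (\<Sum>(u, \<tau>, v)\<leftarrow>L. norm ((B v - P\<^sub>0 v) - (B u - P\<^sub>0 u))) \<le> \<kappa> / 2 ^ i)"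
    using \<open>\<kappa> > 0\<close> by (intro allI tail_mean_close_in_variation[OF ab m dom limP]) auto
  then obtain A where "\<forall>i. \<exists>B. tail_mean F P i (A i) B \<and>
    (\<forall>L. tdiv a b L \<longrightarrow> (\<Sum>(u, \<tau>, v)\<leftarrow>L. norm ((B v - P\<^sub>0 v) - (B u - P\<^sub>0 u))) \<le> \<kappa> / 2 ^ i)"
    by (rule choice[THEN exE])
  then obtain B where "\<forall>i. tail_mean F P i (A i) (B i) \<and>
    (\<forall>L. tdiv a b L \<longrightarrow> (\<Sum>(u, \<tau>, v)\<leftarrow>L. norm ((B i v - P\<^sub>0 v) - (B i u - P\<^sub>0 u))) \<le> \<kappa> / 2 ^ i)"
    by (rule choice[THEN exE])
  then have AB: "\<And>i. tail_mean F P i (A i) (B i)" and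
    var: "\<And>i L. tdiv a b L \<Longrightarrow> (\<Sum>(u, \<tau>, v)\<leftarrow>L. norm ((B i v - P\<^sub>0 v) - (B i u - P\<^sub>0 u))) \<le> \<kappa> / 2 ^ i"
    by blast+
  have "\<forall>i. \<exists>\<delta>. gauge_on a b \<delta> \<and> (\<forall>L. tdiv a b L \<and> fine_div \<delta> L \<longrightarrow>
     (\<Sum>(u, \<tau>, v)\<leftarrow>L. norm ((g v - g u) *\<^sub>R A i \<tau> - (B i v - B i u))) \<le> \<kappa> / 2 ^ i)"
    using tail_mean_primitive[OF AB prim] \<open>\<kappa> > 0\<close> unfolding ks_primitive_def by simp
  then obtain \<delta> where "\<forall>i. gauge_on a b (\<delta> i) \<and> (\<forall>L. tdiv a b L \<and> fine_div (\<delta> i) L \<longrightarrow>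
     (\<Sum>(u, \<tau>, v)\<leftarrow>L. norm ((g v - g u) *\<^sub>R A i \<tau> - (B i v - B i u))) \<le> \<kappa> / 2 ^ i)"
    by (rule choice[THEN exE])
  then have \<delta>: "\<And>i. gauge_on a b (\<delta> i)" and
    hen: "\<And>i L. tdiv a b L \<Longrightarrow> fine_div (\<delta> i) L \<Longrightarrow>
     (\<Sum>(u, \<tau>, v)\<leftarrow>L. norm ((g v - g u) *\<^sub>R A i \<tau> - (B i v - B i u))) \<le> \<kappa> / 2 ^ i" by blast+
  have "\<exists>i. norm (F\<^sub>0 t - A i t) \<le> \<kappa>" if "t \<in> {a..b}" for t
  proof -
    have "(\<lambda>i. A i t) \<longlonglongrightarrow> F\<^sub>0 t" by (rule tail_mean_LIMSEQ(1)[OF AB limF[OF that]])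
    then obtain N where "\<And>i. i \<ge> N \<Longrightarrow> norm (A i t - F\<^sub>0 t) < \<kappa>" using LIMSEQ_D \<open>\<kappa> > 0\<close> by blast
    then show ?thesis by (metis less_imp_le norm_minus_commute order.refl)
  qed
  then obtain k where k: "\<And>t. t \<in> {a..b} \<Longrightarrow> norm (F\<^sub>0 t - A (k t) t) \<le> \<kappa>" by metis
  define \<gamma> where "\<gamma> t = \<delta> (k t) t" for t
  have "gauge_on a b \<gamma>" using \<delta> by (auto simp: gauge_on_def \<gamma>_def)
  moreover have "(\<Sum>(u, \<tau>, v)\<leftarrow>L. norm ((g v - g u) *\<^sub>R F\<^sub>0 \<tau> - (P\<^sub>0 v - P\<^sub>0 u))) \<le> \<epsilon>"
    if L: "tdiv a b L" "fine_div \<gamma> L" for L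
  proof -
    define \<Phi> where "\<Phi> i = (\<lambda>(u, \<tau>, v). norm ((g v - g u) *\<^sub>R A i \<tau> - (B i v - B i u)))" for i
    define \<Xi> where "\<Xi> i = (\<lambda>(u, \<tau> :: real, v). norm ((B i v - P\<^sub>0 v) - (B i u - P\<^sub>0 u)))" for i
    define j where "j = (\<lambda>(u::real, \<tau>::real, v::real). k \<tau>)"
    have 1: "(\<Sum>e\<leftarrow>L. \<Phi> (j e) e) \<le> 2 * \<kappa>"
    proof (rule sum_list_group_le)
      fix i
      have "(\<Sum>(u, \<tau>, v)\<leftarrow>L. if j (u, \<tau>, v) = i then norm ((g v - g u) *\<^sub>R A i \<tau> - (B i v - B i u)) else 0) \<le> \<kappa> / 2 ^ i"
      proof (rule dsum_filter_le_fine[OF \<delta>[of i] L(1)])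
        fix u \<tau> v assume "(u, \<tau>, v) \<in> set L" "j (u, \<tau>, v) = i"
        then show "\<tau> - \<delta> i \<tau> < u \<and> v < \<tau> + \<delta> i \<tau>" using L(2) by (auto simp: fine_div_def \<gamma>_def j_def)
      qed (use hen in auto)
      then show "(\<Sum>e\<leftarrow>L. if j e = i then \<Phi> i e else 0) \<le> \<kappa> / 2 ^ i"
        by (simp add: \<Phi>_def case_prod_unfold cong: if_cong)
    qed (use \<open>\<kappa> > 0\<close> in simp)
    have 2: "(\<Sum>e\<leftarrow>L. \<Xi> (j e) e) \<le> 2 * \<kappa>"
    proof (rule sum_list_group_le)
      fix i
      have "(\<Sum>e\<leftarrow>L. if j e = i then \<Xi> i e else 0) \<le> (\<Sum>e\<leftarrow>L. \<Xi> i e)"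
        by (rule sum_list_mono) (auto simp: \<Xi>_def)
      also have "\<dots> \<le> \<kappa> / 2 ^ i" using var[OF L(1)] by (simp add: \<Xi>_def)
      finally show "(\<Sum>e\<leftarrow>L. if j e = i then \<Xi> i e else 0) \<le> \<kappa> / 2 ^ i" .
    qed (use \<open>\<kappa> > 0\<close> in simp)
    have "(\<Sum>(u, \<tau>, v)\<leftarrow>L. norm ((g v - g u) *\<^sub>R F\<^sub>0 \<tau> - (P\<^sub>0 v - P\<^sub>0 u))) \<le>
      (\<Sum>e\<leftarrow>L. \<kappa> * (case e of (u, \<tau>, v) \<Rightarrow> g v - g u) + (\<Phi> (j e) e + \<Xi> (j e) e))"
    proof (rule sum_list_mono, clarify)
      fix u \<tau> v assume e: "(u, \<tau>, v) \<in> set L"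
      note uv = tdiv_mem[OF L(1) e]
      have "g u \<le> g v" using uv by (intro mono_onD[OF g]) auto
      let ?x = "(g v - g u) *\<^sub>R (F\<^sub>0 \<tau> - A (k \<tau>) \<tau>)"
      let ?y = "(g v - g u) *\<^sub>R A (k \<tau>) \<tau> - (B (k \<tau>) v - B (k \<tau>) u)"
      let ?z = "(B (k \<tau>) v - P\<^sub>0 v) - (B (k \<tau>) u - P\<^sub>0 u)"
      have "norm ((g v - g u) *\<^sub>R F\<^sub>0 \<tau> - (P\<^sub>0 v - P\<^sub>0 u)) = norm (?x + (?y + ?z))"
        by (rule arg_cong[of _ _ norm]) (simp add: algebra_simps)
      also have "\<dots> \<le> norm ?x + (norm ?y + norm ?z)"
        by (intro norm_triangle_le add_left_mono norm_triangle_ineq)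
      also have "norm ?x \<le> (g v - g u) * \<kappa>"
        unfolding norm_scaleR using \<open>g u \<le> g v\<close> uv k[of \<tau>] by (simp add: mult_left_mono)
      finally show "norm ((g v - g u) *\<^sub>R F\<^sub>0 \<tau> - (P\<^sub>0 v - P\<^sub>0 u)) \<le> \<kappa> * (g v - g u) +
          (\<Phi> (j (u, \<tau>, v)) (u, \<tau>, v) + \<Xi> (j (u, \<tau>, v)) (u, \<tau>, v))"
        by (simp add: \<Phi>_def \<Xi>_def j_def mult.commute)
    qed
    also have "\<dots> = \<kappa> * (\<Sum>(u, \<tau>, v)\<leftarrow>L. g v - g u) + ((\<Sum>e\<leftarrow>L. \<Phi> (j e) e) + (\<Sum>e\<leftarrow>L. \<Xi> (j e) e))"
      by (simp only: sum_list_addf sum_list_const_mult)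
    also have "\<dots> \<le> \<kappa> * (g b - g a) + 4 * \<kappa>"
      using 1 2 dsum_telescope[OF L(1), of g] by simp
    also have "\<dots> = \<kappa> * (g b - g a + 4)" by (simp add: algebra_simps)
    also have "\<dots> = \<epsilon>" using gab by (simp add: \<kappa>_def)
    finally show ?thesis .
  qed
  ultimately show "\<exists>\<delta>. gauge_on a b \<delta> \<and> (\<forall>L. tdiv a b L \<and> fine_div \<delta> L \<longrightarrow>
      (\<Sum>(u, \<tau>, v)\<leftarrow>L. norm ((g v - g u) *\<^sub>R F\<^sub>0 \<tau> - (P\<^sub>0 v - P\<^sub>0 u))) \<le> \<epsilon>)" by blast
qed

section \<open>Euler approximations\<close>

definition last_before :: "real \<Rightarrow> real set \<Rightarrow> real \<Rightarrow> real" where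
  "last_before a S s = Max {r \<in> insert a S. r \<le> s}"

lemma last_before:
  assumes "finite S" "a \<le> s"
  shows "last_before a S s \<in> insert a S" "last_before a S s \<le> s" "a \<le> last_before a S s"
    "\<And>r. r \<in> S \<Longrightarrow> r \<le> s \<Longrightarrow> r \<le> last_before a S s"
proof -
  let ?M = "{r \<in> insert a S. r \<le> s}"
  have M: "finite ?M" "?M \<noteq> {}" using assms by auto
  from Max_in[OF M] show "last_before a S s \<in> insert a S" "last_before a S s \<le> s"
    by (auto simp: last_before_def)
  show "a \<le> last_before a S s" "\<And>r. r \<in> S \<Longrightarrow> r \<le> s \<Longrightarrow> r \<le> last_before a S s"
    unfolding last_before_def using M assms by (auto intro!: Max_ge)
qed

lemma last_before_eq:
  assumes "finite S" "a \<le> s" "s \<in> insert a S"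
  shows "last_before a S s = s"
proof -
  have "s \<le> last_before a S s" using last_before(3,4)[OF assms(1,2)] assms(3) by auto
  then show ?thesis using last_before(2)[OF assms(1,2)] by simp
qed

lemma last_before_insert_less: "s < p \<Longrightarrow> last_before a (insert p S) s = last_before a S s"
  unfolding last_before_def by (rule arg_cong[of _ _ Max]) auto

lemma last_before_insert_ge:
  assumes "finite S" "\<And>x. x \<in> S \<Longrightarrow> x < p" "a < p" "p \<le> s"
  shows "last_before a (insert p S) s = p"
  unfolding last_before_def using assms by (intro Max_eqI) (auto intro: less_imp_le)

text \<open>
  Explicit Euler steps, by induction on the largest grid point \<open>p\<close>: beyond \<open>p\<close> the parameter of \<open>k\<close> is constant, so
  the primitive continues with that of \<open>k s u\<close>. On \<open>[a, p]\<close> the new integrand differs from the old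
  one only at the right end \<open>p\<close>, where the primitive does not notice the change.
\<close>

lemma euler_primitive:
  fixes k :: "real \<Rightarrow> 'b \<Rightarrow> 'a::euclidean_space"
  assumes ab: "a < b" and g: "mono_on {a..b} g"
    and left: "\<And>t. t \<in> {a<..b} \<Longrightarrow> (g \<longlongrightarrow> g t) (at_left t)"
    and m: "mono_on {a..b} m"
    and K: "\<And>u. ks_primitive g a b (\<lambda>s. k s u) (K u)" "\<And>u. dominated m a b 1 (K u)"
    and S: "finite S" "S \<subseteq> {a<..b}"
  shows "\<exists>z. z a = 0 \<and> dominated m a b 1 z \<and>
    ks_primitive g a b (\<lambda>s. k s (\<Psi> (last_before a S s) (z (last_before a S s)))) z"
  using S
proof (induction S rule: finite_linorder_max_induct)
  case empty
  define u where "u = \<Psi> a 0"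
  have *: "last_before a {} s = a" if "a \<le> s" for s
    using last_before(1)[of "{}" a s] that by simp
  show ?case
  proof (intro exI[of _ "\<lambda>t. K u t - K u a"] conjI)
    show "dominated m a b 1 (\<lambda>t. K u t - K u a)" using K(2)[of u] by (simp add: dominated_def)
    show "ks_primitive g a b (\<lambda>s. k s (\<Psi> (last_before a {} s) (K u (last_before a {} s) - K u a))) (\<lambda>t. K u t - K u a)"
      by (rule ks_primitive_cong[OF K(1)[of u]]) (auto simp: * u_def)
  qed simp
next
  case (insert p A)
  have p: "a < p" "p \<le> b" using insert.prems by auto
  obtain z where z: "z a = 0" "dominated m a b 1 z"
    "ks_primitive g a b (\<lambda>s. k s (\<Psi> (last_before a A s) (z (last_before a A s)))) z"
    using insert by auto
  define u where "u = \<Psi> p (z p)"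
  define z' where "z' t = (if t \<le> p then z t else z p + (K u t - K u p))" for t
  let ?F = "\<lambda>s. k s (\<Psi> (last_before a (insert p A) s) (z' (last_before a (insert p A) s)))"
  have "dominated m a b 1 z'"
    unfolding dominated_def
  proof (intro allI impI, elim conjE)
    fix s t assume st: "a \<le> s" "s \<le> t" "t \<le> b"
    consider "t \<le> p" | "p \<le> s" "p < t" | "s < p" "p < t" using st by linarith
    then show "norm (z' t - z' s) \<le> 1 * (m t - m s)"
    proof cases
      case 1
      then show ?thesis using dominatedD[OF z(2) st] st by (simp add: z'_def)
    next
      case 2
      then have "z' t - z' s = K u t - K u s" by (auto simp: z'_def)
      then show ?thesis using dominatedD[OF K(2) st, of u] by simp
    next
      case 3
      then have "norm (z' t - z' s) = norm ((z p - z s) + (K u t - K u p))" by (simp add: z'_def algebra_simps)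
      also have "\<dots> \<le> norm (z p - z s) + norm (K u t - K u p)" by (rule norm_triangle_ineq)
      also have "\<dots> \<le> 1 * (m p - m s) + 1 * (m t - m p)"
        using 3 st p by (intro add_mono dominatedD[OF z(2)] dominatedD[OF K(2)]) auto
      finally show ?thesis by simp
    qed
  qed
  moreover have "ks_primitive g a b ?F z'"
  proof (rule ks_primitive_join[of g a p])
    have "ks_primitive g a p (\<lambda>s. k s (\<Psi> (last_before a A s) (z (last_before a A s)))) z"
      by (rule ks_primitive_subinterval[OF z(3)]) (use p in auto)
    then have "ks_primitive g a p ?F z"
    proof (rule ks_primitive_change_right_end)
      show "mono_on {a..p} g" using g by (rule mono_on_subset) (use p in auto)
      show "?F t = k t (\<Psi> (last_before a A t) (z (last_before a A t)))" if "a \<le> t" "t < p" for t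
        using that last_before(2)[of A a t] insert.hyps by (simp add: last_before_insert_less z'_def)
    qed (use p left in auto)
    then show "ks_primitive g a p ?F z'"
      by (rule ks_primitive_cong) (auto simp: z'_def)
    have "ks_primitive g p b (\<lambda>s. k s u) (K u)"
      by (rule ks_primitive_subinterval[OF K(1)]) (use p in auto)
    then show "ks_primitive g p b ?F z'"
    proof (rule ks_primitive_cong)
      show "k t u = ?F t" if "t \<in> {p..b}" for t
        using that insert.hyps p last_before_insert_ge[of A p a t] by (auto simp: u_def z'_def)
      show "K u t - K u s = z' t - z' s" if "p \<le> s" "s \<le> t" "t \<le> b" for s t
        using that by (cases "t \<le> p") (auto simp: z'_def dest: order.antisym)
    qed
  qed (use p in auto)
  moreover have "z' a = 0" using z p by (simp add: z'_def)
  ultimately show ?case by blast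
qed

section \<open>Grids exhausting a countable set\<close>

text \<open>
  The first points in an enumeration of \<open>C\<close>. If \<open>C\<close> is dense, the last grid point before \<open>s\<close> converges to \<open>s\<close>;
  for \<open>s \<in> C\<close> it finally equals \<open>s\<close>, which is essential where the functions to be approximated are discontinuous.
\<close>

definition grid :: "real \<Rightarrow> real \<Rightarrow> real set \<Rightarrow> nat \<Rightarrow> real set" where
  "grid a b C n = {a<..b} \<inter> from_nat_into C ` {..n}"

lemma finite_grid [simp]: "finite (grid a b C n)"
  by (simp add: grid_def)

lemma eventually_mem_grid:
  assumes "countable C" "r \<in> C" "r \<in> {a<..b}"
  shows "\<forall>\<^sub>F n in sequentially. r \<in> grid a b C n"
proof -
  obtain N where "r = from_nat_into C N" using assms from_nat_into_surj[OF assms(1,2)] by metis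
  then show ?thesis using assms unfolding eventually_sequentially grid_def by blast
qed

lemma last_before_grid_eventually_eq:
  assumes "countable C" "s \<in> C" "s \<in> {a..b}"
  shows "\<forall>\<^sub>F n in sequentially. last_before a (grid a b C n) s = s"
proof (cases "s = a")
  case True
  then show ?thesis by (simp add: last_before_eq)
next
  case False
  then have "s \<in> {a<..b}" using assms by auto
  from eventually_mem_grid[OF assms(1,2) this] show ?thesis
    by eventually_elim (use assms in \<open>auto intro!: last_before_eq\<close>)
qed

lemma last_before_grid_tendsto:
  assumes C: "countable C" "\<rat> \<inter> {a..b} \<subseteq> C" and s: "s \<in> {a..b}"
  shows "(\<lambda>n. last_before a (grid a b C n) s) \<longlonglongrightarrow> s"
proof (rule increasing_tendsto)
  show "\<forall>\<^sub>F n in sequentially. last_before a (grid a b C n) s \<le> s"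
    using s by (auto intro!: always_eventually last_before)
  fix x assume "x < s"
  show "\<forall>\<^sub>F n in sequentially. x < last_before a (grid a b C n) s"
  proof (cases "x < a")
    case True
    then show ?thesis using s last_before(3)[OF finite_grid] by (auto intro!: always_eventually intro: less_le_trans)
  next
    case False
    obtain r where r: "r \<in> \<rat>" "x < r" "r < s" using Rats_dense_in_real[OF \<open>x < s\<close>] by blast
    then have "r \<in> C" "r \<in> {a<..b}" using False C s by auto
    from eventually_mem_grid[OF C(1) this] show ?thesis
    proof eventually_elim
      case (elim n)
      then show ?case using last_before(4)[where a = a and s = s, OF finite_grid _ elim] s r by auto
    qed
  qed
qed

section \<open>Pointwise compactness of dominated functions\<close>

lemma countable_mono_discont:
  fixes m :: "real \<Rightarrow> real"
  assumes "mono_on {a..b} m"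
  shows "countable {s \<in> {a..b}. \<not> continuous (at s within {a..b}) m}"
  using mono_on_ctble_discont[OF assms] .

lemma dominated_dist_le:
  assumes "dominated m a b 1 z" "s \<in> {a..b}" "t \<in> {a..b}"
  shows "norm (z t - z s) \<le> \<bar>m t - m s\<bar>"
  using dominatedD[OF assms(1), of s t] dominatedD[OF assms(1), of t s] assms(2,3)
  by (cases "s \<le> t") (auto simp: norm_minus_commute)

text \<open>
  Helly's selection principle. A diagonal sequence converges on a countable dense set that contains the discontinuities of
  \<open>m\<close>; elsewhere \<open>m\<close> is continuous, which makes the functions \<open>z n\<close> equicontinuous at the point.
\<close>

lemma dominated_convergent_subsequence:
  fixes z :: "nat \<Rightarrow> real \<Rightarrow> 'a::euclidean_space"
  assumes ab: "a < b" and m: "mono_on {a..b} m"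
    and z: "\<And>n. dominated m a b 1 (z n)" "\<And>n. z n a = 0"
  shows "\<exists>r y. strict_mono (r :: nat \<Rightarrow> nat) \<and> (\<forall>t\<in>{a..b}. (\<lambda>n. z (r n) t) \<longlonglongrightarrow> y t)"
proof -
  define C where "C = (\<rat> \<inter> {a..b}) \<union> {s \<in> {a..b}. \<not> continuous (at s within {a..b}) m}"
  have "countable C" unfolding C_def
    using countable_rat countable_mono_discont[OF m] by (auto intro: countable_subset)
  moreover have "norm (z n x) \<le> m b - m a" if "x \<in> C" for n x
  proof -
    have x: "a \<le> x" "x \<le> b" using that by (auto simp: C_def)
    then have "m x \<le> m b" using ab by (intro mono_onD[OF m]) auto
    then show ?thesis using dominatedD[OF z(1)[of n], of a x] z(2)[of n] x by simp
  qed
  ultimately obtain r where r: "strict_mono (r :: nat \<Rightarrow> nat)"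
    and conv: "\<And>x. x \<in> C \<Longrightarrow> \<exists>l. (\<lambda>n. z (r n) x) \<longlonglongrightarrow> l"
    by (rule function_convergent_subsequence[where f = z]) blast+
  have "\<exists>l. (\<lambda>n. z (r n) t) \<longlonglongrightarrow> l" if t: "t \<in> {a..b}" for t
  proof (cases "t \<in> C")
    case False
    then have cont: "continuous (at t within {a..b}) m" using t by (auto simp: C_def)
    have "Cauchy (\<lambda>n. z (r n) t)"
    proof (rule metric_CauchyI)
      fix e :: real assume "e > 0"
      then obtain d where d: "d > 0" "\<And>s. s \<in> {a..b} \<Longrightarrow> dist s t < d \<Longrightarrow> dist (m s) (m t) < e / 3"
        using cont unfolding continuous_within_eps_delta by (metis zero_less_divide_iff zero_less_numeral)
      obtain q where q: "q \<in> \<rat>" "q \<in> {a..b}" "dist q t < d"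
      proof -
        have "max a (t - d) < min b (t + d)" using t d ab by auto
        then obtain q where "q \<in> \<rat>" "max a (t - d) < q" "q < min b (t + d)"
          using Rats_dense_in_real by blast
        then show thesis using that[of q] by (auto simp: dist_real_def)
      qed
      have close: "norm (z n t - z n q) < e / 3" for n
        using dominated_dist_le[OF z(1)[of n] q(2) t] d(2)[OF q(2,3)] unfolding dist_real_def by linarith
      obtain l where "(\<lambda>n. z (r n) q) \<longlonglongrightarrow> l" using conv[of q] q by (auto simp: C_def)
      then have "Cauchy (\<lambda>n. z (r n) q)" by (rule LIMSEQ_imp_Cauchy)
      then obtain M where M: "\<And>i j. i \<ge> M \<Longrightarrow> j \<ge> M \<Longrightarrow> dist (z (r i) q) (z (r j) q) < e / 3"
        using metric_CauchyD[of _ "e / 3"] \<open>e > 0\<close> by (metis zero_less_divide_iff zero_less_numeral)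
      have "dist (z (r i) t) (z (r j) t) < e" if "i \<ge> M" "j \<ge> M" for i j
      proof -
        have "dist (z (r i) t) (z (r j) t) \<le> dist (z (r i) t) (z (r i) q) + dist (z (r i) q) (z (r j) q) + dist (z (r j) q) (z (r j) t)"
          using dist_triangle[of "z (r i) t" "z (r j) t" "z (r i) q"]
            dist_triangle[of "z (r i) q" "z (r j) t" "z (r j) q"] by linarith
        then show ?thesis using M[OF that] close[of "r i"] close[of "r j"]
          by (simp add: dist_norm norm_minus_commute)
      qed
      then show "\<exists>M. \<forall>i\<ge>M. \<forall>j\<ge>M. dist (z (r i) t) (z (r j) t) < e" by blast
    qed
    then show ?thesis using Cauchy_convergent convergent_def by blast
  qed (rule conv)
  then show ?thesis using r by metis
qed

section \<open>Regulated functions\<close>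

text \<open>
  For each \<open>e\<close> the points of oscillation at least \<open>e\<close> are isolated: near \<open>t\<close>, but apart from \<open>t\<close>, the values are close to one
  of the one-sided limits at \<open>t\<close>. By compactness there are finitely many such points.
\<close>

lemma regulated_countable_discont:
  fixes x :: "real \<Rightarrow> 'a::banach"
  assumes reg: "regulated_on a b x" and ab: "a \<le> b"
  shows "countable {s \<in> {a..b}. \<not> continuous (at s within {a..b}) x}"
proof -
  define osc where "osc e s \<longleftrightarrow> (\<exists>d>0. \<forall>p\<in>{a..b}. \<forall>q\<in>{a..b}. dist p s < d \<longrightarrow> dist q s < d \<longrightarrow> dist (x p) (x q) < e)"
    for e s
  have punctured: "\<forall>\<^sub>F s in at t. s \<in> {a..b} \<longrightarrow> osc e s" if t: "t \<in> {a..b}" and "e > 0" for t e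
  proof -
    have one_sided: "osc e s" if U: "\<And>p. p \<in> {u<..<v} \<Longrightarrow> dist (x p) l < e / 2" and "s \<in> {u<..<v}" for u v l s
    proof -
      have "open {u<..<v}" by simp
      then obtain d where "d > 0" "ball s d \<subseteq> {u<..<v}" using \<open>s \<in> {u<..<v}\<close> open_contains_ball by blast
      moreover have "dist (x p) (x q) < e" if "p \<in> {u<..<v}" "q \<in> {u<..<v}" for p q
        using U[OF that(1)] U[OF that(2)] dist_triangle_half_l[of "x p" l e "x q"] by (simp add: dist_commute)
      ultimately show ?thesis unfolding osc_def by (intro exI[of _ d]) (auto simp: subset_eq dist_commute)
    qed
    have "\<forall>\<^sub>F s in at_left t. s \<in> {a..b} \<longrightarrow> osc e s"
    proof (cases "a < t")
      case True
      then have "t \<in> {a<..b}" using t by auto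
      then obtain l where "(x \<longlongrightarrow> l) (at_left t)" using reg unfolding regulated_on_def by blast
      then have "\<forall>\<^sub>F p in at_left t. dist (x p) l < e / 2" using \<open>e > 0\<close> by (intro tendstoD) auto
      then obtain u where u: "u < t" "\<And>p. u < p \<Longrightarrow> p < t \<Longrightarrow> dist (x p) l < e / 2"
        unfolding eventually_at_left_field by blast
      then have "osc e s" if "u < s" "s < t" for s using one_sided[of u t l s] that by auto
      then show ?thesis unfolding eventually_at_left_field using u(1) by blast
    next
      case False
      then show ?thesis unfolding eventually_at_left_field using t by (intro exI[of _ "t - 1"]) auto
    qed
    moreover have "\<forall>\<^sub>F s in at_right t. s \<in> {a..b} \<longrightarrow> osc e s"
    proof (cases "t < b")
      case True
      then have "t \<in> {a..<b}" using t by auto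
      then obtain l where "(x \<longlongrightarrow> l) (at_right t)" using reg unfolding regulated_on_def by blast
      then have "\<forall>\<^sub>F p in at_right t. dist (x p) l < e / 2" using \<open>e > 0\<close> by (intro tendstoD) auto
      then obtain v where v: "t < v" "\<And>p. t < p \<Longrightarrow> p < v \<Longrightarrow> dist (x p) l < e / 2"
        unfolding eventually_at_right_field by blast
      then have "osc e s" if "t < s" "s < v" for s using one_sided[of t v l s] that by auto
      then show ?thesis unfolding eventually_at_right_field using v(1) by blast
    next
      case False
      then show ?thesis unfolding eventually_at_right_field using t by (intro exI[of _ "t + 1"]) auto
    qed
    ultimately show ?thesis by (simp add: eventually_at_split)
  qed
  have "finite {s \<in> {a..b}. \<not> osc e s}" if "e > 0" for e
  proof -
    let ?S = "{s \<in> {a..b}. \<not> osc e s}"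
    have "finite ({a..b} \<inter> ?S)"
    proof (rule finite_not_islimpt_in_compact)
      show "\<not> t islimpt {s \<in> {a..b}. \<not> osc e s}" if "t \<in> {a..b}" for t
      proof -
        have "\<forall>\<^sub>F s in at t. s \<notin> {s \<in> {a..b}. \<not> osc e s}"
          using punctured[OF that \<open>e > 0\<close>] by eventually_elim auto
        then show ?thesis unfolding islimpt_iff_eventually by simp
      qed
    qed simp
    moreover have "{a..b} \<inter> ?S = ?S" by auto
    ultimately show ?thesis by simp
  qed
  then have "countable (\<Union>n::nat. {s \<in> {a..b}. \<not> osc (1 / Suc n) s})"
    by (intro countable_UN) (auto intro: countable_finite)
  moreover have "{s \<in> {a..b}. \<not> continuous (at s within {a..b}) x} \<subseteq> (\<Union>n::nat. {s \<in> {a..b}. \<not> osc (1 / Suc n) s})"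
  proof (rule subsetI, rule ccontr)
    fix s assume s: "s \<in> {s \<in> {a..b}. \<not> continuous (at s within {a..b}) x}"
      and "s \<notin> (\<Union>n::nat. {s \<in> {a..b}. \<not> osc (1 / Suc n) s})"
    then have osc: "osc (1 / Suc n) s" for n by auto
    have "continuous (at s within {a..b}) x"
      unfolding continuous_within_eps_delta
    proof (intro allI impI)
      fix e :: real assume "e > 0"
      then obtain n where n: "1 / real (Suc n) < e" using nat_approx_posE by blast
      obtain d where d: "d > 0" "\<And>p q. p \<in> {a..b} \<Longrightarrow> q \<in> {a..b} \<Longrightarrow> dist p s < d \<Longrightarrow> dist q s < d \<Longrightarrow> dist (x p) (x q) < 1 / Suc n"
        using osc[of n] unfolding osc_def by blast
      have "dist (x p) (x s) < e" if "p \<in> {a..b}" "dist p s < d" for p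
        using d(2)[of p s] that s d(1) n by auto
      then show "\<exists>d>0. \<forall>x'\<in>{a..b}. dist x' s < d \<longrightarrow> dist (x x') (x s) < e" using d(1) by blast
    qed
    then show False using s by simp
  qed
  ultimately show ?thesis by (rule countable_subset[rotated])
qed

lemma monotone_one_sided_limits:
  fixes m :: "real \<Rightarrow> real"
  assumes m: "mono_on {a..b} m"
  shows "t \<in> {a<..b} \<Longrightarrow> \<exists>l. (m \<longlongrightarrow> l) (at_left t)" "t \<in> {a..<b} \<Longrightarrow> \<exists>l. (m \<longlongrightarrow> l) (at_right t)"
proof -
  assume t: "t \<in> {a<..b}"
  have "(m \<longlongrightarrow> Sup (m ` ({..<t} \<inter> {a<..}))) (at t within ({..<t} \<inter> {a<..}))"
    by (rule Lim_left_bound[where K = "m t"]) (use t in \<open>auto intro!: mono_onD[OF m]\<close>)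
  moreover have "at t within ({..<t} \<inter> {a<..}) = at_left t"
    by (rule at_within_nhd[of _ "{a<..}"]) (use t in auto)
  ultimately show "\<exists>l. (m \<longlongrightarrow> l) (at_left t)" by auto
next
  assume t: "t \<in> {a..<b}"
  have "(m \<longlongrightarrow> Inf (m ` ({t<..} \<inter> {..<b}))) (at t within ({t<..} \<inter> {..<b}))"
    by (rule Lim_right_bound[where K = "m t"]) (use t in \<open>auto intro!: mono_onD[OF m]\<close>)
  moreover have "at t within ({t<..} \<inter> {..<b}) = at_right t"
    by (rule at_within_nhd[of _ "{..<b}"]) (use t in auto)
  ultimately show "\<exists>l. (m \<longlongrightarrow> l) (at_right t)" by auto
qed

text \<open>
  Each coordinate is a difference of two monotone functions: adding \<open>m\<close> makes it monotone.
\<close>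

lemma dominated_regulated:
  fixes y :: "real \<Rightarrow> 'a::euclidean_space"
  assumes m: "mono_on {a..b} m" and y: "dominated m a b 1 y"
  shows "regulated_on a b y"
proof -
  define p where "p i t = m t + y t \<bullet> i" for i t
  have p: "mono_on {a..b} (p i)" if i: "i \<in> Basis" for i
  proof (rule mono_onI)
    fix s t assume st: "s \<in> {a..b}" "t \<in> {a..b}" "s \<le> t"
    have "\<bar>(y t - y s) \<bullet> i\<bar> \<le> norm (y t - y s)" by (rule Basis_le_norm[OF i])
    also have "\<dots> \<le> m t - m s" using dominatedD[OF y, of s t] st by simp
    finally show "p i s \<le> p i t" by (simp add: p_def inner_diff_left)
  qed
  have y_eq: "y t = (\<Sum>i\<in>Basis. (p i t - m t) *\<^sub>R i)" for t
    by (simp add: p_def euclidean_representation)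
  have lim: "\<exists>l. (y \<longlongrightarrow> l) F" if lm: "\<exists>l. (m \<longlongrightarrow> l) F" and lp: "\<And>i. i \<in> Basis \<Longrightarrow> \<exists>l. (p i \<longlongrightarrow> l) F" for F
  proof -
    obtain l q where "(m \<longlongrightarrow> l) F" "\<And>i. i \<in> Basis \<Longrightarrow> (p i \<longlongrightarrow> q i) F"
      using lm bchoice[of Basis "\<lambda>i l. (p i \<longlongrightarrow> l) F"] lp by blast
    then have "((\<lambda>t. \<Sum>i\<in>Basis. (p i t - m t) *\<^sub>R i) \<longlongrightarrow> (\<Sum>i\<in>Basis. (q i - l) *\<^sub>R i)) F"
      by (intro tendsto_intros) auto
    moreover have "y = (\<lambda>t. \<Sum>i\<in>Basis. (p i t - m t) *\<^sub>R i)" using y_eq by (rule ext)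
    ultimately show ?thesis by metis
  qed
  show ?thesis unfolding regulated_on_def
    using lim monotone_one_sided_limits[OF m] monotone_one_sided_limits[OF p] by auto
qed

section \<open>Arbitrary norms\<close>

locale finite_dim_norm =
  fixes N :: "'a::euclidean_space \<Rightarrow> real"
  assumes N: "is_norm N"
begin

lemma N_nonneg [simp]: "0 \<le> N x" and N_eq_0 [simp]: "N x = 0 \<longleftrightarrow> x = 0"
  and N_scaleR: "N (c *\<^sub>R x) = \<bar>c\<bar> * N x" and N_add_le: "N (x + y) \<le> N x + N y"
  using N unfolding is_norm_def by blast+

lemma N_0 [simp]: "N 0 = 0"
  by simp

lemma N_minus [simp]: "N (- x) = N x"
  using N_scaleR[of "-1" x] by simp

lemma N_diff_commute: "N (x - y) = N (y - x)"
  using N_minus[of "x - y"] by simp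

lemma N_triangle: "N (x - z) \<le> N (x - y) + N (y - z)"
  using N_add_le[of "x - y" "y - z"] by simp

lemma N_le_norm: "\<exists>C>0. \<forall>x. N x \<le> C * norm x"
proof (intro exI conjI allI)
  let ?C = "(\<Sum>i\<in>Basis. N i) + 1"
  show "?C > 0" by (simp add: sum_nonneg add_nonneg_pos)
  fix x :: 'a
  have sum: "N (\<Sum>i\<in>I. y i) \<le> (\<Sum>i\<in>I. N (y i))" if "finite I" for I and y :: "'a \<Rightarrow> 'a"
    using that
  proof (induction I rule: finite_induct)
    case (insert i I)
    then show ?case using N_add_le[of "y i" "\<Sum>i\<in>I. y i"] by simp
  qed simp
  have "N x = N (\<Sum>i\<in>Basis. (x \<bullet> i) *\<^sub>R i)" by (simp add: euclidean_representation)
  also have "\<dots> \<le> (\<Sum>i\<in>Basis. N ((x \<bullet> i) *\<^sub>R i))" by (rule sum) simp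
  also have "\<dots> \<le> (\<Sum>i\<in>Basis. norm x * N i)"
    by (rule sum_mono) (simp add: N_scaleR Basis_le_norm mult_right_mono)
  also have "\<dots> = norm x * (\<Sum>i\<in>Basis. N i)" by (simp add: sum_distrib_left)
  also have "\<dots> \<le> ?C * norm x" by (simp add: algebra_simps)
  finally show "N x \<le> ?C * norm x" .
qed

lemma continuous_on_N: "continuous_on S N"
proof -
  obtain C where C: "C > 0" "\<And>x. N x \<le> C * norm x" using N_le_norm by blast
  have "\<bar>N y - N x\<bar> \<le> C * norm (y - x)" for x y
    using N_add_le[of "y - x" x] N_add_le[of "x - y" y] C(2)[of "y - x"] N_diff_commute[of x y] by simp
  then have "C-lipschitz_on S N"
    using C(1) by (intro lipschitz_onI) (auto simp: dist_norm)
  then show ?thesis by (rule lipschitz_on_continuous_on)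
qed

lemma norm_le_N: "\<exists>c>0. \<forall>x. norm x \<le> c * N x"
proof -
  obtain y :: 'a where y: "y \<in> sphere 0 1" "\<And>x. x \<in> sphere 0 1 \<Longrightarrow> N y \<le> N x"
    using continuous_attains_inf[OF _ _ continuous_on_N, of "sphere 0 1"] by auto
  have "y \<noteq> 0" using y(1) by auto
  then have Ny: "N y > 0" using N_nonneg[of y] N_eq_0[of y] by linarith
  have "norm x \<le> (1 / N y) * N x" for x
  proof (cases "x = 0")
    case False
    have "N y \<le> N ((1 / norm x) *\<^sub>R x)" using False by (intro y(2)) simp
    then show ?thesis using False Ny by (simp add: N_scaleR field_simps)
  qed simp
  then show ?thesis using Ny by (intro exI[of _ "1 / N y"]) auto
qed

lemma tendsto_iff_N: "(X \<longlongrightarrow> l) F \<longleftrightarrow> ((\<lambda>i. N (X i - l)) \<longlongrightarrow> 0) F"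
proof
  obtain C where C: "C > 0" "\<And>x. N x \<le> C * norm x" using N_le_norm by blast
  assume "(X \<longlongrightarrow> l) F"
  then have "((\<lambda>i. C * norm (X i - l)) \<longlongrightarrow> 0) F"
    by (intro tendsto_mult_right_zero tendsto_norm_zero LIM_zero)
  then show "((\<lambda>i. N (X i - l)) \<longlongrightarrow> 0) F"
    by (rule tendsto_0_le[where K = 1, OF _ always_eventually]) (use C in \<open>auto intro: order.trans\<close>)
next
  obtain c where c: "c > 0" "\<And>x. norm x \<le> c * N x" using norm_le_N by blast
  assume "((\<lambda>i. N (X i - l)) \<longlongrightarrow> 0) F"
  then have "((\<lambda>i. X i - l) \<longlongrightarrow> 0) F"
    by (rule tendsto_0_le[where K = c, OF _ always_eventually]) (use c in \<open>auto simp: mult.commute\<close>)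
  then show "(X \<longlongrightarrow> l) F" by (rule LIM_zero_cancel)
qed

lemma has_ks_integral_iff_norm: "has_ks_integral N F g a b I \<longleftrightarrow> has_ks_integral norm F g a b I"
proof
  obtain c where c: "c > 0" "\<And>x. norm x \<le> c * N x" using norm_le_N by blast
  assume I: "has_ks_integral N F g a b I"
  show "has_ks_integral norm F g a b I"
    unfolding has_ks_integral_def
  proof (intro allI impI)
    fix \<epsilon> :: real assume "\<epsilon> > 0"
    then have "\<epsilon> / c > 0" using c by simp
    moreover have "norm x < \<epsilon>" if "N x < \<epsilon> / c" for x
      using c(2)[of x] that c(1) by (simp add: field_simps)
    ultimately show "\<exists>\<delta>. gauge_on a b \<delta> \<and> (\<forall>k s \<tau>. tagged_partition a b k s \<tau> \<and> delta_fine \<delta> k s \<tau> \<longrightarrow>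
        norm ((\<Sum>i=1..k. (g (s i) - g (s (i - 1))) *\<^sub>R F (\<tau> i)) - I) < \<epsilon>)"
      using I unfolding has_ks_integral_def by meson
  qed
next
  obtain C where C: "C > 0" "\<And>x. N x \<le> C * norm x" using N_le_norm by blast
  assume I: "has_ks_integral norm F g a b I"
  show "has_ks_integral N F g a b I"
    unfolding has_ks_integral_def
  proof (intro allI impI)
    fix \<epsilon> :: real assume "\<epsilon> > 0"
    then have "\<epsilon> / C > 0" using C by simp
    moreover have "N x < \<epsilon>" if "norm x < \<epsilon> / C" for x
      using C(2)[of x] that C(1) by (simp add: field_simps)
    ultimately show "\<exists>\<delta>. gauge_on a b \<delta> \<and> (\<forall>k s \<tau>. tagged_partition a b k s \<tau> \<and> delta_fine \<delta> k s \<tau> \<longrightarrow>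
        N ((\<Sum>i=1..k. (g (s i) - g (s (i - 1))) *\<^sub>R F (\<tau> i)) - I) < \<epsilon>)"
      using I unfolding has_ks_integral_def by meson
  qed
qed

end

section \<open>Nonlinear contractions and their resolvents\<close>

locale nonlinear_contraction = finite_dim_norm N for N :: "'a::euclidean_space \<Rightarrow> real" +
  fixes \<phi> :: "real \<Rightarrow> real"
  assumes D: "D_function \<phi>" and less: "\<And>t. t > 0 \<Longrightarrow> \<phi> t < t"
    and liminf: "Liminf at_top (\<lambda>r. ereal (\<phi> r / r)) < 1"
begin

definition contractive :: "('a \<Rightarrow> 'a) \<Rightarrow> bool" where
  "contractive H \<longleftrightarrow> (\<forall>u v. N (H u - H v) \<le> \<phi> (N (u - v)))"

lemma contractiveD: "contractive H \<Longrightarrow> N (H u - H v) \<le> \<phi> (N (u - v))"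
  by (simp add: contractive_def)

lemma contractive_less: "contractive H \<Longrightarrow> u \<noteq> v \<Longrightarrow> N (H u - H v) < N (u - v)"
proof -
  assume H: "contractive H" and "u \<noteq> v"
  then have "N (u - v) > 0" by (simp add: less_le)
  then show ?thesis using less[of "N (u - v)"] contractiveD[OF H, of u v] by linarith
qed

lemma contractive_le: "contractive H \<Longrightarrow> N (H u - H v) \<le> N (u - v)"
  using contractive_less[of H u v] by (cases "u = v") auto

lemma \<phi>_mono: "0 \<le> s \<Longrightarrow> s \<le> t \<Longrightarrow> \<phi> s \<le> \<phi> t"
  using D mono_onD[of "{0..}" \<phi> s t] by (auto simp: D_function_def)

text \<open>
  Since \<open>\<phi> r / r \<le> q < 1\<close> for arbitrarily large \<open>r\<close>, the difference \<open>r - \<phi> r\<close> is unbounded. It need not tend to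
  infinity, which is why the radius is chosen and not merely assumed large.
\<close>

lemma large_radius: "\<exists>R>0. \<eta> \<le> R - \<phi> R"
proof -
  obtain q where q: "Liminf at_top (\<lambda>r. ereal (\<phi> r / r)) < ereal q" "q < 1"
    using ereal_dense2[OF liminf] by auto
  have "\<not> (\<forall>\<^sub>F r in at_top. ereal q \<le> ereal (\<phi> r / r))"
    using q(1) Liminf_bounded[of "ereal q" "\<lambda>r. ereal (\<phi> r / r)" at_top] by auto
  then have "\<exists>r\<ge>M. \<phi> r / r < q" for M
    unfolding eventually_at_top_linorder by (auto simp: not_le)
  then obtain r where r: "r \<ge> max 1 (\<eta> / (1 - q))" "\<phi> r / r < q" by blast
  then have "\<eta> \<le> r * (1 - q)" using q(2) by (simp add: divide_le_eq)
  moreover have "\<phi> r \<le> q * r" using r by (simp add: divide_less_eq)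
  ultimately have "\<eta> \<le> r - \<phi> r" by (simp add: algebra_simps)
  then show ?thesis using r by (intro exI[of _ r]) auto
qed

text \<open>
  The ball around \<open>p\<close> of radius \<open>R\<close> is invariant under \<open>u \<mapsto> w + H u\<close>. By compactness the displacement attains a minimum in
  it; a nonzero minimum would be lowered by one more application of the map (Edelstein's argument).
\<close>

lemma fixed_point_in_ball:
  assumes H: "contractive H" and R: "0 \<le> R" "N (w + H p - p) \<le> R - \<phi> R"
  shows "\<exists>u. u = w + H u \<and> N (u - p) \<le> R"
proof -
  let ?G = "\<lambda>u. w + H u" and ?K = "{u. N (u - p) \<le> R}"
  have inv: "?G u \<in> ?K" if "u \<in> ?K" for u
  proof -
    have "N (?G u - p) \<le> N (?G u - ?G p) + N (?G p - p)" by (rule N_triangle)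
    also have "N (?G u - ?G p) \<le> \<phi> (N (u - p))" using contractiveD[OF H, of u p] by simp
    also have "\<dots> \<le> \<phi> R" using that by (intro \<phi>_mono) auto
    finally show ?thesis using R by simp
  qed
  obtain c where c: "c > 0" "\<And>x. norm x \<le> c * N x" using norm_le_N by blast
  have "bounded ?K"
  proof (rule boundedI)
    fix u assume "u \<in> ?K"
    then have "c * N (u - p) \<le> c * R" using c(1) by simp
    then have "norm (u - p) \<le> c * R" using c(2)[of "u - p"] by linarith
    then show "norm u \<le> norm p + c * R" using norm_triangle_sub[of u p] by linarith
  qed
  moreover have "closed ?K"
    by (intro closed_Collect_le continuous_on_const continuous_on_compose2[OF continuous_on_N[of UNIV]] continuous_intros) auto
  ultimately have "compact ?K" by (simp add: compact_eq_bounded_closed)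
  moreover have "p \<in> ?K" using R(1) by simp
  moreover have "continuous_on ?K (\<lambda>u. N (u - ?G u))"
  proof -
    have "continuous_on UNIV H"
      unfolding continuous_on_def
    proof
      fix x
      have "((\<lambda>u. N (u - x)) \<longlongrightarrow> 0) (at x)" using tendsto_iff_N[of "\<lambda>u. u" x "at x"] by simp
      then have "((\<lambda>u. N (H u - H x)) \<longlongrightarrow> 0) (at x)"
        by (rule tendsto_0_le[where K = 1, OF _ always_eventually]) (simp add: contractive_le[OF H])
      then show "(H \<longlongrightarrow> H x) (at x within UNIV)" using tendsto_iff_N[of H "H x" "at x"] by simp
    qed
    then show ?thesis
      by (intro continuous_on_compose2[OF continuous_on_N[of UNIV]] continuous_intros) (auto intro: continuous_on_subset)
  qed
  ultimately obtain u where u: "u \<in> ?K" "\<And>v. v \<in> ?K \<Longrightarrow> N (u - ?G u) \<le> N (v - ?G v)"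
    using continuous_attains_inf[of ?K "\<lambda>u. N (u - ?G u)"] by blast
  have "u = ?G u"
  proof (rule ccontr)
    assume "u \<noteq> ?G u"
    then have "N (?G u - ?G (?G u)) < N (u - ?G u)" using contractive_less[OF H, of u "?G u"] by simp
    then show False using u(2)[OF inv[OF u(1)]] by simp
  qed
  then show ?thesis using u(1) by auto
qed

lemma fixed_point_unique:
  assumes "contractive H" "u = w + H u" "v = w + H v"
  shows "u = v"
proof (rule ccontr)
  assume "u \<noteq> v"
  then have "N (H u - H v) < N (u - v)" by (rule contractive_less[OF assms(1)])
  moreover have "u - v = H u - H v" using assms(2,3) by (metis add_diff_cancel_left)
  ultimately show False by simp
qed

definition resolvent :: "('a \<Rightarrow> 'a) \<Rightarrow> 'a \<Rightarrow> 'a" where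
  "resolvent H w = (THE u. u = w + H u)"

lemma resolvent_unique: "contractive H \<Longrightarrow> u = w + H u \<Longrightarrow> resolvent H w = u"
  unfolding resolvent_def using fixed_point_unique by (intro the_equality) auto

lemma resolvent_eq:
  assumes "contractive H"
  shows "resolvent H w = w + H (resolvent H w)"
proof -
  obtain R where "0 \<le> R" "N (w + H 0 - 0) \<le> R - \<phi> R" using large_radius by (meson less_imp_le)
  then obtain u where "u = w + H u" using fixed_point_in_ball[OF assms] by blast
  then show ?thesis using resolvent_unique[OF assms] by metis
qed

text \<open>
  A bound that depends on \<open>\<phi>\<close> only, so that it is uniform over all contractive \<open>H\<close>. It cannot be read off from
  the inequality \<open>r - \<phi> r \<le> N (w - w')\<close> for \<open>r = N (resolvent H w - resolvent H w')\<close>, which may also hold for large \<open>r\<close>;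
  it is the existence of a fixed point in the ball of radius \<open>R\<close> that excludes them.
\<close>

lemma resolvent_close:
  assumes H: "contractive H" and R: "0 \<le> R" "N (w - w') \<le> R - \<phi> R"
  shows "N (resolvent H w - resolvent H w') \<le> R"
proof -
  let ?p = "resolvent H w'"
  have "w + H ?p - ?p = w - w'" using resolvent_eq[OF H, of w'] by (simp add: algebra_simps)
  then obtain u where "u = w + H u" "N (u - ?p) \<le> R" using fixed_point_in_ball[OF H R(1), of w ?p] R(2) by metis
  then show ?thesis using resolvent_unique[OF H] by metis
qed

text \<open>
  The limit \<open>x\<close> of the resolvents is itself a resolvent of \<open>H i\<close>, at \<open>w' i = x - H i x\<close>, and
  \<open>w i - w' i\<close> tends to \<open>0\<close>. The general filter covers sequences as well as one-sided limits.
\<close>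

lemma resolvent_tendsto:
  assumes ne: "F \<noteq> bot" and H: "\<forall>\<^sub>F i in F. contractive (H i)"
    and lim: "\<And>v. ((\<lambda>i. H i v) \<longlongrightarrow> H\<^sub>0 v) F" and w: "(w \<longlongrightarrow> w\<^sub>0) F"
  shows "((\<lambda>i. resolvent (H i) (w i)) \<longlongrightarrow> resolvent H\<^sub>0 w\<^sub>0) F"
proof -
  have H0: "contractive H\<^sub>0"
    unfolding contractive_def
  proof (intro allI)
    fix u v
    have "((\<lambda>i. N (H i u - H i v)) \<longlongrightarrow> N (H\<^sub>0 u - H\<^sub>0 v)) F"
      by (rule continuous_on_tendsto_compose[OF continuous_on_N[of UNIV]]) (auto intro!: tendsto_intros lim)
    then show "N (H\<^sub>0 u - H\<^sub>0 v) \<le> \<phi> (N (u - v))"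
      by (rule tendsto_upperbound[OF _ eventually_mono[OF H] ne]) (rule contractiveD)
  qed
  define x where "x = resolvent H\<^sub>0 w\<^sub>0"
  have x: "x = w\<^sub>0 + H\<^sub>0 x" unfolding x_def by (rule resolvent_eq[OF H0])
  define w' where "w' i = x - H i x" for i
  have "((\<lambda>i. w i - w' i) \<longlongrightarrow> w\<^sub>0 - (x - H\<^sub>0 x)) F" unfolding w'_def by (intro tendsto_intros lim w)
  also have "w\<^sub>0 - (x - H\<^sub>0 x) = 0" using x by (simp add: algebra_simps)
  finally have "((\<lambda>i. N (w i - w' i)) \<longlongrightarrow> 0) F"
    using tendsto_iff_N[of "\<lambda>i. w i - w' i" 0] by simp
  then have small: "\<forall>\<^sub>F i in F. N (w i - w' i) < e" if "e > 0" for e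
    using that by (rule order_tendstoD(2))
  have "((\<lambda>i. N (resolvent (H i) (w i) - x)) \<longlongrightarrow> 0) F"
  proof (rule tendstoI)
    fix e :: real assume "e > 0"
    define R where "R = e / 2"
    have "R > 0" "R < e" using \<open>e > 0\<close> by (auto simp: R_def)
    have "\<forall>\<^sub>F i in F. N (w i - w' i) < R - \<phi> R" using less[OF \<open>R > 0\<close>] by (intro small) simp
    with H show "\<forall>\<^sub>F i in F. dist (N (resolvent (H i) (w i) - x)) 0 < e"
    proof eventually_elim
      case (elim i)
      have "resolvent (H i) (w' i) = x" using resolvent_unique[OF elim(1), of x "w' i"] by (simp add: w'_def)
      then show ?case using resolvent_close[OF elim(1), of R "w i" "w' i"] elim(2) \<open>R > 0\<close> \<open>R < e\<close> by simp
    qed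
  qed
  then show ?thesis unfolding x_def using tendsto_iff_N[of "\<lambda>i. resolvent (H i) (w i)" "resolvent H\<^sub>0 w\<^sub>0"] by simp
qed

end

section \<open>Regulated families of contractions\<close>

lemma regulated_on_cong:
  assumes "regulated_on a b x" "\<And>t. t \<in> {a..b} \<Longrightarrow> x t = x' t"
  shows "regulated_on a b x'"
  unfolding regulated_on_def
proof (intro conjI ballI)
  fix t assume t: "t \<in> {a<..b}"
  then have "\<forall>\<^sub>F s in at_left t. s \<in> {a<..<t}" using eventually_at_left_real[of a t] by simp
  then have "\<forall>\<^sub>F s in at_left t. x s = x' s" by eventually_elim (use t assms(2) in auto)
  then show "\<exists>l. (x' \<longlongrightarrow> l) (at_left t)"
    using assms(1) t Lim_transform_eventually unfolding regulated_on_def by blast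
next
  fix t assume t: "t \<in> {a..<b}"
  then have "\<forall>\<^sub>F s in at_right t. s \<in> {t<..<b}" using eventually_at_right_real[of t b] by simp
  then have "\<forall>\<^sub>F s in at_right t. x s = x' s" by eventually_elim (use t assms(2) in auto)
  then show "\<exists>l. (x' \<longlongrightarrow> l) (at_right t)"
    using assms(1) t Lim_transform_eventually unfolding regulated_on_def by blast
qed

lemma regulated_on_diff:
  assumes "regulated_on a b x" "regulated_on a b x'"
  shows "regulated_on a b (\<lambda>t. x t - x' t)"
proof -
  have "\<exists>l. ((\<lambda>t. x t - x' t) \<longlongrightarrow> l) F" if "\<exists>l. (x \<longlongrightarrow> l) F" "\<exists>l. (x' \<longlongrightarrow> l) F" for F
    using that tendsto_diff by blast
  then show ?thesis using assms unfolding regulated_on_def by blast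
qed

lemma regulated_on_const_add:
  assumes "regulated_on a b x"
  shows "regulated_on a b (\<lambda>t. c + x t)"
proof -
  have "\<exists>l. ((\<lambda>t. c + x t) \<longlongrightarrow> l) F" if "\<exists>l. (x \<longlongrightarrow> l) F" for F
    using that tendsto_add[OF tendsto_const] by blast
  then show ?thesis using assms unfolding regulated_on_def by blast
qed

context finite_dim_norm
begin

lemma ks_integral_eq:
  assumes "a \<le> b" "has_ks_integral norm F g a b I"
  shows "ks_integral N F g a b = I"
  unfolding ks_integral_def has_ks_integral_iff_norm
  using assms has_ks_integral_unique by (intro the_equality) auto

lemma ks_integrable_imp_primitive:
  assumes "a \<le> b" "ks_integrable N F g a b"
  shows "\<exists>P. ks_primitive g a b F P \<and>
    (\<forall>c d. a \<le> c \<and> c \<le> d \<and> d \<le> b \<longrightarrow> ks_integral N F g c d = P d - P c)"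
proof -
  obtain P where "ks_primitive g a b F P"
    using henstock[OF assms(1)] assms(2) unfolding ks_integrable_def has_ks_integral_iff_norm by blast
  then show ?thesis using ks_primitive_imp_integral ks_integral_eq by blast
qed

end

context nonlinear_contraction
begin

text \<open>
  The exceptional set collects the discontinuities of \<open>h(\<cdot>, d)\<close> for \<open>d\<close> in a countable dense set; the
  contractions \<open>h t\<close> are equicontinuous, which extends continuity in \<open>t\<close> to all \<open>v\<close>.
\<close>

lemma contractive_family_countable_discont:
  assumes ab: "a \<le> b" and h: "\<And>t. t \<in> {a..b} \<Longrightarrow> contractive (h t)"
    and reg: "\<And>v. regulated_on a b (\<lambda>t. h t v)"
  shows "\<exists>Z. countable Z \<and> (\<forall>s\<in>{a..b} - Z. \<forall>l v. range l \<subseteq> {a..b} \<longrightarrow> l \<longlonglongrightarrow> s \<longrightarrow>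
    (\<lambda>n. h (l n) v) \<longlonglongrightarrow> h s v)"
proof -
  obtain D :: "'a set" where D: "countable D" "\<And>X. open X \<Longrightarrow> X \<noteq> {} \<Longrightarrow> \<exists>d\<in>D. d \<in> X"
    using countable_dense_exists by blast
  define Z where "Z = (\<Union>d\<in>D. {s \<in> {a..b}. \<not> continuous (at s within {a..b}) (\<lambda>t. h t d)})"
  have "countable Z" unfolding Z_def
    using D(1) regulated_countable_discont[OF reg ab] by (intro countable_UN)
  moreover have "(\<lambda>n. h (l n) v) \<longlonglongrightarrow> h s v"
    if s: "s \<in> {a..b} - Z" and l: "range l \<subseteq> {a..b}" "l \<longlonglongrightarrow> s" for s l v
  proof -
    obtain C where C: "C > 0" "\<And>x. N x \<le> C * norm x" using N_le_norm by blast
    have "(\<lambda>n. N (h (l n) v - h s v)) \<longlonglongrightarrow> 0"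
    proof (rule tendstoI)
      fix e :: real assume "e > 0"
      then have "e / (3 * C) > 0" using C(1) by simp
      then have "ball v (e / (3 * C)) \<noteq> {}" by simp
      then obtain d where d: "d \<in> D" "dist v d < e / (3 * C)" using D(2)[OF open_ball] by fastforce
      have "N (v - d) \<le> C * norm (v - d)" by (rule C(2))
      also have "\<dots> < C * (e / (3 * C))"
        using d(2) C(1) by (intro mult_strict_left_mono) (auto simp: dist_norm)
      finally have vd: "N (v - d) < e / 3" using C(1) by simp
      have "continuous (at s within {a..b}) (\<lambda>t. h t d)" using s d(1) by (auto simp: Z_def)
      then have "(\<lambda>n. h (l n) d) \<longlonglongrightarrow> h s d"
        using continuous_within_tendsto_compose'[of s "{a..b}" "\<lambda>t. h t d" l sequentially]
          l(2) range_subsetD[OF l(1)] by blast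
      then have "(\<lambda>n. N (h (l n) d - h s d)) \<longlonglongrightarrow> 0" by (rule iffD1[OF tendsto_iff_N])
      then have "\<forall>\<^sub>F n in sequentially. N (h (l n) d - h s d) < e / 3"
        using \<open>e > 0\<close> by (intro order_tendstoD(2)) auto
      then show "\<forall>\<^sub>F n in sequentially. dist (N (h (l n) v - h s v)) 0 < e"
      proof eventually_elim
        case (elim n)
        have "l n \<in> {a..b}" "s \<in> {a..b}" using range_subsetD[OF l(1)] s by blast+
        then have "N (h (l n) v - h (l n) d) \<le> N (v - d)" "N (h s d - h s v) \<le> N (v - d)"
          using contractive_le[OF h, of "l n" v d] contractive_le[OF h, of s d v] N_diff_commute[of d v] by auto
        then show ?case
          using elim vd N_triangle[of "h (l n) v" "h s v" "h (l n) d"] N_triangle[of "h (l n) d" "h s v" "h s d"]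
          by simp
      qed
    qed
    then show ?thesis by (rule iffD2[OF tendsto_iff_N])
  qed
  ultimately show ?thesis by blast
qed

lemma resolvent_regulated:
  assumes h: "\<And>t. t \<in> {a..b} \<Longrightarrow> contractive (h t)"
    and reg: "\<And>v. regulated_on a b (\<lambda>t. h t v)" and w: "regulated_on a b w"
  shows "regulated_on a b (\<lambda>t. resolvent (h t) (w t))"
proof -
  have lim: "\<exists>l. ((\<lambda>t. resolvent (h t) (w t)) \<longlongrightarrow> l) F"
    if F: "F \<noteq> bot" "\<forall>\<^sub>F t in F. t \<in> {a..b}" and lw: "\<exists>l. (w \<longlongrightarrow> l) F"
      and lh: "\<And>v. \<exists>l. ((\<lambda>t. h t v) \<longlongrightarrow> l) F" for F
  proof -
    obtain H\<^sub>0 where "\<And>v. ((\<lambda>t. h t v) \<longlongrightarrow> H\<^sub>0 v) F" using lh by metis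
    moreover obtain l where "(w \<longlongrightarrow> l) F" using lw by blast
    moreover have "\<forall>\<^sub>F t in F. contractive (h t)" using F(2) by eventually_elim (rule h)
    ultimately show ?thesis using resolvent_tendsto[OF F(1)] by blast
  qed
  show ?thesis
    unfolding regulated_on_def
  proof (intro conjI ballI)
    fix t assume t: "t \<in> {a<..b}"
    then have "\<forall>\<^sub>F s in at_left t. s \<in> {a<..<t}" using eventually_at_left_real[of a t] by simp
    then have "\<forall>\<^sub>F s in at_left t. s \<in> {a..b}" by eventually_elim (use t in auto)
    then show "\<exists>l. ((\<lambda>t. resolvent (h t) (w t)) \<longlongrightarrow> l) (at_left t)"
      using t reg w by (intro lim) (auto simp: regulated_on_def)
  next
    fix t assume t: "t \<in> {a..<b}"
    then have "\<forall>\<^sub>F s in at_right t. s \<in> {t<..<b}" using eventually_at_right_real[of t b] by simp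
    then have "\<forall>\<^sub>F s in at_right t. s \<in> {a..b}" by eventually_elim (use t in auto)
    then show "\<exists>l. ((\<lambda>t. resolvent (h t) (w t)) \<longlongrightarrow> l) (at_right t)"
      using t reg w by (intro lim) (auto simp: regulated_on_def)
  qed
qed

section \<open>Existence of solutions\<close>

text \<open>
  The problem after the substitution \<open>x s = resolvent (h s) (w\<^sub>0 + y s)\<close>. The countable set \<open>C\<close> that the grids
  exhaust is made such that at each \<open>s\<close> either the grid point before \<open>s\<close> is finally \<open>s\<close> itself,
  or \<open>m\<close> (which controls all \<open>z n\<close>) and \<open>h(\<cdot>, v)\<close> are continuous at \<open>s\<close>.
\<close>

lemma exists_primitive_solution:
  fixes f h :: "real \<Rightarrow> 'a \<Rightarrow> 'a"
  assumes ab: "a < b" and g: "mono_on {a..b} g"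
    and left: "\<And>t. t \<in> {a<..b} \<Longrightarrow> (g \<longlongrightarrow> g t) (at_left t)"
    and m: "mono_on {a..b} m"
    and f: "\<And>t. t \<in> {a..b} \<Longrightarrow> continuous_on UNIV (f t)"
    and K: "\<And>u. ks_primitive g a b (\<lambda>s. f s u) (K u)" "\<And>u. dominated m a b 1 (K u)"
    and h: "\<And>t. t \<in> {a..b} \<Longrightarrow> contractive (h t)"
    and reg: "\<And>v. regulated_on a b (\<lambda>t. h t v)"
  shows "\<exists>y. y a = 0 \<and> dominated m a b 1 y \<and>
    ks_primitive g a b (\<lambda>s. f s (resolvent (h s) (w\<^sub>0 + y s))) y"
proof -
  obtain Z where Z: "countable Z" and "\<forall>s\<in>{a..b} - Z. \<forall>l v. range l \<subseteq> {a..b} \<longrightarrow> l \<longlonglongrightarrow> s \<longrightarrow>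
    (\<lambda>n. h (l n) v) \<longlonglongrightarrow> h s v"
    using contractive_family_countable_discont[of a b h] ab h reg by auto
  then have h_lim: "\<And>s l v. s \<in> {a..b} - Z \<Longrightarrow> range l \<subseteq> {a..b} \<Longrightarrow> l \<longlonglongrightarrow> s \<Longrightarrow>
    (\<lambda>n. h (l n) v) \<longlonglongrightarrow> h s v" by blast
  define C where "C = (\<rat> \<inter> {a..b}) \<union> {s \<in> {a..b}. \<not> continuous (at s within {a..b}) m} \<union> Z"
  have C: "countable C" "\<rat> \<inter> {a..b} \<subseteq> C"
    using Z countable_rat countable_mono_discont[OF m] by (auto simp: C_def intro: countable_subset)
  define p where "p n s = last_before a (grid a b C n) s" for n s
  define \<Psi> where "\<Psi> s v = resolvent (h s) (w\<^sub>0 + v)" for s v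
  have "\<exists>z. z a = 0 \<and> dominated m a b 1 z \<and> ks_primitive g a b (\<lambda>s. f s (\<Psi> (p n s) (z (p n s)))) z" for n
    unfolding p_def by (rule euler_primitive[OF ab g left m K]) (auto simp: grid_def)
  then obtain z where z: "\<And>n. z n a = 0" "\<And>n. dominated m a b 1 (z n)"
    "\<And>n. ks_primitive g a b (\<lambda>s. f s (\<Psi> (p n s) (z n (p n s)))) (z n)" by metis
  obtain r y where r: "strict_mono (r :: nat \<Rightarrow> nat)"
    and y: "\<And>t. t \<in> {a..b} \<Longrightarrow> (\<lambda>n. z (r n) t) \<longlonglongrightarrow> y t"
    using dominated_convergent_subsequence[OF ab m, of z] z(1,2) by blast
  have p_mem: "p n s \<in> {a..b}" if "s \<in> {a..b}" for n s
    using last_before(2,3)[where S = "grid a b C n" and a = a and s = s] that by (simp add: p_def)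
  have lim: "(\<lambda>n. \<Psi> (p (r n) s) (z (r n) (p (r n) s))) \<longlonglongrightarrow> \<Psi> s (y s)" if s: "s \<in> {a..b}" for s
  proof -
    have "(\<lambda>n. h (p (r n) s) v) \<longlonglongrightarrow> h s v \<and> (\<lambda>n. z (r n) (p (r n) s)) \<longlonglongrightarrow> y s" for v
    proof (cases "s \<in> C")
      case True
      have "\<forall>\<^sub>F n in sequentially. p n s = s"
        unfolding p_def by (rule last_before_grid_eventually_eq[OF C(1) True s])
      then have ev: "\<forall>\<^sub>F n in sequentially. p (r n) s = s"
        by (rule eventually_subseq[OF r])
      have "(\<lambda>n. h (p (r n) s) v) \<longlonglongrightarrow> h s v"
        by (rule tendsto_eventually) (use ev in eventually_elim, simp)
      moreover have "(\<lambda>n. z (r n) (p (r n) s)) \<longlonglongrightarrow> y s"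
        by (rule Lim_transform_eventually[OF y[OF s]]) (use ev in eventually_elim, simp)
      ultimately show ?thesis by blast
    next
      case False
      have "(\<lambda>n. p n s) \<longlonglongrightarrow> s"
        unfolding p_def by (rule last_before_grid_tendsto[OF C s])
      then have ps: "(\<lambda>n. p (r n) s) \<longlonglongrightarrow> s"
        using LIMSEQ_subseq_LIMSEQ[OF _ r] by (simp add: comp_def)
      have "(\<lambda>n. h (p (r n) s) v) \<longlonglongrightarrow> h s v"
        by (rule h_lim[OF _ _ ps]) (use p_mem[OF s] False s in \<open>auto simp: C_def\<close>)
      moreover have "continuous (at s within {a..b}) m" using False s by (auto simp: C_def)
      then have "(\<lambda>n. m (p (r n) s)) \<longlonglongrightarrow> m s"
        using continuous_within_tendsto_compose'[of s "{a..b}" m "\<lambda>n. p (r n) s" sequentially] ps p_mem[OF s] by auto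
      then have "(\<lambda>n. m (p (r n) s) - m s) \<longlonglongrightarrow> 0" by (rule LIM_zero)
      then have "(\<lambda>n. z (r n) (p (r n) s) - z (r n) s) \<longlonglongrightarrow> 0"
        by (rule tendsto_0_le[where K = 1, OF _ always_eventually])
          (use dominated_dist_le[OF z(2) s p_mem[OF s]] in auto)
      from tendsto_add[OF this y[OF s]] have "(\<lambda>n. z (r n) (p (r n) s)) \<longlonglongrightarrow> y s" by simp
      ultimately show ?thesis by blast
    qed
    then show ?thesis
      unfolding \<Psi>_def using h[OF p_mem[OF s]]
      by (intro resolvent_tendsto tendsto_add tendsto_const) (auto intro: always_eventually)
  qed
  have "ks_primitive g a b (\<lambda>s. f s (\<Psi> s (y s))) y"
  proof (rule ks_primitive_dominated_limit[OF less_imp_le[OF ab] g m, where P = "\<lambda>n. z (r n)"])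
    show "ks_primitive g a b (\<lambda>s. f s (\<Psi> (p (r n) s) (z (r n) (p (r n) s)))) (z (r n))" for n by (rule z)
    show "(\<lambda>n. f t (\<Psi> (p (r n) t) (z (r n) (p (r n) t)))) \<longlonglongrightarrow> f t (\<Psi> t (y t))" if "t \<in> {a..b}" for t
      by (rule continuous_on_tendsto_compose[OF f[OF that] lim[OF that]]) auto
  qed (use z y in auto)
  moreover have "dominated m a b 1 y"
    unfolding dominated_def
  proof (intro allI impI, elim conjE)
    fix s t assume st: "a \<le> s" "s \<le> t" "t \<le> b"
    show "norm (y t - y s) \<le> 1 * (m t - m s)"
    proof (rule LIMSEQ_le_const2)
      show "(\<lambda>n. norm (z (r n) t - z (r n) s)) \<longlonglongrightarrow> norm (y t - y s)"
        using st by (intro tendsto_intros y) auto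
    qed (use dominatedD[OF z(2) st] in blast)
  qed
  moreover have "y a = 0" using y[of a] z(1) ab LIMSEQ_unique[of "\<lambda>n. 0"] by auto
  ultimately show ?thesis unfolding \<Psi>_def by blast
qed

end

theorem theorem3p10:
  fixes N :: "real^'n \<Rightarrow> real"
    and t\<^sub>0 a :: real
    and g :: "real \<Rightarrow> real"
    and x\<^sub>0 :: "real^'n"
    and f h :: "real \<Rightarrow> real^'n \<Rightarrow> real^'n"
    and \<phi> :: "real \<Rightarrow> real"
  assumes norm_N: "is_norm N"
    and a_pos: "a > 0"
    and g_mono: "mono_on {t\<^sub>0..t\<^sub>0 + a} g"
    and g_left_cont: "\<forall>t\<in>{t\<^sub>0<..t\<^sub>0 + a}. (g \<longlongrightarrow> g t) (at_left t)"
    and A0: "\<forall>t\<in>{t\<^sub>0..t\<^sub>0 + a}. continuous_on UNIV (f t)"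
    and A1: "\<forall>u. ks_integrable N (\<lambda>s. f s u) g t\<^sub>0 (t\<^sub>0 + a)"
    and A2: "\<exists>M :: real \<Rightarrow> real.
               (\<forall>s\<in>{t\<^sub>0..t\<^sub>0 + a}. 0 \<le> M s) \<and>
               ks_integrable abs M g t\<^sub>0 (t\<^sub>0 + a) \<and>
               (\<forall>u c d. t\<^sub>0 \<le> c \<and> c \<le> d \<and> d \<le> t\<^sub>0 + a \<longrightarrow>
                  N (ks_integral N (\<lambda>s. f s u) g c d) \<le> ks_integral abs M g c d)"
    and A3_regulated: "\<forall>v. regulated_on t\<^sub>0 (t\<^sub>0 + a) (\<lambda>t. h t v)"
    and A3_D_function: "D_function \<phi>"
    and A3_less: "\<forall>t>0. \<phi> t < t"
    and A3_contraction: "\<forall>t\<in>{t\<^sub>0..t\<^sub>0 + a}. \<forall>u v. N (h t u - h t v) \<le> \<phi> (N (u - v))"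
    and liminf_less: "Liminf at_top (\<lambda>r. ereal (\<phi> r / r)) < 1"
  shows "\<exists>x. is_solution N t\<^sub>0 a g f h x\<^sub>0 x"
proof -
  interpret nonlinear_contraction N \<phi>
    using norm_N A3_D_function A3_less liminf_less by unfold_locales auto
  interpret real: finite_dim_norm "abs :: real \<Rightarrow> real"
    by unfold_locales (auto simp: is_norm_def abs_mult)
  define b where "b = t\<^sub>0 + a"
  have ab: "t\<^sub>0 < b" using a_pos by (simp add: b_def)
  obtain M where M: "ks_integrable abs M g t\<^sub>0 b" and
    M_le: "\<And>u c d. t\<^sub>0 \<le> c \<Longrightarrow> c \<le> d \<Longrightarrow> d \<le> b \<Longrightarrow> N (ks_integral N (\<lambda>s. f s u) g c d) \<le> ks_integral abs M g c d"
    using A2 unfolding b_def by blast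
  obtain m where m: "\<And>c d. t\<^sub>0 \<le> c \<Longrightarrow> c \<le> d \<Longrightarrow> d \<le> b \<Longrightarrow> ks_integral abs M g c d = m d - m c"
    using real.ks_integrable_imp_primitive[OF less_imp_le[OF ab] M] by blast
  have "\<forall>u. \<exists>P. ks_primitive g t\<^sub>0 b (\<lambda>s. f s u) P \<and>
    (\<forall>c d. t\<^sub>0 \<le> c \<and> c \<le> d \<and> d \<le> b \<longrightarrow> ks_integral N (\<lambda>s. f s u) g c d = P d - P c)"
    using ks_integrable_imp_primitive[OF less_imp_le[OF ab]] A1 by (simp add: b_def)
  then obtain K where "\<forall>u. ks_primitive g t\<^sub>0 b (\<lambda>s. f s u) (K u) \<and>
    (\<forall>c d. t\<^sub>0 \<le> c \<and> c \<le> d \<and> d \<le> b \<longrightarrow> ks_integral N (\<lambda>s. f s u) g c d = K u d - K u c)"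
    by (rule choice[THEN exE])
  then have K: "\<And>u. ks_primitive g t\<^sub>0 b (\<lambda>s. f s u) (K u)"
    and K_eq: "\<And>u c d. t\<^sub>0 \<le> c \<Longrightarrow> c \<le> d \<Longrightarrow> d \<le> b \<Longrightarrow> ks_integral N (\<lambda>s. f s u) g c d = K u d - K u c"
    by blast+
  have K_le: "N (K u d - K u c) \<le> m d - m c" if "t\<^sub>0 \<le> c" "c \<le> d" "d \<le> b" for u c d
    using M_le[OF that, of u] m[OF that] K_eq[OF that, of u] by simp
  obtain c where c: "c > 0" "\<And>x. norm x \<le> c * N x" using norm_le_N by blast
  have m_mono: "mono_on {t\<^sub>0..b} (\<lambda>t. c * m t)"
  proof (rule mono_onI)
    fix s t assume "s \<in> {t\<^sub>0..b}" "t \<in> {t\<^sub>0..b}" "s \<le> t"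
    then have "0 \<le> m t - m s" using order.trans[OF N_nonneg K_le[of s t 0]] by auto
    then show "c * m s \<le> c * m t" using c(1) by simp
  qed
  have dom: "dominated (\<lambda>t. c * m t) t\<^sub>0 b 1 (K u)" for u
    unfolding dominated_def
  proof (intro allI impI, elim conjE)
    fix s t assume st: "t\<^sub>0 \<le> s" "s \<le> t" "t \<le> b"
    have "norm (K u t - K u s) \<le> c * N (K u t - K u s)" by (rule c(2))
    also have "\<dots> \<le> c * (m t - m s)" using K_le[OF st] c(1) by simp
    finally show "norm (K u t - K u s) \<le> 1 * (c * m t - c * m s)" by (simp add: algebra_simps)
  qed
  have h: "contractive (h t)" if "t \<in> {t\<^sub>0..b}" for t
    using A3_contraction that by (simp add: contractive_def b_def)
  have reg: "regulated_on t\<^sub>0 b (\<lambda>t. h t v)" for v using A3_regulated by (simp add: b_def)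
  define w\<^sub>0 where "w\<^sub>0 = x\<^sub>0 - h t\<^sub>0 x\<^sub>0"
  have "\<exists>y. y t\<^sub>0 = 0 \<and> dominated (\<lambda>t. c * m t) t\<^sub>0 b 1 y \<and>
    ks_primitive g t\<^sub>0 b (\<lambda>s. f s (resolvent (h s) (w\<^sub>0 + y s))) y"
  proof (rule exists_primitive_solution[OF ab _ _ m_mono _ K dom h reg])
    show "mono_on {t\<^sub>0..b} g" using g_mono by (simp add: b_def)
    show "(g \<longlongrightarrow> g t) (at_left t)" if "t \<in> {t\<^sub>0<..b}" for t using g_left_cont that by (simp add: b_def)
    show "continuous_on UNIV (f t)" if "t \<in> {t\<^sub>0..b}" for t using A0 that by (simp add: b_def)
  qed
  then obtain y where y0: "y t\<^sub>0 = 0" and y_dom: "dominated (\<lambda>t. c * m t) t\<^sub>0 b 1 y"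
    and y_prim: "ks_primitive g t\<^sub>0 b (\<lambda>s. f s (resolvent (h s) (w\<^sub>0 + y s))) y"
    by blast
  define x where "x t = resolvent (h t) (w\<^sub>0 + y t)" for t
  have x_eq: "x t = w\<^sub>0 + y t + h t (x t)" if "t \<in> {t\<^sub>0..b}" for t
    unfolding x_def by (rule resolvent_eq[OF h[OF that]])
  have x0: "x t\<^sub>0 = x\<^sub>0"
    unfolding x_def using ab y0 by (intro resolvent_unique h) (auto simp: w\<^sub>0_def)
  have y_reg: "regulated_on t\<^sub>0 b y" by (rule dominated_regulated[OF m_mono y_dom])
  have w_reg: "regulated_on t\<^sub>0 b (\<lambda>t. w\<^sub>0 + y t)"
    by (rule regulated_on_const_add[OF y_reg])
  then have x_reg: "regulated_on t\<^sub>0 b x"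
    unfolding x_def by (intro resolvent_regulated h reg)
  from regulated_on_diff[OF this w_reg]
  have hx_reg: "regulated_on t\<^sub>0 b (\<lambda>t. h t (x t))"
    by (rule regulated_on_cong) (use x_eq in \<open>metis add_diff_cancel_left'\<close>)
  have "ks_integrable N (\<lambda>s. f s (x s)) g t\<^sub>0 t \<and>
     x t = x\<^sub>0 - h t\<^sub>0 (x t\<^sub>0) + h t (x t) + ks_integral N (\<lambda>s. f s (x s)) g t\<^sub>0 t"
    if t: "t \<in> {t\<^sub>0..b}" for t
  proof -
    have I: "has_ks_integral norm (\<lambda>s. f s (x s)) g t\<^sub>0 t (y t)"
      using ks_primitive_imp_integral[OF y_prim, of t\<^sub>0 t] t y0 by (simp add: x_def)
    then have "ks_integral N (\<lambda>s. f s (x s)) g t\<^sub>0 t = y t"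
      using t by (intro ks_integral_eq) auto
    moreover have "ks_integrable N (\<lambda>s. f s (x s)) g t\<^sub>0 t"
      using I has_ks_integral_iff_norm unfolding ks_integrable_def by blast
    ultimately show ?thesis using x_eq[OF t] x0 by (simp add: w\<^sub>0_def algebra_simps)
  qed
  then have "is_solution N t\<^sub>0 a g f h x\<^sub>0 x"
    using x_reg hx_reg x0 unfolding is_solution_def b_def by blast
  then show ?thesis by blast
qed

end
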